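(* Let $\mathbb{K}$ be a field, let $d\ge1$ be an integer, and let $S=\mathbb{K}[x_{ij}\mid i\in[n],\,j\in[d]]$ be the polynomial ring with the $\mathbb{Z}^n$-multigrading induced by $\deg(x_{ij})=\mathfrak{e}_i\in\mathbb{Z}^n$. Let $H=(V=[n],E)$ be a good forest. Then the ideal $L_H^{\mathbb{K}}(d)\subset S$ is a Cartwright–Sturmfels ideal.
   Context: $[n]=\{1,\dots,n\}$ and $\mathfrak{e}_i$ is the $i$-th standard basis vector of $\mathbb{Z}^n$. A hypergraph is $r$-uniform ($r>1$) if every edge has exactly $r$ vertices. An $r$-uniform hypergraph $H=(V,E)$ with $m=|E|$ is a good forest if its edges can be ordered $e_1,\dots,e_m$ so that $|(e_1\cup\dots\cup e_i)\cap e_{i+1}|\le1$ for all $1\le i\le m-1$. For $e\subset[n]$ put $f_e^{(d)}=\sum_{j=1}^{d}\prod_{i\in e}x_{ij}\in S$; the Lovász–Saks–Schrijver (LSS) ideal is $L_H^{\mathbb{K}}(d)=(f_e^{(d)}\mid e\in E)$. A $\mathbb{Z}^n$-graded ideal $I$ of $S$ is a Cartwright–Sturmfels ideal if there exists a radical Borel-fixed ideal $J$ of $S$ with the same $\mathbb{Z}^n$-multigraded Hilbert series as $I$. Here Borel-fixed is in the multigraded sense: $J$ is stable under the Borel subgroup $B_d(\mathbb{K})^n$ of $\mathrm{GL}_d(\mathbb{K})^n$ ($B_d(\mathbb{K})$ the upper triangular invertible matrices), where the $i$-th factor acts by linear substitutions on the variables $x_{i1},\dots,x_{id}$ of degree $\mathfrak{e}_i$.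 *)

theory Defs
  imports "HOL-Library.Poly_Mapping" "HOL-Analysis.Cartesian_Space"
begin

text \<open>
  The index set \<open>[n]\<close> is an arbitrary finite type \<open>'n\<close>, and \<open>[d]\<close> is an arbitrary finite
  linearly ordered type \<open>'d\<close>; the order is only used to speak about upper triangular matrices.
  The polynomial ring \<open>S = K[x\<^sub>i\<^sub>j]\<close> is the type of finitely supported maps from monomials
  (exponent vectors) to coefficients.
\<close>

type_synonym ('n, 'd) mon = "('n \<times> 'd) \<Rightarrow>\<^sub>0 nat"
type_synonym ('n, 'd, 'k) mpoly = "('n, 'd) mon \<Rightarrow>\<^sub>0 'k"

definition const :: "'k::comm_ring_1 \<Rightarrow> ('n, 'd, 'k) mpoly" where
  "const c = Poly_Mapping.single 0 c"

definition var :: "'n \<Rightarrow> 'd \<Rightarrow> ('n, 'd, 'k::comm_ring_1) mpoly" where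
  "var i j = Poly_Mapping.single (Poly_Mapping.single (i, j) 1) 1"

definition pscale :: "'k::comm_ring_1 \<Rightarrow> ('n, 'd, 'k) mpoly \<Rightarrow> ('n, 'd, 'k) mpoly" where
  "pscale c p = const c * p"

lemma vector_space_pscale:
  "vector_space (pscale :: 'k::field \<Rightarrow> ('n, 'd, 'k) mpoly \<Rightarrow> ('n, 'd, 'k) mpoly)"
  by unfold_locales
    (simp_all add: pscale_def const_def distrib_left single_add distrib_right
      mult_single flip: mult.assoc)

lemma module_mult: "module ((*) :: 'a::comm_ring_1 \<Rightarrow> 'a \<Rightarrow> 'a)"
  by unfold_locales (simp_all add: algebra_simps)


subsection \<open>Ideals\<close>

text \<open>Ideals of a commutative ring are its submodules, the ring acting on itself by multiplication.\<close>

definition is_ideal :: "'a::comm_ring_1 set \<Rightarrow> bool" where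
  "is_ideal I \<longleftrightarrow> module.subspace (*) I"

definition ideal_gen :: "'a::comm_ring_1 set \<Rightarrow> 'a set" where
  "ideal_gen F = module.span (*) F"

definition is_radical :: "'a::comm_ring_1 set \<Rightarrow> bool" where
  "is_radical J \<longleftrightarrow> (\<forall>p k. p ^ k \<in> J \<longrightarrow> p \<in> J)"


subsection \<open>The multigrading and Hilbert series\<close>

definition mdeg :: "('n, 'd::finite) mon \<Rightarrow> 'n \<Rightarrow> int" where
  "mdeg m = (\<lambda>i. \<Sum>j\<in>UNIV. int (Poly_Mapping.lookup m (i, j)))"

definition graded_piece :: "('n \<Rightarrow> int) \<Rightarrow> ('n, 'd::finite, 'k::comm_ring_1) mpoly set" where
  "graded_piece a = {p. \<forall>m\<in>Poly_Mapping.keys p. mdeg m = a}"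

definition hom_component ::
    "('n \<Rightarrow> int) \<Rightarrow> ('n, 'd::finite, 'k::comm_ring_1) mpoly \<Rightarrow> ('n, 'd, 'k) mpoly" where
  "hom_component a p =
    (\<Sum>m\<in>{m\<in>Poly_Mapping.keys p. mdeg m = a}. Poly_Mapping.single m (Poly_Mapping.lookup p m))"

definition is_graded_ideal :: "('n, 'd::finite, 'k::comm_ring_1) mpoly set \<Rightarrow> bool" where
  "is_graded_ideal I \<longleftrightarrow> is_ideal I \<and> (\<forall>p\<in>I. \<forall>a. hom_component a p \<in> I)"

text \<open>
  The multigraded Hilbert series \<open>\<Sum>\<^sub>a dim I\<^sub>a y\<^sup>a\<close> of \<open>I\<close>, as the formal series given by its
  coefficient function. All \<open>I\<^sub>a\<close> are finite-dimensional, so the convention that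
  \<open>dim = 0\<close> in infinite dimension plays no role.
\<close>

definition hilbert_series ::
    "('n::finite, 'd::finite, 'k::field) mpoly set \<Rightarrow> ('n \<Rightarrow> int) \<Rightarrow> nat" where
  "hilbert_series I = (\<lambda>a. vector_space.dim pscale (I \<inter> graded_piece a))"


subsection \<open>Borel-fixed and Cartwright--Sturmfels ideals\<close>

definition poly_subst ::
    "('n \<Rightarrow> 'd \<Rightarrow> ('n, 'd, 'k::comm_ring_1) mpoly) \<Rightarrow> ('n, 'd, 'k) mpoly \<Rightarrow> ('n, 'd, 'k) mpoly" where
  "poly_subst \<phi> p =
    (\<Sum>m\<in>Poly_Mapping.keys p. const (Poly_Mapping.lookup p m) *
      (\<Prod>(i, j)\<in>Poly_Mapping.keys m. \<phi> i j ^ Poly_Mapping.lookup m (i, j)))"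

definition borel_group :: "(('k::field, 'd::{finite,linorder}) vec, 'd) vec set" where
  "borel_group = {A. invertible A \<and> (\<forall>k j. j < k \<longrightarrow> A $ k $ j = 0)}"

text \<open>
  \<open>g i\<close> is the matrix of the \<open>i\<close>-th factor with respect to the basis \<open>x\<^sub>i\<^sub>j\<close>, \<open>j \<in> [d]\<close>, of the
  space of linear forms of degree \<open>e\<^sub>i\<close>: the image of \<open>x\<^sub>i\<^sub>j\<close> is read off from the \<open>j\<close>-th column.
\<close>

definition gl_act ::
    "('n \<Rightarrow> 'k::field ^ 'd::finite ^ 'd) \<Rightarrow> ('n, 'd, 'k) mpoly \<Rightarrow> ('n, 'd, 'k) mpoly" where
  "gl_act g = poly_subst (\<lambda>i j. \<Sum>k\<in>UNIV. const (g i $ k $ j) * var i k)"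

definition borel_fixed :: "('n, 'd::{finite,linorder}, 'k::field) mpoly set \<Rightarrow> bool" where
  "borel_fixed J \<longleftrightarrow> (\<forall>g. (\<forall>i. g i \<in> borel_group) \<longrightarrow> gl_act g ` J \<subseteq> J)"

text \<open>
  The ideal \<open>J\<close> has to be multigraded for its Hilbert series to make sense. Over an infinite field
  this already follows from being Borel-fixed, over a finite field it does not.
\<close>

definition cartwright_sturmfels ::
    "('n::finite, 'd::{finite,linorder}, 'k::field) mpoly set \<Rightarrow> bool" where
  "cartwright_sturmfels I \<longleftrightarrow>
    is_graded_ideal I \<and>
    (\<exists>J :: ('n, 'd, 'k) mpoly set. is_graded_ideal J \<and> is_radical J \<and> borel_fixed J \<and>
      hilbert_series J = hilbert_series I)"


subsection \<open>Good forests and LSS ideals\<close>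

text \<open>A hypergraph on the vertex set \<open>[n]\<close>, i.e. \<open>UNIV :: 'n set\<close>, is given by its edge set.\<close>

definition uniform_hypergraph :: "nat \<Rightarrow> 'n set set \<Rightarrow> bool" where
  "uniform_hypergraph r E \<longleftrightarrow> r > 1 \<and> (\<forall>e\<in>E. finite e \<and> card e = r)"

text \<open>Lists are indexed from \<open>0\<close>: \<open>e\<^sub>1, \<dots>, e\<^sub>i\<close> is \<open>take i es\<close>, and \<open>e\<^sub>i\<^sub>+\<^sub>1\<close> is \<open>es ! i\<close>.\<close>

definition good_forest :: "nat \<Rightarrow> 'n set set \<Rightarrow> bool" where
  "good_forest r E \<longleftrightarrow> uniform_hypergraph r E \<and>
    (\<exists>es. distinct es \<and> set es = E \<and>
      (\<forall>i. 1 \<le> i \<and> i \<le> length es - 1 \<longrightarrow> card (\<Union>(set (take i es)) \<inter> es ! i) \<le> 1))"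

definition lss_poly :: "'n set \<Rightarrow> ('n, 'd::finite, 'k::comm_ring_1) mpoly" where
  "lss_poly e = (\<Sum>j\<in>UNIV. \<Prod>i\<in>e. var i j)"

definition lss_ideal :: "'n set set \<Rightarrow> ('n, 'd::finite, 'k::comm_ring_1) mpoly set" where
  "lss_ideal E = ideal_gen (lss_poly ` E)"

end

theory Submission
  imports Defs "HOL-Analysis.Determinants" "HOL-Computational_Algebra.Polynomial"
    "HOL-Computational_Algebra.Fraction_Field"
begin

text \<open>
  Hilbert series do not change under field extensions, so the field may be taken to be infinite.
  Build the forest edge by edge. A new edge \<open>e = {v} \<union> W\<close> has only \<open>v\<close> in common with the earlier
  edges, whose ideal is \<open>I\<close>. Then \<open>I : f\<^sub>e = I : (x\<^sub>v\<^sub>1, \<dots>, x\<^sub>v\<^sub>d) = I : l\<close> for a general linear form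
  \<open>l\<close> of degree \<open>e\<^sub>v\<close>: no element of positive degree at \<open>v\<close> is annihilated by \<open>l\<close> modulo \<open>I\<close>. This
  expresses the Hilbert series of \<open>I + (f\<^sub>e)\<close> by those of \<open>I\<close> and \<open>I + (l)\<close>. To iterate, all ideals are
  considered modulo arbitrary sets of general linear forms. When the variables of every \<open>w \<in> W\<close> are
  cut down to a single one \<open>z\<^sub>w\<close>, the polynomial \<open>f\<^sub>e\<close> becomes \<open>c \<Prod>z\<^sub>w\<close> for a linear form \<open>c\<close> at \<open>v\<close>
  that is determined by the forms used at \<open>W\<close>; the forms must be so general that \<open>c\<close> is again in
  general position to the forms at \<open>v\<close>.

  The radical Borel-fixed ideal \<open>J\<close> is built by the same recursion: \<open>f\<^sub>e\<close> contributes the monomials \<open>m\<close>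
  divisible by all \<open>x\<^sub>w\<^sub>1\<close> and by some \<open>x\<^sub>v\<^sub>t\<close> such that \<open>m x\<^sub>v\<^sub>j \<in> J\<close> for all \<open>j < t\<close>. The last variables of
  each degree play the role of the general linear forms, and the numbers of monomials satisfy the
  recursion of the Hilbert series.
\<close>

subsection \<open>Polynomials\<close>

text \<open>The comparison of f_e with the form c only becomes visible after the variables at each w
  in \<open>W\<close> are cut down to one. The forms used for this have to be removed again one at a
  time; each removal is an argument of Nakayama type, by induction on the degree, in which c and a
  form at w are cancelled in either order. This is why regularity is demanded over every subset
  \<open>T\<close> of the labels and not along one fixed sequence. The d - 1 forms kept at each w
  must contain those of \<open>T\<close>, and c depends on them, so \<open>good_position\<close>
  asks for a form c for every choice \<open>X\<close>. For finitely many labels these are finitely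
  many nonvanishing conditions. Each of them can be met because c can be prescribed, up to a scalar,
  through the forms at \<open>W\<close>; this uses up these forms, but no earlier edge contains a
  vertex of \<open>W\<close>. In the monomial model c corresponds to the last variable x_vq at v
  that is not yet truncated, whereas the edge itself uses the first variable at v that leads out of
  J. The recursion for the counts comes from exchanging these two factors.\<close>

abbreviation "lookup \<equiv> Poly_Mapping.lookup"
abbreviation "keys \<equiv> Poly_Mapping.keys"
abbreviation "single \<equiv> Poly_Mapping.single"

lemma mpoly_expansion:
  "p = (\<Sum>m\<in>keys p. single m (lookup p m))"
  by (rule poly_mapping_eqI)
    (auto simp: lookup_sum lookup_single when_def in_keys_iff sum.delta)

lemma mpoly_expansion_superset:
  assumes "finite M" "keys p \<subseteq> M"
  shows "p = (\<Sum>m\<in>M. single m (lookup p m))"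
  by (rule poly_mapping_eqI)
    (use assms in \<open>auto simp: lookup_sum lookup_single when_def in_keys_iff sum.delta\<close>)

lemma mpoly_mult_expansion:
  "p * q = (\<Sum>m\<in>keys p. \<Sum>m'\<in>keys q.
    single (m + m') (lookup p m * lookup q m'))"
  by (subst mpoly_expansion[of p], subst mpoly_expansion[of q])
    (simp add: sum_product mult_single)

lemma lookup_mpoly_mult:
  "lookup (p * q) k = (\<Sum>m\<in>keys p. \<Sum>m'\<in>keys q.
    lookup p m * lookup q m' when m + m' = k)"
  by (subst mpoly_mult_expansion) (simp add: lookup_sum lookup_single)

lemma lookup_single_mult_add:
  fixes m :: "'a \<Rightarrow>\<^sub>0 nat"
  shows "lookup (single m c * p) (m + m') = c * lookup p m'"
proof (cases "c = 0")
  case False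
  then show ?thesis
    by (simp add: lookup_mpoly_mult when_def sum.delta in_keys_iff)
qed simp

text \<open>Transports the linear order on \<open>nat \<Rightarrow>\<^sub>0 nat\<close>, which is
  compatible with addition, to monomials over an unordered index set.\<close>

lemma exists_monomial_embedding:
  "\<exists>h :: ('a::finite \<Rightarrow>\<^sub>0 nat) \<Rightarrow> (nat \<Rightarrow>\<^sub>0 nat). inj h \<and> (\<forall>m m'. h (m + m') = h m + h m')"
proof -
  obtain e :: "'a \<Rightarrow> nat" where e: "inj e"
    using finite_imp_inj_to_nat_seg[of "UNIV :: 'a set"] by blast
  define h where "h m = (\<Sum>a\<in>UNIV. single (e a) (lookup m a))"
    for m :: "'a \<Rightarrow>\<^sub>0 nat"
  have lk: "lookup (h m) (e a) = lookup m a" for m a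
    using e by (simp add: h_def lookup_sum lookup_single when_def inj_eq sum.delta)
  have "inj h"
    by (rule injI, rule poly_mapping_eqI) (metis lk)
  moreover have "h (m + m') = h m + h m'" for m m'
    by (simp add: h_def lookup_add single_add sum.distrib)
  ultimately show ?thesis by blast
qed

text \<open>For the leading monomials \<open>a\<close> and \<open>b\<close> in the transported
  order, \<open>a + b\<close> arises from no other pair, so its coefficient is a product of two
  nonzero ones.\<close>

lemma mpoly_no_zero_divisors:
  fixes p q :: "('a::finite \<Rightarrow>\<^sub>0 nat) \<Rightarrow>\<^sub>0 'k::idom"
  assumes "p * q = 0"
  shows "p = 0 \<or> q = 0"
proof (rule ccontr)
  assume "\<not> ?thesis"
  then have ne: "keys p \<noteq> {}" "keys q \<noteq> {}"
    by auto
  obtain h :: "('a \<Rightarrow>\<^sub>0 nat) \<Rightarrow> (nat \<Rightarrow>\<^sub>0 nat)"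
    where h: "inj h" "\<And>m m'. h (m + m') = h m + h m'"
    using exists_monomial_embedding by blast
  have ex_max: "\<exists>a\<in>A. \<forall>m\<in>A. h m \<le> h a" if "finite A" "A \<noteq> {}" for A
  proof -
    have "Max (h ` A) \<in> h ` A" using that by (intro Max_in) auto
    then obtain a where "a \<in> A" "h a = Max (h ` A)" by auto
    then show ?thesis using that by (intro bexI[of _ a]) auto
  qed
  obtain a where a: "a \<in> keys p" "\<And>m. m \<in> keys p \<Longrightarrow> h m \<le> h a"
    using ex_max[of "keys p"] ne by auto
  obtain b where b: "b \<in> keys q" "\<And>m. m \<in> keys q \<Longrightarrow> h m \<le> h b"
    using ex_max[of "keys q"] ne by auto
  have only: "m = a \<and> m' = b"
    if "m \<in> keys p" "m' \<in> keys q" "m + m' = a + b" for m m'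
  proof -
    have "h m + h m' = h a + h b" using that(3) h(2) by metis
    moreover have "h m \<le> h a" "h m' \<le> h b" using a b that by auto
    ultimately have "h m = h a \<and> h m' = h b"
      by (metis add_le_cancel_left add_le_cancel_right antisym add_left_imp_eq
          add_mono order_refl)
    then show ?thesis using h(1) by (auto dest: injD)
  qed
  have "lookup (p * q) (a + b) =
      (\<Sum>m\<in>keys p. if m = a then \<Sum>m'\<in>keys q. if m' = b
        then lookup p a * lookup q b else 0 else 0)"
    unfolding lookup_mpoly_mult
    by (intro sum.cong refl) (auto simp: when_def dest: only intro!: sum.neutral sum.cong)
  also have "\<dots> = lookup p a * lookup q b"
    using a(1) b(1) by (simp add: sum.delta)
  also have "\<dots> \<noteq> 0" using a(1) b(1) by (simp add: in_keys_iff)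
  finally show False using assms by simp
qed

lemma const_0 [simp]: "const 0 = 0" by (simp add: const_def)
lemma const_1 [simp]: "const 1 = 1" by (simp add: const_def)
lemma const_add: "const (a + b) = const a + const b" by (simp add: const_def single_add)
lemma const_mult: "const (a * b) = const a * const b" by (simp add: const_def mult_single)
lemma const_prod: "const (prod f A) = (\<Prod>x\<in>A. const (f x))"
  by (induction A rule: infinite_finite_induct) (simp_all add: const_mult)
lemma lookup_const_mult: "lookup (const c * p) m = c * lookup p m"
  for p :: "('n, 'd, 'k::comm_ring_1) mpoly"
  using lookup_single_mult_add[of 0 c p m] by (simp add: const_def)
lemma single_eq_const_mult:
  "single m c = const c * single m (1::'k::comm_ring_1)"
  by (simp add: const_def mult_single)

lemma const_inverse_cancel:
  "c \<noteq> 0 \<Longrightarrow> const (inverse c) * (const c * p) = p" for c :: "'k::field"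
  by (simp flip: const_mult mult.assoc)

lemma prod_single_power:
  "(\<Prod>x\<in>A. single (f x) (c x :: 'k::comm_ring_1)) =
    single (\<Sum>x\<in>A. f x :: 'a \<Rightarrow>\<^sub>0 nat) (\<Prod>x\<in>A. c x)"
  by (induction A rule: infinite_finite_induct) (simp_all add: mult_single)

lemma monomial_eq_sum_singles:
  "m = (\<Sum>z\<in>UNIV. single z (lookup m z))" for m :: "'a::finite \<Rightarrow>\<^sub>0 nat"
  by (rule mpoly_expansion_superset) auto


subsection \<open>Substitution homomorphisms\<close>

definition monomial_subst ::
    "('n::finite \<Rightarrow> 'd::finite \<Rightarrow> ('n, 'd, 'k::comm_ring_1) mpoly) \<Rightarrow> ('n, 'd) mon \<Rightarrow> ('n, 'd, 'k) mpoly" where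
  "monomial_subst \<phi> m = (\<Prod>(i, j)\<in>UNIV. \<phi> i j ^ lookup m (i, j))"

context
  fixes \<phi> :: "'n::finite \<Rightarrow> 'd::finite \<Rightarrow> ('n, 'd, 'k::comm_ring_1) mpoly"
begin

lemma poly_subst_eq_monomial_subst:
  "poly_subst \<phi> p =
    (\<Sum>m\<in>keys p. const (lookup p m) * monomial_subst \<phi> m)"
proof -
  have "(\<Prod>(i, j)\<in>keys m. \<phi> i j ^ lookup m (i, j)) = monomial_subst \<phi> m"
    for m
    unfolding monomial_subst_def
    by (rule prod.mono_neutral_left) (auto simp: in_keys_iff)
  then show ?thesis by (simp add: poly_subst_def)
qed

lemma poly_subst_superset:
  assumes "finite M" "keys p \<subseteq> M"
  shows "poly_subst \<phi> p = (\<Sum>m\<in>M. const (lookup p m) * monomial_subst \<phi> m)"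
  unfolding poly_subst_eq_monomial_subst
  by (rule sum.mono_neutral_left) (use assms in \<open>auto simp: in_keys_iff\<close>)

lemma monomial_subst_add: "monomial_subst \<phi> (m + m') = monomial_subst \<phi> m * monomial_subst \<phi> m'"
  by (simp add: monomial_subst_def lookup_add power_add prod.distrib case_prod_unfold)

lemma poly_subst_add: "poly_subst \<phi> (p + q) = poly_subst \<phi> p + poly_subst \<phi> q"
proof -
  let ?M = "keys p \<union> keys q"
  have "poly_subst \<phi> (p + q) = (\<Sum>m\<in>?M. const (lookup (p + q) m) * monomial_subst \<phi> m)"
    by (rule poly_subst_superset) (auto simp: Poly_Mapping.keys_add)
  moreover have "poly_subst \<phi> p = (\<Sum>m\<in>?M. const (lookup p m) * monomial_subst \<phi> m)"
    by (rule poly_subst_superset) auto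
  moreover have "poly_subst \<phi> q = (\<Sum>m\<in>?M. const (lookup q m) * monomial_subst \<phi> m)"
    by (rule poly_subst_superset) auto
  ultimately show ?thesis
    by (simp add: lookup_add const_add distrib_right sum.distrib)
qed

lemma poly_subst_0 [simp]: "poly_subst \<phi> 0 = 0" by (simp add: poly_subst_def)

lemma poly_subst_sum: "poly_subst \<phi> (sum f A) = (\<Sum>x\<in>A. poly_subst \<phi> (f x))"
  by (induction A rule: infinite_finite_induct) (simp_all add: poly_subst_add)

lemma poly_subst_single: "poly_subst \<phi> (single m c) = const c * monomial_subst \<phi> m"
  by (subst poly_subst_superset[of "{m}"]) auto

lemma poly_subst_mult: "poly_subst \<phi> (p * q) = poly_subst \<phi> p * poly_subst \<phi> q"
  by (subst mpoly_mult_expansion)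
    (simp add: poly_subst_sum poly_subst_single monomial_subst_add const_mult
      poly_subst_eq_monomial_subst[of p] poly_subst_eq_monomial_subst[of q] sum_product mult.assoc
      mult.left_commute)

lemma poly_subst_const: "poly_subst \<phi> (const c) = const c"
  by (simp add: const_def[of c] poly_subst_single) (simp add: monomial_subst_def)

lemma poly_subst_var: "poly_subst \<phi> (var i j) = \<phi> i j"
proof -
  have "monomial_subst \<phi> (single (i, j) 1) =
      (\<Prod>z\<in>UNIV. if z = (i, j) then \<phi> i j else 1)"
    unfolding monomial_subst_def
    by (intro prod.cong refl) (simp add: lookup_single when_def split: prod.split)
  then show ?thesis by (simp add: var_def poly_subst_single)
qed

end

text \<open>Reduces statements about substitution homomorphisms to constants and variables.\<close>

lemma mpoly_induct [case_names const var add mult]: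
  fixes p :: "('n::finite, 'd::finite, 'k::comm_ring_1) mpoly"
  assumes c: "\<And>c. P (const c)" and v: "\<And>i j. P (var i j)"
    and a: "\<And>p q. P p \<Longrightarrow> P q \<Longrightarrow> P (p + q)" and m: "\<And>p q. P p \<Longrightarrow> P q \<Longrightarrow> P (p * q)"
  shows "P p"
proof -
  have P1: "P 1" using c[of 1] by simp
  have P0: "P 0" using c[of 0] by simp
  have prod: "P (\<Prod>x\<in>A. f x)" if "\<And>x. x \<in> A \<Longrightarrow> P (f x)" for A :: "'x set" and f
    using that by (induction A rule: infinite_finite_induct) (auto intro: P1 m)
  have sum: "P (\<Sum>x\<in>A. f x)" if "\<And>x. x \<in> A \<Longrightarrow> P (f x)" for A :: "'x set" and f
    using that by (induction A rule: infinite_finite_induct) (auto intro: P0 a)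
  have pw: "P (q ^ k)" if "P q" for q k
    using that by (induction k) (auto intro: P1 m)
  have s1: "P (single (single z k) 1)" for z k
  proof -
    have "single (single z k) (1::'k) = var (fst z) (snd z) ^ k"
    proof (induction k)
      case (Suc k)
      have "single z (Suc k) = single z 1 + single z k"
        by (simp flip: single_add)
      then have "single (single z (Suc k)) (1::'k) =
          var (fst z) (snd z) * single (single z k) 1"
        by (simp add: var_def mult_single)
      then show ?case by (simp only: Suc.IH power_Suc)
    qed simp
    then show ?thesis using pw[OF v] by simp
  qed
  have s: "P (single n 1)" for n
  proof -
    have *: "single n (1::'k) =
        (\<Prod>z\<in>UNIV. single (single z (lookup n z)) 1)"
      by (subst monomial_eq_sum_singles[of n], subst prod_single_power) simp
    show ?thesis by (subst *) (intro prod s1)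
  qed
  have "P (\<Sum>n\<in>keys p. single n (lookup p n))"
    by (rule sum) (subst single_eq_const_mult, intro m c s)
  then show ?thesis by (subst mpoly_expansion)
qed

subsection \<open>Ideals and the multigrading\<close>

lemma is_ideal_ideal_gen: "is_ideal (ideal_gen F)"
  by (simp add: is_ideal_def ideal_gen_def module.subspace_span[OF module_mult])

context
  fixes I :: "'a::comm_ring_1 set"
  assumes I: "is_ideal I"
begin

lemma ideal_0: "0 \<in> I"
  using module.subspace_0[OF module_mult] I by (simp add: is_ideal_def)

lemma ideal_add: "p \<in> I \<Longrightarrow> q \<in> I \<Longrightarrow> p + q \<in> I"
  using module.subspace_add[OF module_mult] I by (simp add: is_ideal_def)

lemma ideal_mult: "p \<in> I \<Longrightarrow> q * p \<in> I"
  using module.subspace_scale[OF module_mult] I by (simp add: is_ideal_def)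

lemma ideal_mult_right: "p \<in> I \<Longrightarrow> p * q \<in> I"
  using ideal_mult by (simp add: mult.commute)

lemma ideal_diff: "p \<in> I \<Longrightarrow> q \<in> I \<Longrightarrow> p - q \<in> I"
  using module.subspace_diff[OF module_mult] I by (simp add: is_ideal_def)

lemma ideal_sum: "(\<And>x. x \<in> A \<Longrightarrow> f x \<in> I) \<Longrightarrow> sum f A \<in> I"
  by (induction A rule: infinite_finite_induct) (auto intro: ideal_0 ideal_add)

lemma ideal_prod_cong:
  assumes "finite A" "\<And>x. x \<in> A \<Longrightarrow> f x - g x \<in> I"
  shows "prod f A - prod g A \<in> I"
  using assms
proof (induction A rule: finite_induct)
  case (insert x A)
  have "prod f (insert x A) - prod g (insert x A) =
      (f x - g x) * prod f A + g x * (prod f A - prod g A)"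
    using insert by (simp add: algebra_simps)
  then show ?case using insert by (auto intro: ideal_add ideal_mult ideal_mult_right)
qed (simp add: ideal_0)

end

lemma ideal_gen_base: "f \<in> F \<Longrightarrow> f \<in> ideal_gen F"
  by (simp add: ideal_gen_def module.span_base[OF module_mult])

lemma ideal_gen_mono: "F \<subseteq> G \<Longrightarrow> ideal_gen F \<subseteq> ideal_gen G"
  by (simp add: ideal_gen_def module.span_mono[OF module_mult])

lemma ideal_gen_minimal: "F \<subseteq> I \<Longrightarrow> is_ideal I \<Longrightarrow> ideal_gen F \<subseteq> I"
  by (simp add: ideal_gen_def is_ideal_def module.span_minimal[OF module_mult])

lemma ideal_gen_insert: "p \<in> ideal_gen (insert f F) \<longleftrightarrow> (\<exists>h. p - f * h \<in> ideal_gen F)"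
  by (simp add: ideal_gen_def module.span_insert[OF module_mult] mult.commute)

lemma ideal_gen_absorb: "f \<in> ideal_gen F \<Longrightarrow> ideal_gen (insert f F) = ideal_gen F"
  by (intro antisym ideal_gen_minimal ideal_gen_mono is_ideal_ideal_gen) (auto intro: ideal_gen_base)

lemma ideal_gen_induct [consumes 1, case_names zero step]:
  assumes "p \<in> ideal_gen F" "P 0" "\<And>c f p. f \<in> F \<Longrightarrow> P p \<Longrightarrow> P (c * f + p)"
  shows "P p"
  using module.span_induct_alt[OF module_mult, of p F P] assms by (auto simp: ideal_gen_def)

section \<open>Multidegrees, graded pieces and homogeneous components\<close>

lemma mdeg_add: "mdeg (m + m') = (\<lambda>i. mdeg m i + mdeg m' i)"
  by (simp add: mdeg_def lookup_add sum.distrib)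

lemma mdeg_0 [simp]: "mdeg 0 = (\<lambda>i. 0)" by (simp add: mdeg_def)

lemma mdeg_nonneg: "mdeg m i \<ge> 0"
  by (simp add: mdeg_def sum_nonneg)

lemma mdeg_single: "mdeg (single (i, j) k) = (\<lambda>i'. if i' = i then int k else 0)"
  by (rule ext) (auto simp: mdeg_def lookup_single when_def if_distrib[of int] cong: if_cong)

lemma graded_piece_0 [simp]: "0 \<in> graded_piece a" by (simp add: graded_piece_def)

lemma graded_piece_add: "p \<in> graded_piece a \<Longrightarrow> q \<in> graded_piece a \<Longrightarrow> p + q \<in> graded_piece a"
  using Poly_Mapping.keys_add[of p q] by (auto simp: graded_piece_def)

lemma graded_piece_sum: "(\<And>x. x \<in> A \<Longrightarrow> f x \<in> graded_piece a) \<Longrightarrow> sum f A \<in> graded_piece a"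
  by (induction A rule: infinite_finite_induct) (auto intro: graded_piece_add)

lemma graded_piece_uminus: "p \<in> graded_piece a \<Longrightarrow> - p \<in> graded_piece a"
  by (auto simp: graded_piece_def in_keys_iff)

lemma graded_piece_diff: "p \<in> graded_piece a \<Longrightarrow> q \<in> graded_piece a \<Longrightarrow> p - q \<in> graded_piece a"
  using graded_piece_add[of p a "- q"] graded_piece_uminus[of q a] by simp

lemma graded_piece_mult:
  assumes "p \<in> graded_piece a" "q \<in> graded_piece b" "c = (\<lambda>i. a i + b i)"
  shows "p * q \<in> graded_piece c"
proof -
  have "mdeg m = c" if m: "m \<in> keys (p * q)" for m
  proof -
    obtain m1 m2 where "m = m1 + m2" "m1 \<in> keys p" "m2 \<in> keys q"
      using keys_mult[of p q] m by blast
    then show ?thesis using assms by (simp add: graded_piece_def mdeg_add)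
  qed
  then show ?thesis by (simp add: graded_piece_def)
qed

lemma graded_piece_const: "const c \<in> graded_piece (\<lambda>i. 0)"
  by (simp add: const_def graded_piece_def)

lemma graded_piece_1: "1 \<in> graded_piece (\<lambda>i. 0)"
  by (simp add: graded_piece_def)

lemma graded_piece_const_mult: "p \<in> graded_piece a \<Longrightarrow> const c * p \<in> graded_piece a"
  by (erule graded_piece_mult[OF graded_piece_const]) simp

lemma graded_piece_var: "var i j \<in> graded_piece (\<lambda>i'. if i' = i then 1 else 0)"
  by (simp add: var_def graded_piece_def mdeg_single fun_eq_iff)

lemma graded_piece_prod:
  "(\<And>x. x \<in> A \<Longrightarrow> f x \<in> graded_piece (a x)) \<Longrightarrow> prod f A \<in> graded_piece (\<lambda>i. \<Sum>x\<in>A. a x i)"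
proof (induction A rule: infinite_finite_induct)
  case (insert x A)
  then show ?case by (simp, intro graded_piece_mult[where a = "a x"]) auto
qed (simp_all add: graded_piece_1)

lemma graded_piece_neg:
  assumes "p \<in> graded_piece a" "a i < 0"
  shows "p = 0"
proof (rule ccontr)
  assume "p \<noteq> 0"
  then obtain m where "m \<in> keys p"
    using ex_in_conv[of "keys p"] by auto
  then have "mdeg m i < 0" using assms by (simp add: graded_piece_def)
  then show False using mdeg_nonneg[of m i] by simp
qed

lemma lookup_hom_component:
  "lookup (hom_component a p) m = (lookup p m when mdeg m = a)"
  by (auto simp: hom_component_def lookup_sum lookup_single when_def sum.delta in_keys_iff)

lemma hom_component_add: "hom_component a (p + q) = hom_component a p + hom_component a q"
  by (rule poly_mapping_eqI) (simp add: lookup_hom_component lookup_add when_def)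

lemma hom_component_diff: "hom_component a (p - q) = hom_component a p - hom_component a q"
  by (rule poly_mapping_eqI) (simp add: lookup_hom_component lookup_minus when_def)

lemma hom_component_0 [simp]: "hom_component a 0 = 0"
  by (rule poly_mapping_eqI) (simp add: lookup_hom_component)

lemma hom_component_in_piece: "hom_component a p \<in> graded_piece a"
  by (auto simp: graded_piece_def in_keys_iff lookup_hom_component when_def split: if_splits)

lemma hom_component_id: "p \<in> graded_piece a \<Longrightarrow> hom_component a p = p"
  by (rule poly_mapping_eqI)
    (force simp: graded_piece_def in_keys_iff lookup_hom_component when_def)

lemma keys_hom_component: "keys (hom_component a p) \<subseteq> keys p"
  by (auto simp: in_keys_iff lookup_hom_component when_def split: if_splits)

text \<open>Degrees are integers, so \<open>a - b\<close> needs no case distinction: if it is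
  negative somewhere, both sides vanish.\<close>

lemma hom_component_mult:
  fixes s h :: "('n, 'd::finite, 'k::comm_ring_1) mpoly"
  assumes s: "s \<in> graded_piece b"
  shows "hom_component a (s * h) = s * hom_component (\<lambda>i. a i - b i) h"
proof (rule poly_mapping_eqI)
  fix m
  let ?h' = "hom_component (\<lambda>i. a i - b i) h"
  have "lookup (s * ?h') m = (\<Sum>m1\<in>keys s. \<Sum>m2\<in>keys ?h'.
      lookup s m1 * lookup ?h' m2 when m1 + m2 = m)"
    by (rule lookup_mpoly_mult)
  also have "\<dots> = (\<Sum>m1\<in>keys s. \<Sum>m2\<in>keys h.
      lookup s m1 * lookup ?h' m2 when m1 + m2 = m)"
    by (intro sum.cong refl sum.mono_neutral_left keys_hom_component)
      (auto simp: in_keys_iff when_def)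
  also have "\<dots> = (\<Sum>m1\<in>keys s. \<Sum>m2\<in>keys h.
      (lookup s m1 * lookup h m2 when m1 + m2 = m) when mdeg m = a)"
  proof (intro sum.cong refl)
    fix m1 m2 assume "m1 \<in> keys s"
    then have "mdeg m1 = b" using s by (simp add: graded_piece_def)
    then have "mdeg m2 = (\<lambda>i. a i - b i) \<longleftrightarrow> mdeg m = a" if "m1 + m2 = m"
      using mdeg_add[of m1 m2] that by (simp add: fun_eq_iff eq_diff_eq add.commute)
    then show "(lookup s m1 * lookup ?h' m2 when m1 + m2 = m) =
        ((lookup s m1 * lookup h m2 when m1 + m2 = m) when mdeg m = a)"
      by (auto simp: lookup_hom_component when_def)
  qed
  also have "\<dots> = lookup (hom_component a (s * h)) m"
    by (simp add: lookup_hom_component lookup_mpoly_mult[of s h m] when_def)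
  finally show "lookup (hom_component a (s * h)) m = lookup (s * ?h') m" ..
qed

lemma is_graded_ideal_gen:
  fixes F :: "('n, 'd::finite, 'k::comm_ring_1) mpoly set"
  assumes F: "\<And>f. f \<in> F \<Longrightarrow> \<exists>b. f \<in> graded_piece b"
  shows "is_graded_ideal (ideal_gen F)"
proof -
  have "hom_component a p \<in> ideal_gen F" if "p \<in> ideal_gen F" for p a
    using that
  proof (induction rule: ideal_gen_induct)
    case zero
    show ?case by (simp add: ideal_0[OF is_ideal_ideal_gen])
  next
    case (step c f p)
    obtain b where "f \<in> graded_piece b" using F step by blast
    then have "hom_component a (c * f) = hom_component (\<lambda>i. a i - b i) c * f"
      using hom_component_mult[of f b a c] by (simp add: mult.commute)
    moreover have "hom_component (\<lambda>i. a i - b i) c * f \<in> ideal_gen F"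
      by (intro ideal_mult is_ideal_ideal_gen ideal_gen_base step)
    ultimately show ?case using step
      by (simp add: hom_component_add ideal_add[OF is_ideal_ideal_gen])
  qed
  then show ?thesis by (simp add: is_graded_ideal_def is_ideal_ideal_gen)
qed

text \<open>Multipliers of homogeneous elements can be taken homogeneous: modulo a graded ideal only
  the component of \<open>h\<close> in degree \<open>a - b\<close> matters.\<close>

lemma graded_ideal_lift:
  assumes I: "is_graded_ideal I" and p: "p \<in> graded_piece a" and s: "s \<in> graded_piece b"
    and "p - s * h \<in> I"
  obtains h' where "h' \<in> graded_piece (\<lambda>i. a i - b i)" "p - s * h' \<in> I"
proof
  show "hom_component (\<lambda>i. a i - b i) h \<in> graded_piece (\<lambda>i. a i - b i)"
    by (rule hom_component_in_piece)
  have "hom_component a (p - s * h) \<in> I" using assms by (simp add: is_graded_ideal_def)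
  then show "p - s * hom_component (\<lambda>i. a i - b i) h \<in> I"
    by (simp add: hom_component_diff hom_component_id[OF p] hom_component_mult[OF s])
qed

lemma ideal_gen_insert_graded:
  assumes "\<And>f. f \<in> F \<Longrightarrow> \<exists>b. f \<in> graded_piece b"
    and "p \<in> ideal_gen (insert s F)" "p \<in> graded_piece a" "s \<in> graded_piece b"
  obtains h where "h \<in> graded_piece (\<lambda>i. a i - b i)" "p - s * h \<in> ideal_gen F"
proof -
  obtain h where "p - s * h \<in> ideal_gen F" using assms(2) by (auto simp: ideal_gen_insert)
  then show ?thesis
    using graded_ideal_lift[OF is_graded_ideal_gen[OF assms(1)] assms(3,4)] that by blast
qed

subsection \<open>Dimensions of graded pieces\<close>

text \<open>Rank-nullity for the map that \<open>f\<close> induces from \<open>X\<close> to the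
  quotient by \<open>U\<close>, in additive form so that neither quotient spaces nor subtraction of
  naturals occur. A basis of the kernel \<open>Q\<close> is extended by \<open>C\<close> to one of
  \<open>X\<close>, and the image of \<open>C\<close> is independent modulo
  \<open>U\<close>.\<close>

lemma (in vector_space) dim_add_image:
  assumes lin: "Vector_Spaces.linear scale scale f"
    and U: "subspace U" and X: "subspace X"
    and fin: "finite A" "U \<subseteq> span A" "finite B" "X \<subseteq> span B"
  shows "dim {u + f x | u x. u \<in> U \<and> x \<in> X} + dim {x \<in> X. f x \<in> U} = dim U + dim X"
proof -
  interpret f: Vector_Spaces.linear scale scale f by (rule lin)
  define Q where "Q = {x \<in> X. f x \<in> U}"
  have Q: "subspace Q" "Q \<subseteq> X"
    using U X by (auto simp: Q_def subspace_def f.zero f.add f.scale)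
  obtain BQ where BQ: "BQ \<subseteq> Q" "independent BQ" "Q \<subseteq> span BQ"
    using maximal_independent_subset[of Q] by blast
  obtain BX where BX: "BQ \<subseteq> BX" "BX \<subseteq> X" "independent BX" "X \<subseteq> span BX"
    using maximal_independent_subset_extend[of BQ X] BQ Q by blast
  obtain BU where BU: "BU \<subseteq> U" "independent BU" "U \<subseteq> span BU"
    using maximal_independent_subset[of U] by blast
  have finX: "finite BX" using independent_span_bound[OF fin(3) BX(3)] BX(2) fin(4) by blast
  have finU: "finite BU" using independent_span_bound[OF fin(1) BU(2)] BU(1) fin(2) by blast
  have spU: "span BU = U" using BU U span_minimal by blast
  have spX: "span BX = X" using BX X span_minimal by blast
  define C where "C = BX - BQ"
  have finC: "finite C" using finX by (simp add: C_def)
  have "independent (BU \<union> f ` C') \<and> card (BU \<union> f ` C') = card BU + card C'"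
    if "finite C'" "C' \<subseteq> C" for C'
    using that
  proof (induction C' rule: finite_induct)
    case empty
    then show ?case using BU by simp
  next
    case (insert c C')
    have "f c \<notin> span (BU \<union> f ` C')"
    proof
      assume "f c \<in> span (BU \<union> f ` C')"
      then obtain u x where ux: "f c = u + f x" "u \<in> U" "x \<in> span C'"
        by (auto simp: span_Un f.span_image spU)
      have "x \<in> X" using ux(3) insert.prems span_mono[of C' BX] spX by (auto simp: C_def)
      moreover have "c \<in> X" using insert.prems BX by (auto simp: C_def)
      moreover have "f (c - x) = u" using ux by (simp add: f.diff)
      ultimately have "c - x \<in> Q" using X ux by (auto simp: Q_def subspace_diff)
      then have "c - x \<in> span (BQ \<union> C')" "x \<in> span (BQ \<union> C')"
        using BQ(3) ux(3) span_mono[of BQ "BQ \<union> C'"] span_mono[of C' "BQ \<union> C'"] by auto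
      then have "c \<in> span (BQ \<union> C')" using span_add[of "c - x" "BQ \<union> C'" x] by simp
      moreover have "BQ \<union> C' \<subseteq> BX - {c}" "c \<in> BX"
        using insert.prems insert.hyps BX(1) by (auto simp: C_def)
      ultimately have "c \<in> span (BX - {c})" using span_mono by blast
      then show False using BX(3) \<open>c \<in> BX\<close> by (auto simp: dependent_def)
    qed
    moreover from this have "f c \<notin> BU \<union> f ` C'"
      using span_superset[of "BU \<union> f ` C'"] by auto
    moreover have "independent (BU \<union> f ` C')" "card (BU \<union> f ` C') = card BU + card C'"
      using insert.IH insert.prems by auto
    ultimately have "independent (insert (f c) (BU \<union> f ` C'))"
      and "card (insert (f c) (BU \<union> f ` C')) = card BU + card (insert c C')"
      using insert.hyps finU by (simp_all add: independent_insertI)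
    then show ?case by simp
  qed
  from this[OF finC] have ind: "independent (BU \<union> f ` C)"
    and crd: "card (BU \<union> f ` C) = card BU + card C" by auto
  have "dim {u + f x | u x. u \<in> U \<and> x \<in> X} = card BU + card C"
  proof (rule dim_unique[OF _ _ ind crd])
    have "\<exists>u x. v = u + f x \<and> u \<in> U \<and> x \<in> X" if "v \<in> BU" for v
      using that BU X by (intro exI[of _ v] exI[of _ 0]) (auto simp: f.zero subspace_0)
    moreover have "\<exists>u x. f c = u + f x \<and> u \<in> U \<and> x \<in> X" if "c \<in> C" for c
      using that BX U by (intro exI[of _ 0] exI[of _ c]) (auto simp: C_def subspace_0)
    ultimately show "BU \<union> f ` C \<subseteq> {u + f x | u x. u \<in> U \<and> x \<in> X}" by auto
    show "{u + f x | u x. u \<in> U \<and> x \<in> X} \<subseteq> span (BU \<union> f ` C)"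
    proof clarify
      fix u x assume ux: "u \<in> U" "x \<in> X"
      have "BX = BQ \<union> C" using BX(1) by (auto simp: C_def)
      then have "x \<in> span (BQ \<union> C)" using ux spX by simp
      then obtain q y where "x = q + y" "q \<in> span BQ" "y \<in> span C"
        by (auto simp: span_Un)
      moreover from this have "q \<in> Q" using BQ Q span_minimal by blast
      ultimately have "u + f x = (u + f q) + f y" "u + f q \<in> U"
        using ux U by (auto simp: f.add Q_def add.assoc subspace_add)
      then show "u + f x \<in> span (BU \<union> f ` C)"
        using \<open>y \<in> span C\<close> unfolding span_Un f.span_image spU by blast
    qed
  qed
  moreover have "dim Q = card BQ" using dim_unique[OF BQ(1,3,2) refl] .
  moreover have "dim X = card BX" using dim_unique[OF BX(2,4,3) refl] .
  moreover have "dim U = card BU" using dim_unique[OF BU(1,3,2) refl] .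
  moreover have "card BX = card BQ + card C"
    using finX BX(1) by (simp add: C_def card_Diff_subset finite_subset card_mono)
  ultimately show ?thesis unfolding Q_def by simp
qed

interpretation mpoly: vector_space
  "pscale :: 'k::field \<Rightarrow> ('n, 'd, 'k) mpoly \<Rightarrow> ('n, 'd, 'k) mpoly"
  by (rule vector_space_pscale)

lemma linear_mult_mpoly:
  "Vector_Spaces.linear pscale pscale ((*) (f :: ('n, 'd, 'k::field) mpoly))"
  by unfold_locales (simp_all add: pscale_def distrib_left mult.left_commute)

lemma subspace_graded_piece: "mpoly.subspace (graded_piece a)"
  by (auto simp: mpoly.subspace_def pscale_def graded_piece_add graded_piece_const_mult)

lemma subspace_ideal: "is_ideal I \<Longrightarrow> mpoly.subspace I"
  by (auto simp: mpoly.subspace_def pscale_def ideal_0 ideal_add ideal_mult)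

lemma finite_mdeg_eq: "finite {m :: ('n::finite, 'd::finite) mon. mdeg m = a}"
proof (rule finite_imageD)
  define N where "N = nat (\<Sum>i\<in>UNIV. a i)"
  have "lookup m (i, j) \<le> N" if "mdeg m = a" for m :: "('n, 'd) mon" and i j
  proof -
    have "int (lookup m (i, j)) \<le> a i"
      using that unfolding mdeg_def
      by (auto intro!: member_le_sum[of j UNIV "\<lambda>j. int (lookup m (i, j))"])
    also have "a i \<le> (\<Sum>i\<in>UNIV. a i)"
      using that mdeg_nonneg[of m] by (auto intro: member_le_sum)
    finally show ?thesis by (simp add: N_def)
  qed
  then have "lookup ` {m :: ('n, 'd) mon. mdeg m = a} \<subseteq> PiE UNIV (\<lambda>_. {..N})"
    by auto
  then show "finite (lookup ` {m :: ('n, 'd) mon. mdeg m = a})"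
    by (rule finite_subset) (simp add: finite_PiE)
  show "inj_on lookup {m :: ('n, 'd) mon. mdeg m = a}"
    by (simp add: inj_on_def)
qed

lemma dim_keys_subset:
  assumes "finite M"
  shows "mpoly.dim {p :: ('n, 'd, 'k::field) mpoly. keys p \<subseteq> M} = card M"
    and "{p :: ('n, 'd, 'k::field) mpoly. keys p \<subseteq> M} \<subseteq>
      mpoly.span ((\<lambda>m. single m 1) ` M)"
proof -
  let ?b = "\<lambda>m. single m 1 :: ('n, 'd, 'k) mpoly"
  have inj: "inj_on ?b M" 
  proof (rule inj_onI)
    fix m m' assume "?b m = ?b m'"
    then have "keys (?b m) = keys (?b m')" by (rule arg_cong)
    then show "m = m'" by simp
  qed
  have "mpoly.independent (?b ` M)"
  proof (rule mpoly.independent_if_scalars_zero)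
    show "finite (?b ` M)" using assms by simp
    fix f x assume 0: "(\<Sum>x\<in>?b ` M. pscale (f x) x) = 0" and "x \<in> ?b ` M"
    then obtain m where m: "m \<in> M" "x = ?b m" by auto
    have "0 = lookup (\<Sum>x\<in>?b ` M. pscale (f x) x) m" using 0 by simp
    also have "\<dots> = (\<Sum>m'\<in>M. f (?b m') * lookup (?b m') m)"
      by (simp add: sum.reindex[OF inj] lookup_sum pscale_def lookup_const_mult)
    also have "\<dots> = f x"
      using assms m by (simp add: lookup_single when_def sum.delta if_distrib cong: if_cong)
    finally show "f x = 0" by simp
  qed
  moreover show *: "{p. keys p \<subseteq> M} \<subseteq> mpoly.span (?b ` M)"
  proof clarify
    fix p :: "('n, 'd, 'k) mpoly" assume p: "keys p \<subseteq> M"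
    have "p = (\<Sum>m\<in>M. pscale (lookup p m) (?b m))"
      by (subst mpoly_expansion_superset[OF assms p])
        (simp add: pscale_def single_eq_const_mult[of _ "lookup p _"])
    also have "\<dots> \<in> mpoly.span (?b ` M)"
      by (intro mpoly.span_sum mpoly.span_scale mpoly.span_base) auto
    finally show "p \<in> mpoly.span (?b ` M)" .
  qed
  ultimately show "mpoly.dim {p :: ('n, 'd, 'k) mpoly. keys p \<subseteq> M} = card M"
    by (intro mpoly.dim_unique[of "?b ` M"]) (auto simp: card_image[OF inj])
qed

lemma graded_piece_eq_keys: "graded_piece a = {p. keys p \<subseteq> {m. mdeg m = a}}"
  by (auto simp: graded_piece_def)

lemma dim_graded_piece:
  "mpoly.dim (graded_piece a :: ('n::finite, 'd::finite, 'k::field) mpoly set) =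
    card {m :: ('n, 'd) mon. mdeg m = a}"
  unfolding graded_piece_eq_keys by (rule dim_keys_subset(1)[OF finite_mdeg_eq])

text \<open>Multiplication by \<open>f\<close> maps S in degree \<open>a - \<phi>\<close> to S/I in
  degree \<open>a\<close>, with the colon ideal as kernel and (I + (f))/I as image. Hence two
  elements with the same colon ideal change the Hilbert series in the same way, up to a shift of the
  degree.\<close>

lemma hilbert_series_insert:
  fixes F :: "('n::finite, 'd::finite, 'k::field) mpoly set"
  assumes F: "\<And>f. f \<in> F \<Longrightarrow> \<exists>b. f \<in> graded_piece b" and f: "f \<in> graded_piece \<phi>"
  shows "hilbert_series (ideal_gen (insert f F)) a +
      mpoly.dim {h \<in> graded_piece (\<lambda>i. a i - \<phi> i). f * h \<in> ideal_gen F} =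
    hilbert_series (ideal_gen F) a + card {m :: ('n, 'd) mon. mdeg m = (\<lambda>i. a i - \<phi> i)}"
proof -
  let ?I = "ideal_gen F" and ?I' = "ideal_gen (insert f F)"
  let ?X = "graded_piece (\<lambda>i. a i - \<phi> i) :: ('n, 'd, 'k) mpoly set"
  let ?U = "?I \<inter> graded_piece a"
  let ?b = "\<lambda>m. single m 1 :: ('n, 'd, 'k) mpoly"
  have fin: "graded_piece c \<subseteq> mpoly.span (?b ` {m. mdeg m = c})" for c
    unfolding graded_piece_eq_keys by (rule dim_keys_subset(2)[OF finite_mdeg_eq])
  have fh: "f * h \<in> graded_piece a" if "h \<in> ?X" for h
    by (rule graded_piece_mult[OF f that]) simp
  have "mpoly.dim {u + f * x | u x. u \<in> ?U \<and> x \<in> ?X} + mpoly.dim {x \<in> ?X. f * x \<in> ?U} =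
      mpoly.dim ?U + mpoly.dim ?X"
  proof (rule mpoly.dim_add_image[OF linear_mult_mpoly])
    show "mpoly.subspace ?U"
      using subspace_ideal[OF is_ideal_ideal_gen[of F]] subspace_graded_piece
      by (rule mpoly.subspace_inter)
    show "?U \<subseteq> mpoly.span (?b ` {m. mdeg m = a})" using fin[of a] by auto
  show "?X \<subseteq> mpoly.span (?b ` {m. mdeg m = (\<lambda>i. a i - \<phi> i)})" by (rule fin)
  qed (simp_all add: subspace_graded_piece finite_mdeg_eq)
  moreover have "{x \<in> ?X. f * x \<in> ?U} = {h \<in> ?X. f * h \<in> ?I}" using fh by auto
  moreover have "{u + f * x | u x. u \<in> ?U \<and> x \<in> ?X} = ?I' \<inter> graded_piece a"
  proof (intro antisym subsetI)
    fix p assume p: "p \<in> ?I' \<inter> graded_piece a"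
    obtain h where h: "h \<in> ?X" "p - f * h \<in> ?I"
      using ideal_gen_insert_graded[of F p f a \<phi>] F f p by auto
    have "p - f * h \<in> graded_piece a" using p fh[OF h(1)] by (auto intro: graded_piece_diff)
    then show "p \<in> {u + f * x | u x. u \<in> ?U \<and> x \<in> ?X}"
      using h by (intro CollectI exI[of _ "p - f * h"] exI[of _ h]) auto
  next
    fix p assume "p \<in> {u + f * x | u x. u \<in> ?U \<and> x \<in> ?X}"
    then obtain u x where "p = u + f * x" "u \<in> ?U" "x \<in> ?X" by blast
    then show "p \<in> ?I' \<inter> graded_piece a"
      using fh by (auto simp: ideal_gen_insert intro!: graded_piece_add exI[of _ x])
  qed
  ultimately show ?thesis by (simp add: hilbert_series_def dim_graded_piece)
qed

subsection \<open>Linear forms in general position\<close>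

definition linform :: "'n \<Rightarrow> 'k::field ^ 'd::finite \<Rightarrow> ('n, 'd, 'k) mpoly" where
  "linform u y = (\<Sum>j\<in>UNIV. const (y $ j) * var u j)"

lemma linform_0 [simp]: "linform u 0 = 0" by (simp add: linform_def)

lemma linform_add: "linform u (y + z) = linform u y + linform u z"
  by (simp add: linform_def const_add distrib_right sum.distrib)

lemma linform_scale: "linform u (c *s y) = const c * linform u y"
  by (simp add: linform_def const_mult sum_distrib_left mult.assoc)

lemma linform_axis: "linform u (axis j 1) = var u j"
  by (simp add: linform_def axis_def if_distrib if_distribR sum.delta cong: if_cong)

lemma linform_diff: "linform u (y - z) = linform u y - linform u z"
  using linform_add[of u "y - z" z] by simp

lemma linform_sum: "linform u (sum y A) = (\<Sum>x\<in>A. linform u (y x))"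
  by (induction A rule: infinite_finite_induct) (simp_all add: linform_add)

lemma linform_piece: "linform u y \<in> graded_piece (\<lambda>i. if i = u then 1 else 0)"
  unfolding linform_def by (intro graded_piece_sum graded_piece_const_mult graded_piece_var)

lemma linform_eq_0_iff: "linform u y = 0 \<longleftrightarrow> y = 0"
proof
  assume 0: "linform u y = 0"
  have "y $ j = 0" for j
  proof -
    have "0 = lookup (linform u y) (single (u, j) 1)" using 0 by simp
    also have "\<dots> = (\<Sum>j'\<in>UNIV. if j' = j then y $ j else 0)"
      unfolding linform_def lookup_sum lookup_const_mult var_def lookup_single
      by (intro sum.cong refl) (auto simp: when_def dest: inj_single[THEN injD] arg_cong[where f = keys])
    finally show ?thesis by (simp add: sum.delta)
  qed
  then show "y = 0" by (simp add: vec_eq_iff)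
qed simp

lemma linform_span_in_ideal:
  assumes I: "is_ideal I" and A: "\<And>y. y \<in> A \<Longrightarrow> linform u y \<in> I" and y: "y \<in> vec.span A"
  shows "linform u y \<in> I"
  using y
proof (induction rule: vec.span_induct_alt)
  case base
  then show ?case by (simp add: ideal_0[OF I])
next
  case (step c x y)
  then show ?case by (auto simp: linform_add linform_scale intro!: ideal_add[OF I] ideal_mult[OF I] A)
qed

text \<open>A monomial of positive degree at \<open>u\<close> is divisible by some variable at
  \<open>u\<close>.\<close>

lemma graded_piece_in_ideal:
  assumes I: "is_ideal I" and vars: "\<And>j. var u j \<in> I" and g: "g \<in> graded_piece a" "a u \<ge> 1"
  shows "g \<in> I"
proof -
  have "single m (lookup g m) \<in> I" if "m \<in> keys g" for m
  proof -
    have "(\<Sum>j\<in>UNIV. int (lookup m (u, j))) \<noteq> 0"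
      using g that by (auto simp: graded_piece_def mdeg_def fun_eq_iff)
    then obtain j where "lookup m (u, j) \<noteq> 0"
      by (metis (mono_tags, lifting) of_nat_0 sum.neutral)
    then have "m = single (u, j) 1 + (m - single (u, j) 1)"
      by (intro poly_mapping_eqI) (auto simp: lookup_add lookup_minus lookup_single when_def)
    then have "single m (lookup g m) =
        var u j * single (m - single (u, j) 1) (lookup g m)"
      by (simp add: var_def mult_single)
    then show ?thesis using ideal_mult_right[OF I vars] by simp
  qed
  then have "(\<Sum>m\<in>keys g. single m (lookup g m)) \<in> I"
    by (intro ideal_sum[OF I])
  then show ?thesis by (subst mpoly_expansion)
qed

text \<open>A pair \<open>(u, n)\<close> is the label of a linear form in the variables of degree \<open>e\<^sub>u\<close>.\<close>

definition labels_at :: "('n \<times> nat) set \<Rightarrow> 'n \<Rightarrow> nat set" where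
  "labels_at L u = {n. (u, n) \<in> L}"

text \<open>Vacuous at a vertex with fewer than d labels; independence of smaller families follows
  only when there are enough labels to complete them to d.\<close>

definition general_position :: "('n \<times> nat) set \<Rightarrow> ('n \<times> nat \<Rightarrow> 'k::field ^ 'd::finite) \<Rightarrow> bool" where
  "general_position L \<phi> \<longleftrightarrow> (\<forall>u X. X \<subseteq> labels_at L u \<and> card X = CARD('d) \<longrightarrow>
    vec.span ((\<lambda>n. \<phi> (u, n)) ` X) = UNIV)"

definition forms :: "('n \<times> nat \<Rightarrow> 'k::field ^ 'd::finite) \<Rightarrow> ('n \<times> nat) set \<Rightarrow> ('n, 'd, 'k) mpoly set" where
  "forms \<phi> T = (\<lambda>(u, n). linform u (\<phi> (u, n))) ` T"

text \<open>An edge is stored as \<open>(v, W)\<close>: its root \<open>v\<close>, the only vertex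
  that it may share with the edges behind it in a \<open>rooted_forest\<close>, and the remaining
  vertices.\<close>

definition edge_polys :: "('n \<times> 'n set) list \<Rightarrow> ('n, 'd::finite, 'k::field) mpoly set" where
  "edge_polys ps = (\<lambda>(v, W). lss_poly (insert v W)) ` set ps"

definition section_ideal ::
    "('n \<times> 'n set) list \<Rightarrow> ('n \<times> nat) set \<Rightarrow> ('n \<times> nat \<Rightarrow> 'k::field ^ 'd::finite) \<Rightarrow> ('n, 'd, 'k) mpoly set" where
  "section_ideal ps T \<phi> = ideal_gen (edge_polys ps \<union> forms \<phi> T)"

lemma labels_at_mono: "T \<subseteq> L \<Longrightarrow> labels_at T u \<subseteq> labels_at L u"
  by (auto simp: labels_at_def)

lemma finite_labels_at: "finite L \<Longrightarrow> finite (labels_at L u)"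
  unfolding labels_at_def by (rule finite_imageD[of "Pair u"]) (auto intro: finite_subset inj_onI)

lemma labels_at_insert: "labels_at (insert (u, n) T) u' =
    (if u' = u then insert n (labels_at T u) else labels_at T u')"
  by (auto simp: labels_at_def)

lemma lss_poly_piece: "lss_poly e \<in> graded_piece (\<lambda>i. if i \<in> e then 1 else 0)" for e :: "'n::finite set"
proof -
  have "(\<Prod>i\<in>e. var i j :: ('n, 'd::finite, 'k::comm_ring_1) mpoly) \<in> graded_piece (\<lambda>i. if i \<in> e then 1 else 0)" for j
  proof -
    have "(\<Prod>i\<in>e. var i j :: ('n, 'd, 'k) mpoly)
        \<in> graded_piece (\<lambda>i. \<Sum>x\<in>e. if i = x then 1 else 0)"
      by (intro graded_piece_prod graded_piece_var)
    then show ?thesis by (simp add: sum.delta)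
  qed
  then show ?thesis unfolding lss_poly_def by (intro graded_piece_sum)
qed

lemma lss_poly_in_ideal:
  fixes e :: "'n::finite set" and I :: "('n, 'd::finite, 'k::comm_ring_1) mpoly set"
  assumes I: "is_ideal I" and "u \<in> e" and vars: "\<And>j. var u j \<in> I"
  shows "lss_poly e \<in> I"
  unfolding lss_poly_def
proof (intro ideal_sum[OF I])
  fix j :: 'd
  have "(\<Prod>i\<in>e. var i j :: ('n, 'd, 'k) mpoly) = var u j * (\<Prod>i\<in>e - {u}. var i j)"
    using assms by (intro prod.remove) auto
  then show "(\<Prod>i\<in>e. var i j) \<in> I" using ideal_mult_right[OF I vars] by simp
qed

context
  fixes ps :: "('n::finite \<times> 'n set) list" and \<phi> :: "'n \<times> nat \<Rightarrow> 'k::field ^ 'd::finite"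
begin

lemma is_ideal_section: "is_ideal (section_ideal ps T \<phi>)"
  by (simp add: section_ideal_def is_ideal_ideal_gen)

lemma section_generators_homogeneous:
  "f \<in> edge_polys ps \<union> forms \<phi> T \<Longrightarrow> \<exists>b. f \<in> graded_piece b"
  using lss_poly_piece linform_piece by (fastforce simp: edge_polys_def forms_def)

lemma section_mono: "T \<subseteq> T' \<Longrightarrow> section_ideal ps T \<phi> \<subseteq> section_ideal ps T' \<phi>"
  unfolding section_ideal_def forms_def by (intro ideal_gen_mono) auto

lemma linform_in_section: "(u, n) \<in> T \<Longrightarrow> linform u (\<phi> (u, n)) \<in> section_ideal ps T \<phi>"
  unfolding section_ideal_def forms_def by (intro ideal_gen_base) auto

lemma section_insert_eq: "section_ideal ps (insert (u, n) T) \<phi> =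
    ideal_gen (insert (linform u (\<phi> (u, n))) (edge_polys ps \<union> forms \<phi> T))"
  by (simp add: section_ideal_def forms_def)

lemma section_insertE:
  assumes "p \<in> section_ideal ps (insert (u, n) T) \<phi>" "p \<in> graded_piece a"
  obtains h where "h \<in> graded_piece (\<lambda>i. a i - (if i = u then 1 else 0))"
    "p - linform u (\<phi> (u, n)) * h \<in> section_ideal ps T \<phi>"
proof (rule ideal_gen_insert_graded[where F = "edge_polys ps \<union> forms \<phi> T" and p = p and a = a])
  show "p \<in> ideal_gen (insert (linform u (\<phi> (u, n))) (edge_polys ps \<union> forms \<phi> T))"
    using assms(1) by (simp add: section_insert_eq)
qed (use assms(2) that in \<open>auto simp: section_ideal_def intro: linform_piece section_generators_homogeneous\<close>)

lemma section_Cons: "section_ideal ((v, W) # ps) T \<phi> =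
    ideal_gen (insert (lss_poly (insert v W)) (edge_polys ps \<union> forms \<phi> T))"
  by (simp add: section_ideal_def edge_polys_def)

lemma section_ConsE:
  assumes "p \<in> section_ideal ((v, W) # ps) T \<phi>" "p \<in> graded_piece a"
  obtains h where "h \<in> graded_piece (\<lambda>i. a i - (if i \<in> insert v W then 1 else 0))"
    "p - lss_poly (insert v W) * h \<in> section_ideal ps T \<phi>"
proof (rule ideal_gen_insert_graded[where F = "edge_polys ps \<union> forms \<phi> T" and p = p and a = a])
  show "p \<in> ideal_gen (insert (lss_poly (insert v W)) (edge_polys ps \<union> forms \<phi> T))"
    using assms(1) by (simp add: section_Cons)
qed (use assms(2) that in \<open>auto simp: section_ideal_def intro: lss_poly_piece section_generators_homogeneous\<close>)

lemma section_ConsI: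
  "p - lss_poly (insert v W) * h \<in> section_ideal ps T \<phi> \<Longrightarrow> p \<in> section_ideal ((v, W) # ps) T \<phi>"
  unfolding section_Cons section_ideal_def[of ps T] ideal_gen_insert by blast

lemma section_Cons_absorb:
  "lss_poly (insert v W) \<in> section_ideal ps T \<phi> \<Longrightarrow> section_ideal ((v, W) # ps) T \<phi> = section_ideal ps T \<phi>"
  unfolding section_Cons section_ideal_def[of ps T] by (rule ideal_gen_absorb)

lemma var_in_section:
  assumes "general_position L \<phi>" "T \<subseteq> L" "finite L" "card (labels_at T u) \<ge> CARD('d)"
  shows "var u j \<in> section_ideal ps T \<phi>"
proof -
  obtain X where X: "X \<subseteq> labels_at T u" "card X = CARD('d)"
    using obtain_subset_with_card_n[OF assms(4)] by metis
  then have sp: "vec.span ((\<lambda>n. \<phi> (u, n)) ` X) = UNIV"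
    using assms labels_at_mono[of T L u] unfolding general_position_def by blast
  have "linform u (axis j 1) \<in> section_ideal ps T \<phi>"
    by (rule linform_span_in_ideal[OF is_ideal_section, of "(\<lambda>n. \<phi> (u, n)) ` X"])
      (use X sp in \<open>auto simp: labels_at_def intro: linform_in_section\<close>)
  then show ?thesis by (simp add: linform_axis)
qed

lemma section_cong: "(\<And>x. x \<in> T \<Longrightarrow> \<phi> x = \<phi>' x) \<Longrightarrow> section_ideal ps T \<phi> = section_ideal ps T \<phi>'"
proof -
  assume "\<And>x. x \<in> T \<Longrightarrow> \<phi> x = \<phi>' x"
  then have "forms \<phi> T = forms \<phi>' T" unfolding forms_def by (intro image_cong) auto
  then show ?thesis by (simp add: section_ideal_def)
qed

end

subsection \<open>Filter-regular sections\<close>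

definition vertices :: "('n \<times> 'n set) list \<Rightarrow> 'n set" where
  "vertices ps = (\<Union>(v, W)\<in>set ps. insert v W)"

lemma vertices_simps [simp]:
  "vertices [] = {}" "vertices ((v, W) # ps) = insert v W \<union> vertices ps"
  by (auto simp: vertices_def)

text \<open>Degree 0 at \<open>u\<close> is critical at a vertex of an edge: with one edge {v, w}
  and d - 1 forms at w the section contains c z_w, so z_w kills c, which has degree 0 at w. It is
  also critical once there are d forms at \<open>u\<close>: then all variables at \<open>u\<close>
  vanish and every form kills 1.\<close>

definition filter_regular ::
    "('n \<times> 'n set) list \<Rightarrow> ('n \<times> nat) set \<Rightarrow> ('n \<times> nat \<Rightarrow> 'k::field ^ 'd::finite) \<Rightarrow> bool" where
  "filter_regular ps L \<phi> \<longleftrightarrow> (\<forall>T u n a. \<forall>g \<in> graded_piece a. T \<subseteq> L \<and> (u, n) \<in> L - T \<and>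
    (a u \<ge> 1 \<or> u \<notin> vertices ps \<and> card (labels_at T u) < CARD('d)) \<and>
    linform u (\<phi> (u, n)) * g \<in> section_ideal ps T \<phi> \<longrightarrow> g \<in> section_ideal ps T \<phi>)"

text \<open>Models the quotient by \<open>vec.span A\<close> inside the same space, so that a
  substitution can take the place of the passage to a quotient ring.\<close>

lemma vec_projection_exists:
  "\<exists>\<pi>. Vector_Spaces.linear (*s) (*s) \<pi> \<and> (\<forall>y\<in>vec.span A. \<pi> y = 0) \<and>
    (\<forall>y. y - \<pi> y \<in> vec.span A)" for A :: "('k::field ^ 'd::finite) set"
proof -
  obtain B where B: "B \<subseteq> A" "vec.independent B" "A \<subseteq> vec.span B"
    using vec.maximal_independent_subset[of A] by blast
  have sp: "vec.span B = vec.span A"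
    using B by (metis vec.span_mono vec.span_span subset_antisym)
  define B' where "B' = vec.extend_basis B"
  have B': "B \<subseteq> B'" "vec.independent B'" "vec.span B' = UNIV"
    using vec.extend_basis_superset vec.independent_extend_basis vec.span_extend_basis B(2)
    by (auto simp: B'_def)
  obtain \<pi> where lin: "Vector_Spaces.linear (*s) (*s) \<pi>"
    and \<pi>: "\<And>x. x \<in> B' \<Longrightarrow> \<pi> x = (if x \<in> B then 0 else x)"
    using vec.linear_independent_extend[OF B'(2), of "\<lambda>x. if x \<in> B then 0 else x"] by blast
  interpret \<pi>: Vector_Spaces.linear "(*s)" "(*s)" \<pi> by (rule lin)
  have "\<pi> y = 0" if "y \<in> vec.span B" for y
    using that
  proof (induction rule: vec.span_induct_alt)
    case (step c x y)
    then show ?case using B'(1) by (auto simp: \<pi>.add \<pi>.scale \<pi>)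
  qed (simp add: \<pi>.zero)
  moreover have "y - \<pi> y \<in> vec.span B" for y
  proof -
    have "y \<in> vec.span B'" by (simp add: B')
    then show ?thesis
    proof (induction rule: vec.span_induct_alt)
      case base
      then show ?case by (simp add: \<pi>.zero vec.span_zero)
    next
      case (step c x y)
      have "(c *s x + y) - \<pi> (c *s x + y) = c *s (x - \<pi> x) + (y - \<pi> y)"
        by (simp add: \<pi>.add \<pi>.scale vec.scale_right_diff_distrib)
      moreover have "x - \<pi> x \<in> vec.span B"
        using step by (auto simp: \<pi> vec.span_zero vec.span_base)
      ultimately show ?case using step by (simp only: vec.span_add vec.span_scale)
    qed
  qed
  ultimately show ?thesis using lin sp by metis
qed

text \<open>Without edges the section ideal is the kernel of the substitution \<open>\<psi>\<close>
  given by the projections. The quotient therefore embeds into the polynomial ring, a domain, and a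
  form outside the span of those already used is a non-zero-divisor. After d forms at
  \<open>u\<close>, everything of positive degree at \<open>u\<close> lies in the ideal.\<close>

lemma filter_regular_Nil:
  fixes \<phi> :: "'n::finite \<times> nat \<Rightarrow> 'k::field ^ 'd::finite"
  assumes fin: "finite L" and gp: "general_position L \<phi>"
    and big: "\<And>u. card (labels_at L u) \<ge> CARD('d)"
  shows "filter_regular [] L \<phi>"
  unfolding filter_regular_def
proof (intro allI ballI impI, elim conjE)
  fix T u n a g
  assume T: "T \<subseteq> L" and n: "(u, n) \<in> L - T" and g: "g \<in> graded_piece a"
    and deg: "1 \<le> a u \<or> u \<notin> vertices [] \<and> card (labels_at T u) < CARD('d)"
    and lg: "linform u (\<phi> (u, n)) * g \<in> section_ideal [] T \<phi>"
  let ?I = "section_ideal [] T \<phi>"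
  show "g \<in> ?I"
  proof (cases "card (labels_at T u) < CARD('d)")
    case False
    then have "var u j \<in> ?I" for j using var_in_section[OF gp T fin] by simp
    then show ?thesis
      using deg False graded_piece_in_ideal[OF is_ideal_section _ g] by blast
  next
    case True
    define A where "A w = (\<lambda>n. \<phi> (w, n)) ` labels_at T w" for w
    have finT: "finite (labels_at T u)" using fin T by (meson finite_labels_at finite_subset)
    have y: "\<phi> (u, n) \<notin> vec.span (A u)"
    proof
      assume y: "\<phi> (u, n) \<in> vec.span (A u)"
      have nT: "n \<notin> labels_at T u" using n by (simp add: labels_at_def)
      have "insert n (labels_at T u) \<subseteq> labels_at L u" using n T by (auto simp: labels_at_def)
      moreover have "card (insert n (labels_at T u)) \<le> CARD('d)" using True finT nT by simp
      \<comment> \<open>The labels are completed to exactly d. If \<open>\<phi> (u, n)\<close>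
        depended on the forms in \<open>T\<close>, the other d - 1 vectors would already span the
        whole space.\<close>
      ultimately obtain X where X: "insert n (labels_at T u) \<subseteq> X" "X \<subseteq> labels_at L u" "card X = CARD('d)"
        using exists_subset_between[of "insert n (labels_at T u)" "CARD('d)" "labels_at L u"]
          big fin finite_labels_at by metis
      have finX: "finite X" using X fin finite_labels_at finite_subset by metis
      let ?B = "(\<lambda>n. \<phi> (u, n)) ` (X - {n})"
      have "vec.span (A u) \<subseteq> vec.span ?B"
        using X nT by (intro vec.span_mono) (auto simp: A_def)
      then have "(\<lambda>n. \<phi> (u, n)) ` X \<subseteq> vec.span ?B"
        using y by (auto intro: vec.span_base)
      then have "UNIV \<subseteq> vec.span ?B"
        using gp X vec.span_minimal[OF _ vec.subspace_span] unfolding general_position_def by metis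
      then have "vec.dim (UNIV :: ('k ^ 'd) set) \<le> card ?B"
        using finX by (intro vec.dim_le_card) auto
      also have "\<dots> \<le> card (X - {n})" using finX by (intro card_image_le) auto
      also have "\<dots> < CARD('d)" using X finX by (metis card_Diff1_less insert_subset)
      finally show False by (simp add: vec.dim_UNIV card_cart_basis)
    qed
    obtain \<pi> where \<pi>: "\<And>w. Vector_Spaces.linear (*s) (*s) (\<pi> w)"
      "\<And>w y. y \<in> vec.span (A w) \<Longrightarrow> \<pi> w y = 0" "\<And>w y. y - \<pi> w y \<in> vec.span (A w)"
      using vec_projection_exists[of "A _"] by metis
    define \<psi> where "\<psi> = poly_subst (\<lambda>i j. linform i (\<pi> i (axis j 1)))"
    have \<psi>_lin: "\<psi> (linform i y) = linform i (\<pi> i y)" for i y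
    proof -
      interpret \<pi>: Vector_Spaces.linear "(*s)" "(*s)" "\<pi> i" by (rule \<pi>)
      have "y = (\<Sum>j\<in>UNIV. (y $ j) *s axis j 1)" by (rule basis_expansion[symmetric])
      then have "\<pi> i y = \<pi> i (\<Sum>j\<in>UNIV. (y $ j) *s axis j 1)" by (rule arg_cong)
      also have "\<dots> = (\<Sum>j\<in>UNIV. (y $ j) *s \<pi> i (axis j 1))" by (simp only: \<pi>.sum \<pi>.scale)
      finally have "linform i (\<pi> i y) = (\<Sum>j\<in>UNIV. const (y $ j) * linform i (\<pi> i (axis j 1)))"
        by (simp only: linform_sum linform_scale)
      then show ?thesis
        by (simp add: \<psi>_def linform_def[of i y] poly_subst_sum poly_subst_mult poly_subst_const
            poly_subst_var)
    qed
    have linA: "linform w y \<in> ?I" if "y \<in> vec.span (A w)" for w y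
      by (rule linform_span_in_ideal[OF is_ideal_section _ that])
        (auto simp: A_def labels_at_def intro: linform_in_section)
    \<comment> \<open>Together with the vanishing of \<open>\<psi>\<close> on the ideal, shown next,
      this identifies the ideal with the kernel of \<open>\<psi>\<close>.\<close>
    have cong: "p - \<psi> p \<in> ?I" for p
    proof (induction p rule: mpoly_induct)
      case (const c)
      then show ?case by (simp add: \<psi>_def poly_subst_const ideal_0[OF is_ideal_section])
    next
      case (var i j)
      then show ?case using linA[OF \<pi>(3)[of "axis j 1" i]] \<psi>_lin[of i "axis j 1"]
        by (simp add: linform_diff linform_axis)
    next
      case (add p q)
      then have "(p - \<psi> p) + (q - \<psi> q) \<in> ?I" by (rule ideal_add[OF is_ideal_section])
      then show ?case by (simp add: \<psi>_def poly_subst_add algebra_simps)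
    next
      case (mult p q)
      then have "(p - \<psi> p) * q + \<psi> p * (q - \<psi> q) \<in> ?I"
        by (intro ideal_add[OF is_ideal_section] ideal_mult[OF is_ideal_section]
            ideal_mult_right[OF is_ideal_section])
      then show ?case by (simp add: \<psi>_def poly_subst_mult algebra_simps)
    qed
    have "\<psi> p = 0" if "p \<in> ?I" for p
      using that unfolding section_ideal_def
    proof (induction rule: ideal_gen_induct)
      case (step c f p)
      then obtain w m where "(w, m) \<in> T" "f = linform w (\<phi> (w, m))"
        by (auto simp: edge_polys_def forms_def)
      moreover from this have "\<phi> (w, m) \<in> vec.span (A w)"
        by (intro vec.span_base) (auto simp: A_def labels_at_def)
      ultimately have "\<psi> f = 0" by (simp add: \<psi>_lin \<pi>)
      then show ?case using step by (simp add: \<psi>_def poly_subst_add poly_subst_mult)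
    qed (simp add: \<psi>_def)
    then have "\<psi> (linform u (\<phi> (u, n)) * g) = 0" using lg by blast
    then have "\<psi> (linform u (\<phi> (u, n))) * \<psi> g = 0" by (simp only: \<psi>_def poly_subst_mult)
    moreover have "\<pi> u (\<phi> (u, n)) \<noteq> 0" using \<pi>(3)[of "\<phi> (u, n)" u] y by auto
    ultimately have "\<psi> g = 0"
      using mpoly_no_zero_divisors[of "\<psi> (linform u (\<phi> (u, n)))" "\<psi> g"]
      by (simp add: \<psi>_lin linform_eq_0_iff)
    then show ?thesis using cong[of g] by simp
  qed
qed

text \<open>The list of edges starts with the last one. The vector \<open>\<mu> w\<close> spans the orthogonal complement of
  the forms \<open>X w\<close>, so modulo these forms the variables at \<open>w\<close> are proportional to \<open>\<mu> w\<close>; the new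
  label \<open>(v, n)\<close> is the form \<open>c\<close> at \<open>v\<close> to which the last edge then degenerates.\<close>

fun good_position ::
    "('n \<times> 'n set) list \<Rightarrow> ('n \<times> nat) set \<Rightarrow> ('n \<times> nat \<Rightarrow> 'k::field ^ 'd::finite) \<Rightarrow> bool" where
  "good_position [] L \<phi> \<longleftrightarrow> general_position L \<phi>"
| "good_position ((v, W) # ps) L \<phi> \<longleftrightarrow>
    (\<forall>X. (\<forall>w\<in>W. X w \<subseteq> labels_at L w \<and> card (X w) = CARD('d) - 1) \<longrightarrow>
      (\<exists>n \<mu>. (v, n) \<notin> L \<and> (\<forall>w\<in>W. \<mu> w \<noteq> 0 \<and> (\<forall>x\<in>X w. (\<Sum>j\<in>UNIV. \<phi> (w, x) $ j * \<mu> w $ j) = 0)) \<and>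
        good_position ps (insert (v, n) L) (\<phi>((v, n) := \<chi> j. \<Prod>w\<in>W. \<mu> w $ j))))"

text \<open>The tail of the list holds the earlier edges; \<open>W\<close> avoids them, while
  \<open>v\<close> may lie on them. A nonempty \<open>W\<close> is what allows the form c to be
  prescribed.\<close>

fun rooted_forest :: "('n \<times> 'n set) list \<Rightarrow> bool" where
  "rooted_forest [] \<longleftrightarrow> True"
| "rooted_forest ((v, W) # ps) \<longleftrightarrow> v \<notin> W \<and> W \<noteq> {} \<and> W \<inter> vertices ps = {} \<and> rooted_forest ps"

lemma general_position_cong:
  fixes \<phi> :: "'n \<times> nat \<Rightarrow> 'k::field ^ 'd::finite"
  assumes "general_position L' \<phi>'" "L \<subseteq> L'" "\<And>x. x \<in> L \<Longrightarrow> \<phi>' x = \<phi> x"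
  shows "general_position L \<phi>"
  unfolding general_position_def
proof (intro allI impI, elim conjE)
  fix u X assume X: "X \<subseteq> labels_at L u" "card X = CARD('d)"
  then have "(\<lambda>n. \<phi> (u, n)) ` X = (\<lambda>n. \<phi>' (u, n)) ` X"
    using assms(3) by (intro image_cong) (auto simp: labels_at_def)
  moreover have "X \<subseteq> labels_at L' u" using X labels_at_mono[OF assms(2)] by blast
  then have "vec.span ((\<lambda>n. \<phi>' (u, n)) ` X) = UNIV"
    using assms(1) X(2) unfolding general_position_def by blast
  ultimately show "vec.span ((\<lambda>n. \<phi> (u, n)) ` X) = UNIV" by simp
qed

lemma exists_subset_labels:
  assumes "A \<subseteq> B" "card A \<le> k" "k \<le> card B" "finite B"
  shows "\<exists>X. A \<subseteq> X \<and> X \<subseteq> B \<and> card X = k"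
  using exists_subset_between[of A k B] assms by metis

text \<open>Each step of the recursion adds a label and keeps the old forms, so general position is
  inherited from the end of the list. Some choice of \<open>X\<close> exists because every vertex
  has at least d labels.\<close>

lemma good_position_general:
  fixes \<phi> :: "'n \<times> nat \<Rightarrow> 'k::field ^ 'd::finite"
  assumes "finite L" "\<And>u. card (labels_at L u) \<ge> CARD('d)" "good_position ps L \<phi>"
  shows "general_position L \<phi>"
  using assms
proof (induction ps arbitrary: L \<phi>)
  case (Cons p ps)
  obtain v W where p: "p = (v, W)" by force
  have "\<exists>X. {} \<subseteq> X \<and> X \<subseteq> labels_at L w \<and> card X = CARD('d) - 1" for w
    using Cons.prems(2)[of w] finite_labels_at[OF Cons.prems(1)]
    by (intro exists_subset_labels) auto
  then obtain X where "\<And>w. X w \<subseteq> labels_at L w \<and> card (X w) = CARD('d) - 1" by metis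
  then obtain n \<mu> where n: "(v, n) \<notin> L"
    and good: "good_position ps (insert (v, n) L) (\<phi>((v, n) := \<chi> j. \<Prod>w\<in>W. \<mu> w $ j))"
    using Cons.prems(3) unfolding p good_position.simps by blast
  have "card (labels_at (insert (v, n) L) u) \<ge> CARD('d)" for u
    by (rule le_trans[OF Cons.prems(2) card_mono[OF finite_labels_at[OF finite.insertI[OF Cons.prems(1)]]
          labels_at_mono[OF subset_insertI]]])
  then have "general_position (insert (v, n) L) (\<phi>((v, n) := \<chi> j. \<Prod>w\<in>W. \<mu> w $ j))"
    using Cons.IH good Cons.prems(1) by blast
  then show ?case
    by (rule general_position_cong) (use n in auto)
qed simp

lemma regularD:
  fixes \<phi> :: "'n::finite \<times> nat \<Rightarrow> 'k::field ^ 'd::finite"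
  assumes "filter_regular ps L \<phi>" "T \<subseteq> L" "(u, n) \<in> L" "(u, n) \<notin> T" "g \<in> graded_piece a"
    "a u \<ge> 1 \<or> u \<notin> vertices ps \<and> card (labels_at T u) < CARD('d)"
    "linform u (\<phi> (u, n)) * g \<in> section_ideal ps T \<phi>"
  shows "g \<in> section_ideal ps T \<phi>"
  using assms unfolding filter_regular_def by blast

text \<open>One step of \<open>good_position\<close> for one choice of \<open>X\<close>. The new
  label is already contained in \<open>L\<close>, regularity is assumed for the list without the new
  edge, and \<open>lead\<close> is the form c.\<close>

locale edge_section =
  fixes ps :: "('n::finite \<times> 'n set) list" and v :: 'n and W :: "'n set" and n0 :: nat
    and L :: "('n \<times> nat) set" and \<phi> :: "'n \<times> nat \<Rightarrow> 'k::field ^ 'd::finite"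
    and X :: "'n \<Rightarrow> nat set" and \<mu> :: "'n \<Rightarrow> 'k ^ 'd"
  assumes forest: "rooted_forest ((v, W) # ps)"
    and finL: "finite L" and n0: "(v, n0) \<in> L"
    and gp: "general_position L \<phi>" and big: "\<And>w. w \<in> W \<Longrightarrow> card (labels_at L w) \<ge> CARD('d)"
    and reg: "filter_regular ps L \<phi>"
    and X: "\<And>w. w \<in> W \<Longrightarrow> X w \<subseteq> labels_at L w" "\<And>w. w \<in> W \<Longrightarrow> card (X w) = CARD('d) - 1"
    and \<mu>: "\<And>w. w \<in> W \<Longrightarrow> \<mu> w \<noteq> 0"
      "\<And>w x. w \<in> W \<Longrightarrow> x \<in> X w \<Longrightarrow> (\<Sum>j\<in>UNIV. \<phi> (w, x) $ j * \<mu> w $ j) = 0"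
    and c: "\<phi> (v, n0) = (\<chi> j. \<Prod>w\<in>W. \<mu> w $ j)"
begin

abbreviation "S T \<equiv> section_ideal ps T \<phi>"
abbreviation "f \<equiv> lss_poly (insert v W) :: ('n, 'd, 'k) mpoly"
abbreviation "lead \<equiv> linform v (\<phi> (v, n0))"

lemma vW: "v \<notin> W" and W_fresh: "w \<in> W \<Longrightarrow> w \<notin> vertices ps"
  using forest by auto

lemma finite_X: "w \<in> W \<Longrightarrow> finite (X w)"
  using X(1) finL finite_labels_at finite_subset by metis

lemma CARD_d: "CARD('d) > 0" by simp

lemma f_eq: "f = (\<Sum>j\<in>UNIV. var v j * (\<Prod>w\<in>W. var w j))"
  unfolding lss_poly_def using vW by simp

text \<open>If \<open>lead\<close> kills g, it kills every x_vj g, and these have positive degree at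
  \<open>v\<close>. Cancelling \<open>lead\<close> puts all of them, and hence \<open>f * g\<close>,
  into the ideal.\<close>

lemma f_in_of_lead_in:
  assumes T: "T \<subseteq> L" "(v, n0) \<notin> T" and g: "g \<in> graded_piece a" and lg: "lead * g \<in> S T"
  shows "f * g \<in> S T"
proof (cases "a v < 0")
  case True
  then show ?thesis using graded_piece_neg[OF g True] by (simp add: ideal_0[OF is_ideal_section])
next
  case False
  have var_g: "var v j * g \<in> S T" for j
  proof (rule regularD[OF reg T(1) n0 T(2)])
    show "var v j * g \<in> graded_piece (\<lambda>i. (if i = v then 1 else 0) + a i)"
      by (rule graded_piece_mult[OF graded_piece_var g]) simp
    show "lead * (var v j * g) \<in> S T"
      using ideal_mult[OF is_ideal_section lg, of "var v j"] by (simp add: mult.left_commute)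
  qed (use False in auto)
  have "(\<Sum>j\<in>UNIV. (\<Prod>w\<in>W. var w j) * (var v j * g)) \<in> S T"
    by (rule ideal_sum[OF is_ideal_section], rule ideal_mult[OF is_ideal_section var_g])
  then show ?thesis by (simp add: f_eq sum_distrib_left sum_distrib_right ac_simps)
qed

text \<open>If all \<open>w \<in> W\<close> are cut down to one variable \<open>Z w\<close>, then \<open>f\<close> becomes a multiple of
  \<open>lead * (\<Prod>w\<in>W. Z w)\<close>.\<close>

lemma lead_in_of_f_in_full:
  assumes T: "T \<subseteq> L" "(v, n0) \<notin> T" and full: "\<And>w. w \<in> W \<Longrightarrow> labels_at T w = X w"
    and h: "h \<in> graded_piece a" and fh: "f * h \<in> S T"
  shows "lead * h \<in> S T"
proof -
  have "\<exists>z. z \<in> labels_at L w - X w" if "w \<in> W" for w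
  proof (rule ccontr)
    assume "\<not> ?thesis"
    then have "card (labels_at L w) \<le> card (X w)" using finite_X[OF that] by (intro card_mono) auto
    then show False using X(2)[OF that] big[OF that] CARD_d by linarith
  qed
  then obtain z where z: "\<And>w. w \<in> W \<Longrightarrow> z w \<in> labels_at L w - X w" by metis
  define \<rho> where "\<rho> w = (\<Sum>j\<in>UNIV. \<phi> (w, z w) $ j * \<mu> w $ j)" for w
  define Z where "Z w = linform w (\<phi> (w, z w))" for w
  define A where "A w = (\<lambda>n. \<phi> (w, n)) ` X w" for w
  \<comment> \<open>The functional with coefficients \<open>\<mu> w\<close> has kernel
    \<open>vec.span (A w)\<close>. So modulo the forms in \<open>X w\<close>, a form at
    \<open>w\<close> is a multiple of \<open>Z w\<close>, with its value under \<open>dotp w\<close>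
    divided by \<open>\<rho> w\<close> as the factor.\<close>
  define dotp where "dotp w y = (\<Sum>j\<in>UNIV. y $ j * \<mu> w $ j)" for w and y :: "'k ^ 'd"
  have dot_lin: "dotp w (b *s x + y) = b * dotp w x + dotp w y" for w b x y
    by (simp add: dotp_def sum.distrib sum_distrib_left algebra_simps)
  have dot_A: "dotp w y = 0" if "w \<in> W" "y \<in> vec.span (A w)" for w y
    using that(2)
  proof (induction rule: vec.span_induct_alt)
    case base
    then show ?case by (simp add: dotp_def)
  next
    case (step b x y)
    then have "dotp w x = 0" using \<mu>(2)[OF that(1)] by (auto simp: A_def dotp_def)
    then show ?case using step by (simp add: dot_lin)
  qed
  have span: "y \<in> vec.span (insert (\<phi> (w, z w)) (A w))" if w: "w \<in> W" for w y
  proof -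
    have "card (insert (z w) (X w)) = CARD('d)"
      using z[OF w] X(2)[OF w] finite_X[OF w] CARD_d by (simp del: zero_less_card_finite)
    moreover have "insert (z w) (X w) \<subseteq> labels_at L w" using z[OF w] X(1)[OF w] by auto
    ultimately have "vec.span ((\<lambda>n. \<phi> (w, n)) ` insert (z w) (X w)) = UNIV"
      using gp unfolding general_position_def by blast
    then show ?thesis by (simp add: A_def)
  qed
  have \<rho>: "\<rho> w \<noteq> 0" if w: "w \<in> W" for w
  proof
    assume 0: "\<rho> w = 0"
    have "dotp w y = 0" for y
    proof -
      obtain b where b: "y - b *s \<phi> (w, z w) \<in> vec.span (A w)"
        using span[OF w, of y] by (auto simp: vec.span_insert)
      then have "dotp w (b *s \<phi> (w, z w) + (y - b *s \<phi> (w, z w))) = 0"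
        unfolding dot_lin dot_A[OF w b] using 0 by (simp add: \<rho>_def dotp_def)
      then show ?thesis by simp
    qed
    then have "\<mu> w $ j = 0" for j
      using \<open>dotp w (axis j 1) = 0\<close> by (simp add: dotp_def axis_def if_distrib if_distribR sum.delta cong: if_cong)
    then show False using \<mu>(1)[OF w] by (simp add: vec_eq_iff)
  qed
  have in_span: "y - (dotp w y / \<rho> w) *s \<phi> (w, z w) \<in> vec.span (A w)" if w: "w \<in> W" for w y
  proof -
    obtain b where b: "y - b *s \<phi> (w, z w) \<in> vec.span (A w)"
      using span[OF w, of y] by (auto simp: vec.span_insert)
    have "dotp w y = dotp w (b *s \<phi> (w, z w) + (y - b *s \<phi> (w, z w)))" by simp
    also have "\<dots> = b * \<rho> w" unfolding dot_lin dot_A[OF w b] by (simp add: \<rho>_def dotp_def)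
    finally show ?thesis using b \<rho>[OF w] by simp
  qed
  have var_cong: "var w j - const (\<mu> w $ j / \<rho> w) * Z w \<in> S T" if w: "w \<in> W" for w j
  proof -
    have "dotp w (axis j 1) = \<mu> w $ j"
      by (simp add: dotp_def axis_def if_distrib if_distribR sum.delta cong: if_cong)
    then have "axis j 1 - (\<mu> w $ j / \<rho> w) *s \<phi> (w, z w) \<in> vec.span (A w)"
      using in_span[OF w, of "axis j 1"] by simp
    then have "linform w (axis j 1 - (\<mu> w $ j / \<rho> w) *s \<phi> (w, z w)) \<in> S T"
      by (rule linform_span_in_ideal[OF is_ideal_section, rotated])
        (use full[OF w] in \<open>auto simp: A_def labels_at_def intro!: linform_in_section\<close>)
    then show ?thesis by (simp add: linform_diff linform_axis linform_scale Z_def)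
  qed
  \<comment> \<open>The factors 1/\<open>\<rho> w\<close> do not depend on \<open>j\<close> and come
    out of the sum; what remains, the product of the \<open>\<mu> w $ j\<close>, is the coefficient
    of \<open>lead\<close> at \<open>j\<close>.\<close>
  define \<kappa> where "\<kappa> = (\<Prod>w\<in>W. inverse (\<rho> w))"
  have \<kappa>: "\<kappa> \<noteq> 0" using \<rho> by (simp add: \<kappa>_def)
  have "f - const \<kappa> * (lead * (\<Prod>w\<in>W. Z w)) =
      (\<Sum>j\<in>UNIV. var v j * ((\<Prod>w\<in>W. var w j) - (\<Prod>w\<in>W. const (\<mu> w $ j / \<rho> w) * Z w)))"
  proof -
    have "(\<Prod>w\<in>W. const (\<mu> w $ j / \<rho> w) * Z w) = const \<kappa> * (const (\<phi> (v, n0) $ j) * (\<Prod>w\<in>W. Z w))" for j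
      by (simp add: c \<kappa>_def const_prod const_mult divide_inverse prod.distrib ac_simps)
    then show ?thesis
      by (simp add: f_eq linform_def sum_subtractf right_diff_distrib sum_distrib_left
          sum_distrib_right ac_simps)
  qed
  also have "\<dots> \<in> S T"
    by (intro ideal_sum ideal_mult ideal_prod_cong is_ideal_section var_cong) auto
  finally have "(f - const \<kappa> * (lead * (\<Prod>w\<in>W. Z w))) * h \<in> S T"
    by (rule ideal_mult_right[OF is_ideal_section])
  then have "f * h - (f - const \<kappa> * (lead * (\<Prod>w\<in>W. Z w))) * h \<in> S T"
    by (rule ideal_diff[OF is_ideal_section fh])
  then have "const \<kappa> * ((\<Prod>w\<in>W. Z w) * (lead * h)) \<in> S T"
    by (simp add: left_diff_distrib right_diff_distrib ac_simps)
  then have "const (inverse \<kappa>) * (const \<kappa> * ((\<Prod>w\<in>W. Z w) * (lead * h))) \<in> S T"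
    by (rule ideal_mult[OF is_ideal_section])
  then have "(\<Prod>w\<in>W. Z w) * (lead * h) \<in> S T"
    by (simp only: const_inverse_cancel[OF \<kappa>])
  \<comment> \<open>The \<open>Z w\<close> are cancelled one at a time: \<open>w\<close> lies on no
    edge of \<open>ps\<close> and carries only d - 1 forms, so the second alternative in
    \<open>filter_regular\<close> applies in every degree.\<close>
  moreover have "g \<in> S T" if "finite B" "B \<subseteq> W" "g \<in> graded_piece b" "(\<Prod>w\<in>B. Z w) * g \<in> S T"
    for B g b
    using that
  proof (induction B arbitrary: g b rule: finite_induct)
    case (insert w B)
    have w: "w \<in> W" using insert by simp
    have Zg: "Z w * g \<in> graded_piece (\<lambda>i. (if i = w then 1 else 0) + b i)"
      unfolding Z_def by (rule graded_piece_mult[OF linform_piece]) (use insert in auto)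
    have "(\<Prod>w\<in>B. Z w) * (Z w * g) \<in> S T" using insert by (simp add: ac_simps)
    then have "Z w * g \<in> S T" using insert Zg by blast
    then have Zg_in: "linform w (\<phi> (w, z w)) * g \<in> S T" by (simp only: Z_def)
    have "(w, z w) \<in> L" "(w, z w) \<notin> T"
      using z[OF w] full[OF w] by (auto simp: labels_at_def)
    moreover have "w \<notin> vertices ps \<and> card (labels_at T w) < CARD('d)"
      using full[OF w] W_fresh[OF w] X(2)[OF w] CARD_d by simp
    ultimately show ?case using regularD[OF reg T(1) _ _ insert.prems(2) _ Zg_in] by blast
  qed simp
  ultimately show ?thesis
    using graded_piece_mult[OF linform_piece h refl] finite[of W] by blast
qed

text \<open>Induction on the number of forms in \<open>X\<close> that are missing from
  \<open>T\<close>, starting from the case above. Let s be a missing form. The induction hypothesis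
  over \<open>T\<close> and s gives lead h = s h' modulo the ideal. As s can also be cancelled after
  adding lead, h' = lead h'' modulo the ideal; so lead, and therefore f, kills h - s h''. Then s f
  h'', and hence f h'', lies in the ideal. Since h'' has smaller degree, an inner induction gives
  that lead kills h'', and thus h.\<close>

lemma lead_in_of_f_in:
  assumes "T \<subseteq> L" "(v, n0) \<notin> T" and "\<And>w. w \<in> W \<Longrightarrow> labels_at T w \<subseteq> X w"
    and "h \<in> graded_piece a" and "f * h \<in> S T"
  shows "lead * h \<in> S T"
  using assms
proof (induction "card {(w, x). w \<in> W \<and> x \<in> X w \<and> (w, x) \<notin> T}" arbitrary: T h a rule: less_induct)
  case (less T)
  let ?D = "\<lambda>T. {(w, x). w \<in> W \<and> x \<in> X w \<and> (w, x) \<notin> T}"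
  have fin_D: "finite (?D T)"
    by (rule finite_subset[of _ "SIGMA w:W. X w"]) (auto intro: finite_X)
  note T = less.prems(1,2)
  show ?case
  proof (cases "?D T = {}")
    case True
    then have "labels_at T w = X w" if "w \<in> W" for w
      using less.prems(3) that by (auto simp: labels_at_def)
    then show ?thesis using lead_in_of_f_in_full less.prems by blast
  next
    case False
    then obtain w x where wx: "w \<in> W" "x \<in> X w" "(w, x) \<notin> T" by auto
    let ?s = "linform w (\<phi> (w, x))"
    have T': "insert (w, x) T \<subseteq> L" "(v, n0) \<notin> insert (w, x) T"
      "\<And>w'. w' \<in> W \<Longrightarrow> labels_at (insert (w, x) T) w' \<subseteq> X w'"
      using less.prems wx X(1)[OF wx(1)] vW by (auto simp: labels_at_def)
    have wxL: "(w, x) \<in> L" using T'(1) by simp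
    have psub: "?D (insert (w, x) T) \<subset> ?D T" using wx by auto
    have step: "lead * h \<in> S (insert (w, x) T)" if "h \<in> graded_piece a" "f * h \<in> S T" for h a
    proof -
      have "f * h \<in> S (insert (w, x) T)" using that(2) section_mono[OF subset_insertI] by (rule rev_subsetD)
      with psubset_card_mono[OF fin_D psub] T' that(1) show ?thesis by (rule less.hyps)
    qed
    have "labels_at T w \<subset> X w" using less.prems(3)[OF wx(1)] wx by (auto simp: labels_at_def)
    then have "card (labels_at T w) < card (X w)" by (rule psubset_card_mono[OF finite_X[OF wx(1)]])
    then have card_w: "card (labels_at T w) < CARD('d)" using X(2)[OF wx(1)] by linarith
    have "\<forall>a h. nat (sum a UNIV) = k \<longrightarrow> h \<in> graded_piece a \<longrightarrow> f * h \<in> S T \<longrightarrow> lead * h \<in> S T" for k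
    proof (induction k rule: less_induct)
      case (less k)
      show ?case
      proof (intro allI impI)
        fix a h assume k: "nat (sum a UNIV) = k" and h: "h \<in> graded_piece a" and fh: "f * h \<in> S T"
        have lh: "lead * h \<in> graded_piece (\<lambda>i. (if i = v then 1 else 0) + a i)"
          by (rule graded_piece_mult[OF linform_piece h]) simp
        from section_insertE[OF step[OF h fh] lh] obtain h'
          where h': "h' \<in> graded_piece (\<lambda>i. (if i = v then 1 else 0) + a i - (if i = w then 1 else 0))"
            "lead * h - ?s * h' \<in> S T" .
        have wv: "w \<noteq> v" using wx vW by auto
        let ?Tc = "insert (v, n0) T"
        have Tc: "?Tc \<subseteq> L" "(w, x) \<notin> ?Tc" using T(1) n0 wx wv by auto
        have "lead * h \<in> S ?Tc"
          by (intro ideal_mult_right[OF is_ideal_section] linform_in_section) simp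
        then have "?s * h' \<in> S ?Tc"
          using ideal_diff[OF is_ideal_section, of "lead * h" ps ?Tc \<phi> "lead * h - ?s * h'"]
            h'(2) section_mono[of T ?Tc ps \<phi>] by auto
        then have "h' \<in> S ?Tc"
          using regularD[OF reg Tc(1) wxL Tc(2) h'(1)] W_fresh[OF wx(1)] card_w wv
          by (simp add: labels_at_insert)
        from section_insertE[OF this h'(1)] obtain h''
          where h'': "h'' \<in> graded_piece (\<lambda>i. (if i = v then 1 else 0) + a i - (if i = w then 1 else 0)
              - (if i = v then 1 else 0))" "h' - lead * h'' \<in> S T" .
        let ?b = "\<lambda>i. a i - (if i = w then 1 else 0)"
        have h2: "h'' \<in> graded_piece ?b" using h''(1) by (simp add: algebra_simps cong: if_cong)
        have "?s * h'' \<in> graded_piece a" by (rule graded_piece_mult[OF linform_piece h2]) simp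
        then have diff: "h - ?s * h'' \<in> graded_piece a" by (rule graded_piece_diff[OF h])
        have "lead * (h - ?s * h'') = (lead * h - ?s * h') + ?s * (h' - lead * h'')"
          by (simp add: algebra_simps)
        then have ld: "lead * (h - ?s * h'') \<in> S T"
          using h'(2) h''(2) by (simp add: ideal_add ideal_mult is_ideal_section)
        have "f * (h - ?s * h'') \<in> S T" by (rule f_in_of_lead_in[OF T diff ld])
        then have "f * h - f * (h - ?s * h'') \<in> S T" by (rule ideal_diff[OF is_ideal_section fh])
        then have sfh: "?s * (f * h'') \<in> S T" by (simp add: right_diff_distrib mult.left_commute)
        have "f * h'' \<in> graded_piece (\<lambda>i. (if i \<in> insert v W then 1 else 0) + ?b i)"
          by (rule graded_piece_mult[OF lss_poly_piece h2]) simp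
        then have fh2: "f * h'' \<in> S T"
          using regularD[OF reg T(1) wxL wx(3) _ _ sfh] W_fresh[OF wx(1)] card_w by blast
        \<comment> \<open>If \<open>?b\<close> is negative somewhere, \<open>nat\<close> of its sum
          need not decrease, but then \<open>h''\<close> is 0.\<close>
        have "lead * h'' \<in> S T"
        proof (cases "\<forall>i. ?b i \<ge> 0")
          case True
          have "sum ?b UNIV = sum a UNIV - 1" by (simp add: sum_subtractf)
          moreover have "sum ?b UNIV \<ge> 0" using True by (intro sum_nonneg) auto
          ultimately have "nat (sum ?b UNIV) < k" using k by linarith
          then show ?thesis using less.IH h2 fh2 by blast
        next
          case False
          then have "h'' = 0" using graded_piece_neg[OF h2] by (meson not_le)
          then show ?thesis by (simp add: ideal_0[OF is_ideal_section])
        qed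
        then have "lead * (h - ?s * h'') + ?s * (lead * h'') \<in> S T"
          by (rule ideal_add[OF is_ideal_section ld ideal_mult[OF is_ideal_section]])
        then show "lead * h \<in> S T" by (simp add: algebra_simps)
      qed
    qed
    then show ?thesis using less.prems by blast
  qed
qed

end

section \<open>Hilbert series and regularity after adding the edge\<close>

context edge_section
begin

text \<open>Adding \<open>f\<close> in degree \<open>a\<close> and adding \<open>lead\<close> in
  degree \<open>b a\<close> involve multipliers of the same degree and the same colon ideal, so both
  change the Hilbert series by the same amount.\<close>

lemma hilbert_series_edge:
  assumes T: "T \<subseteq> L" "(v, n0) \<notin> T" and TX: "\<And>w. w \<in> W \<Longrightarrow> labels_at T w \<subseteq> X w"
  defines "b \<equiv> \<lambda>a i. a i - (if i \<in> W then 1 else 0 :: int)"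
  shows "hilbert_series (section_ideal ((v, W) # ps) T \<phi>) a + hilbert_series (S T) (b a) =
    hilbert_series (S T) a + hilbert_series (S (insert (v, n0) T)) (b a)"
proof -
  let ?F = "edge_polys ps \<union> forms \<phi> T" and ?a = "\<lambda>i. a i - (if i \<in> insert v W then 1 else 0)"
  have "hilbert_series (section_ideal ((v, W) # ps) T \<phi>) a +
      mpoly.dim {h \<in> graded_piece ?a. f * h \<in> S T} =
      hilbert_series (S T) a + card {m :: ('n, 'd) mon. mdeg m = ?a}"
    unfolding section_Cons section_ideal_def[of ps T]
    by (rule hilbert_series_insert[OF section_generators_homogeneous lss_poly_piece])
  moreover have "?a = (\<lambda>i. b a i - (if i = v then 1 else 0))"
    using vW by (auto simp: b_def fun_eq_iff)
  then have "hilbert_series (S (insert (v, n0) T)) (b a) +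
      mpoly.dim {h \<in> graded_piece ?a. lead * h \<in> S T} =
      hilbert_series (S T) (b a) + card {m :: ('n, 'd) mon. mdeg m = ?a}"
    using hilbert_series_insert[of ?F lead "\<lambda>i. if i = v then 1 else 0" "b a",
        OF section_generators_homogeneous linform_piece]
    unfolding section_insert_eq section_ideal_def[of ps T] by simp
  moreover have "{h \<in> graded_piece ?a. f * h \<in> S T} = {h \<in> graded_piece ?a. lead * h \<in> S T}"
    using lead_in_of_f_in[OF T TX] f_in_of_lead_in[OF T] by blast
  ultimately show ?thesis by simp
qed

text \<open>Let l g = f h modulo the old ideal. It suffices to find h'' such that f kills h - l h'':
  then l (g - f h'') lies in the old ideal, where l can be cancelled. The alternatives in
  \<open>TX\<close> say that the forms at \<open>W\<close> still fit into \<open>X\<close> after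
  adding l, or that l brings their number at a vertex of \<open>W\<close> up to d.\<close>

lemma regular_step:
  assumes T: "T \<subseteq> L" "(v, n0) \<notin> T" and n: "(u, n) \<in> L" "(u, n) \<notin> T" "(u, n) \<noteq> (v, n0)"
    and small: "\<And>w. w \<in> W \<Longrightarrow> card (labels_at T w) < CARD('d)"
    and TX: "(\<forall>w\<in>W. labels_at (insert (u, n) T) w \<subseteq> X w) \<or>
      u \<in> W \<and> card (labels_at (insert (u, n) T) u) \<ge> CARD('d)"
    and g: "g \<in> graded_piece a"
    and deg: "a u \<ge> 1 \<or> u \<notin> vertices ((v, W) # ps) \<and> card (labels_at T u) < CARD('d)"
    and lg: "linform u (\<phi> (u, n)) * g \<in> section_ideal ((v, W) # ps) T \<phi>"
  shows "g \<in> section_ideal ((v, W) # ps) T \<phi>"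
proof -
  let ?l = "linform u (\<phi> (u, n))"
  let ?Tl = "insert (u, n) T"
  have Tl: "?Tl \<subseteq> L" "(v, n0) \<notin> ?Tl" using T n by auto
  have l_Tl: "?l * p \<in> S ?Tl" for p
    by (intro ideal_mult_right[OF is_ideal_section] linform_in_section) simp
  have l_cancel: "p \<in> S T" if "p \<in> graded_piece a" "?l * p \<in> S T" for p
    using regularD[OF reg T(1) n(1,2) that(1) _ that(2)] deg by auto
  have "?l * g \<in> graded_piece (\<lambda>i. (if i = u then 1 else 0) + a i)"
    by (rule graded_piece_mult[OF linform_piece g]) simp
  from section_ConsE[OF lg this] obtain h
    where h: "h \<in> graded_piece (\<lambda>i. (if i = u then 1 else 0) + a i - (if i \<in> insert v W then 1 else 0))"
      and lgfh: "?l * g - f * h \<in> S T" .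
  let ?b = "\<lambda>i. (if i = u then 1 else 0) + a i - (if i \<in> insert v W then 1 else 0)"
  have *: "\<exists>h'' \<in> graded_piece (\<lambda>i. ?b i - (if i = u then 1 else 0)). f * (h - ?l * h'') \<in> S T"
    using TX
  proof
    \<comment> \<open>All variables at \<open>u\<close> vanish once l is added, and \<open>h\<close>
      has positive degree at \<open>u\<close>; so \<open>h\<close> itself is a multiple of l modulo
      the old ideal.\<close>
    assume full: "u \<in> W \<and> card (labels_at ?Tl u) \<ge> CARD('d)"
    then have "a u \<ge> 1" using deg by auto
    then have "?b u \<ge> 1" using full vW by auto
    moreover have "var u j \<in> S ?Tl" for j
      using var_in_section[OF gp Tl(1) finL] full by blast
    ultimately have "h \<in> S ?Tl"
      using graded_piece_in_ideal[OF is_ideal_section _ h] by blast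
    from section_insertE[OF this h] obtain h''
      where "h'' \<in> graded_piece (\<lambda>i. ?b i - (if i = u then 1 else 0))" "h - ?l * h'' \<in> S T" .
    then show ?thesis using ideal_mult[OF is_ideal_section] by blast
  next
    \<comment> \<open>Modulo l the product \<open>f * h\<close> vanishes, so \<open>lead\<close>
      kills \<open>h\<close> there. Exchanging \<open>lead\<close> and l, as in
      \<open>lead_in_of_f_in\<close>, divides \<open>h\<close> by l up to an element killed by
      \<open>lead\<close>.\<close>
    assume TX: "\<forall>w\<in>W. labels_at ?Tl w \<subseteq> X w"
    let ?Tc = "insert (v, n0) T"
    have Tc: "?Tc \<subseteq> L" "(u, n) \<notin> ?Tc" using T n n0 by auto
    have "?l * g - f * h \<in> S ?Tl" using lgfh section_mono[OF subset_insertI] by (rule rev_subsetD)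
    with l_Tl have "?l * g - (?l * g - f * h) \<in> S ?Tl" by (rule ideal_diff[OF is_ideal_section])
    then have "lead * h \<in> S ?Tl" using lead_in_of_f_in[OF Tl _ h] TX by simp
    moreover have "lead * h \<in> graded_piece (\<lambda>i. (if i = v then 1 else 0) + ?b i)"
      by (rule graded_piece_mult[OF linform_piece h]) simp
    ultimately obtain h'
      where h': "h' \<in> graded_piece (\<lambda>i. (if i = v then 1 else 0) + ?b i - (if i = u then 1 else 0))"
        "lead * h - ?l * h' \<in> S T"
      by (rule section_insertE)
    have "lead * h - (lead * h - ?l * h') \<in> S ?Tc"
    proof (rule ideal_diff[OF is_ideal_section])
      show "lead * h \<in> S ?Tc"
        by (intro ideal_mult_right[OF is_ideal_section] linform_in_section) simp
      show "lead * h - ?l * h' \<in> S ?Tc" using h'(2) section_mono[OF subset_insertI] by blast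
    qed
    then have "?l * h' \<in> S ?Tc" by simp
    \<comment> \<open>The additional form \<open>lead\<close> raises the number of forms at
      \<open>v\<close>. For \<open>u = v\<close> this does no harm: \<open>v\<close> is a vertex of
      the new edge, so \<open>deg\<close> gives positive degree there.\<close>
    moreover have "(if u = v then 1 else 0) + ?b u - 1 \<ge> 1 \<or>
        u \<notin> vertices ps \<and> card (labels_at ?Tc u) < CARD('d)"
    proof (cases "u \<in> W")
      case True
      then have "u \<noteq> v" "u \<notin> vertices ps" using vW W_fresh by auto
      then show ?thesis using small[OF True] by (simp add: labels_at_insert)
    next
      case False
      then show ?thesis using deg vW by (auto simp: labels_at_insert)
    qed
    ultimately have "h' \<in> S ?Tc"
      using regularD[OF reg Tc(1) n(1) Tc(2) h'(1)] by simp
    from section_insertE[OF this h'(1)] obtain h''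
      where h'': "h'' \<in> graded_piece (\<lambda>i. (if i = v then 1 else 0) + ?b i - (if i = u then 1 else 0)
          - (if i = v then 1 else 0))" "h' - lead * h'' \<in> S T" .
    have h2: "h'' \<in> graded_piece (\<lambda>i. ?b i - (if i = u then 1 else 0))"
      using h''(1) by (simp add: algebra_simps cong: if_cong)
    have "lead * (h - ?l * h'') = (lead * h - ?l * h') + ?l * (h' - lead * h'')"
      by (simp add: algebra_simps)
    then have ld: "lead * (h - ?l * h'') \<in> S T"
      using h'(2) h''(2) by (simp add: ideal_add ideal_mult is_ideal_section)
    have "?l * h'' \<in> graded_piece ?b"
      by (rule graded_piece_mult[OF linform_piece h2]) (simp add: fun_eq_iff)
    then have "h - ?l * h'' \<in> graded_piece ?b" by (rule graded_piece_diff[OF h])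
    then show ?thesis using f_in_of_lead_in[OF T _ ld] h2 by blast
  qed
  then obtain h'' where h'': "h'' \<in> graded_piece (\<lambda>i. ?b i - (if i = u then 1 else 0))"
    "f * (h - ?l * h'') \<in> S T" by blast
  have "f * h'' \<in> graded_piece a" by (rule graded_piece_mult[OF lss_poly_piece h''(1)]) (auto simp: fun_eq_iff)
  then have "g - f * h'' \<in> graded_piece a" by (rule graded_piece_diff[OF g])
  moreover have "?l * (g - f * h'') = (?l * g - f * h) + f * (h - ?l * h'')"
    by (simp add: algebra_simps)
  then have "?l * (g - f * h'') \<in> S T"
    using lgfh h''(2) by (simp add: ideal_add is_ideal_section)
  ultimately have "g - f * h'' \<in> S T" by (rule l_cancel)
  then show ?thesis by (rule section_ConsI)
qed

end

section \<open>Regularity by induction on the edges\<close>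

lemma edge_section_exists:
  fixes \<phi> :: "'n::finite \<times> nat \<Rightarrow> 'k::field ^ 'd::finite"
  assumes forest: "rooted_forest ((v, W) # ps)" and finL: "finite L"
    and big: "\<And>u. card (labels_at L u) \<ge> CARD('d)"
    and good: "good_position ((v, W) # ps) L \<phi>"
    and reg: "\<And>L' (\<phi>' :: 'n \<times> nat \<Rightarrow> 'k ^ 'd). finite L' \<Longrightarrow> (\<And>u. card (labels_at L' u) \<ge> CARD('d)) \<Longrightarrow>
      good_position ps L' \<phi>' \<Longrightarrow> filter_regular ps L' \<phi>'"
    and X: "\<forall>w\<in>W. X w \<subseteq> labels_at L w \<and> card (X w) = CARD('d) - 1"
  shows "\<exists>n0 \<phi>' \<mu>. (v, n0) \<notin> L \<and> (\<forall>x\<in>L. \<phi>' x = \<phi> x) \<and>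
    edge_section ps v W n0 (insert (v, n0) L) \<phi>' X \<mu> \<and> good_position ps (insert (v, n0) L) \<phi>' \<and>
    (\<forall>u. card (labels_at (insert (v, n0) L) u) \<ge> CARD('d))"
proof -
  obtain n0 \<mu> where *: "(v, n0) \<notin> L \<and>
      (\<forall>w\<in>W. \<mu> w \<noteq> 0 \<and> (\<forall>x\<in>X w. (\<Sum>j\<in>UNIV. \<phi> (w, x) $ j * \<mu> w $ j) = 0)) \<and>
      good_position ps (insert (v, n0) L) (\<phi>((v, n0) := \<chi> j. \<Prod>w\<in>W. \<mu> w $ j))"
    using good[unfolded good_position.simps, THEN spec, THEN mp, OF X] by (elim exE)
  then have n0: "(v, n0) \<notin> L"
    and \<mu>: "\<And>w. w \<in> W \<Longrightarrow> \<mu> w \<noteq> 0"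
      "\<And>w x. w \<in> W \<Longrightarrow> x \<in> X w \<Longrightarrow> (\<Sum>j\<in>UNIV. \<phi> (w, x) $ j * \<mu> w $ j) = 0"
    and good': "good_position ps (insert (v, n0) L) (\<phi>((v, n0) := \<chi> j. \<Prod>w\<in>W. \<mu> w $ j))"
    by blast+
  let ?L = "insert (v, n0) L" and ?\<phi> = "\<phi>((v, n0) := \<chi> j. \<Prod>w\<in>W. \<mu> w $ j)"
  have sub: "labels_at L w \<subseteq> labels_at ?L w" for w by (rule labels_at_mono) auto
  have big': "card (labels_at ?L w) \<ge> CARD('d)" for w
    by (rule le_trans[OF big card_mono[OF finite_labels_at sub]]) (simp add: finL)
  have "edge_section ps v W n0 ?L ?\<phi> X \<mu>"
  proof
    show "general_position ?L ?\<phi>"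
      by (rule good_position_general[OF _ big' good']) (simp add: finL)
    show "filter_regular ps ?L ?\<phi>"
      by (rule reg[OF _ big' good']) (simp add: finL)
    show "X w \<subseteq> labels_at ?L w" if "w \<in> W" for w using X that sub by blast
    show "(\<Sum>j\<in>UNIV. ?\<phi> (w, x) $ j * \<mu> w $ j) = 0" if "w \<in> W" "x \<in> X w" for w x
      using \<mu>(2)[OF that] forest that by auto
  qed (use forest finL big' X \<mu> in auto)
  moreover have "\<forall>x\<in>L. ?\<phi> x = \<phi> x" using n0 by auto
  ultimately show ?thesis using n0 good' big' by blast
qed

lemma labels_choice_exists:
  assumes L: "finite L" "\<And>u. card (labels_at L u) \<ge> k + 1"
    and T: "T \<subseteq> L" "\<forall>w\<in>W. card (labels_at T w) \<le> k"
  shows "\<exists>X. \<forall>w\<in>W. labels_at T w \<subseteq> X w \<and> X w \<subseteq> labels_at L w \<and> card (X w) = k"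
proof -
  have "\<exists>X. labels_at T w \<subseteq> X \<and> X \<subseteq> labels_at L w \<and> card X = k" if "w \<in> W" for w
    using L(2)[of w] T(2)[rule_format, OF that]
    by (intro exists_subset_labels labels_at_mono finite_labels_at L T) auto
  then show ?thesis by metis
qed

lemma labels_choice_exists':
  assumes "finite L" "\<And>u. card (labels_at L u) \<ge> k + 1"
  shows "\<exists>X. \<forall>w\<in>W. X w \<subseteq> labels_at L w \<and> card (X w) = k"
  using labels_choice_exists[OF assms, of "{}" W] by (auto simp: labels_at_def)

text \<open>Once a vertex of \<open>W\<close> carries d forms, the new polynomial already lies in
  the section for \<open>ps\<close>. Otherwise \<open>X\<close> is chosen around the forms of
  \<open>T\<close> and, if it still fits, the form to be cancelled. The new label depends on
  \<open>X\<close>, so \<open>\<phi>'\<close> is chosen only after \<open>T\<close> and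
  \<open>(u, n)\<close>; it agrees with \<open>\<phi>\<close> on \<open>L\<close>, so the sections
  in question are unaffected.\<close>

theorem good_position_regular:
  fixes \<phi> :: "'n::finite \<times> nat \<Rightarrow> 'k::field ^ 'd::finite"
  assumes "rooted_forest ps" "finite L" "\<And>u. card (labels_at L u) \<ge> CARD('d)" "good_position ps L \<phi>"
  shows "filter_regular ps L \<phi>"
  using assms
proof (induction ps arbitrary: L \<phi>)
  case Nil
  then show ?case by (intro filter_regular_Nil) auto
next
  case (Cons p ps)
  obtain v W where p: "p = (v, W)" by force
  note finL = Cons.prems(2) and big = Cons.prems(3)
  have big': "card (labels_at L u) \<ge> CARD('d) - 1 + 1" for u using big[of u] by simp
  have forest: "rooted_forest ((v, W) # ps)" "rooted_forest ps" using Cons.prems(1) p by auto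
  have exists: "\<exists>n0 \<phi>' \<mu>. (v, n0) \<notin> L \<and> (\<forall>x\<in>L. \<phi>' x = \<phi> x) \<and>
      edge_section ps v W n0 (insert (v, n0) L) \<phi>' X \<mu>"
    if "\<forall>w\<in>W. X w \<subseteq> labels_at L w \<and> card (X w) = CARD('d) - 1" for X
    using edge_section_exists[OF forest(1) finL big Cons.prems(4)[unfolded p] Cons.IH[OF forest(2)] that]
    by blast
  show ?case unfolding p filter_regular_def
  proof (intro allI ballI impI, elim conjE)
    fix T u n a g
    assume T: "T \<subseteq> L" and n: "(u, n) \<in> L - T" and g: "g \<in> graded_piece a"
      and deg: "1 \<le> a u \<or> u \<notin> vertices ((v, W) # ps) \<and> card (labels_at T u) < CARD('d)"
      and lg: "linform u (\<phi> (u, n)) * g \<in> section_ideal ((v, W) # ps) T \<phi>"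
    show "g \<in> section_ideal ((v, W) # ps) T \<phi>"
    proof (cases "\<exists>w\<in>W. card (labels_at T w) \<ge> CARD('d)")
      case True
      then obtain w where w: "w \<in> W" "card (labels_at T w) \<ge> CARD('d)" by blast
      obtain X where "\<forall>w\<in>W. X w \<subseteq> labels_at L w \<and> card (X w) = CARD('d) - 1"
        using labels_choice_exists'[OF finL big'] by blast
      then obtain n0 \<phi>' \<mu> where n0: "(v, n0) \<notin> L" and \<phi>': "\<forall>x\<in>L. \<phi>' x = \<phi> x"
        and es: "edge_section ps v W n0 (insert (v, n0) L) \<phi>' X \<mu>"
        using exists by blast
      interpret edge_section ps v W n0 "insert (v, n0) L" \<phi>' X \<mu> by (rule es)
      have eq: "section_ideal qs T \<phi> = section_ideal qs T \<phi>'" for qs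
        by (rule section_cong) (use \<phi>' T in auto)
      have "var w j \<in> S T" for j
        by (rule var_in_section[OF gp _ _ w(2)]) (use T finL in auto)
      then have "lss_poly (insert v W) \<in> S T"
        using lss_poly_in_ideal[OF is_ideal_section, of w] w by blast
      then have *: "section_ideal ((v, W) # ps) T \<phi>' = S T" by (rule section_Cons_absorb)
      have lg': "linform u (\<phi>' (u, n)) * g \<in> S T" using lg \<phi>' n unfolding eq * by auto
      have deg': "1 \<le> a u \<or> u \<notin> vertices ps \<and> card (labels_at T u) < CARD('d)" using deg by auto
      have "T \<subseteq> insert (v, n0) L" "(u, n) \<in> insert (v, n0) L" "(u, n) \<notin> T"
        using T n by auto
      then have "g \<in> S T" by (rule regularD[OF reg _ _ _ g deg' lg'])
      then show ?thesis unfolding eq * .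
    next
      case False
      then have small: "card (labels_at T w) < CARD('d)" if "w \<in> W" for w using that by (meson not_le)
      let ?Tl = "insert (u, n) T"
      have "\<exists>X. (\<forall>w\<in>W. X w \<subseteq> labels_at L w \<and> card (X w) = CARD('d) - 1) \<and>
        ((\<forall>w\<in>W. labels_at ?Tl w \<subseteq> X w) \<or> u \<in> W \<and> card (labels_at ?Tl u) \<ge> CARD('d))"
      proof (cases "\<exists>w\<in>W. card (labels_at ?Tl w) \<ge> CARD('d)")
        case True
        then have "u \<in> W \<and> card (labels_at ?Tl u) \<ge> CARD('d)"
          using small by (auto simp: labels_at_insert split: if_splits dest: leD)
        moreover obtain X where "\<forall>w\<in>W. X w \<subseteq> labels_at L w \<and> card (X w) = CARD('d) - 1"
          using labels_choice_exists'[OF finL big'] by blast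
        ultimately show ?thesis by blast
      next
        case False
        have small': "\<forall>w\<in>W. card (labels_at ?Tl w) \<le> CARD('d) - 1"
        proof
          fix w assume "w \<in> W"
          then have "card (labels_at ?Tl w) < CARD('d)" using False by (meson not_le)
          then show "card (labels_at ?Tl w) \<le> CARD('d) - 1" by linarith
        qed
        have "?Tl \<subseteq> L" using T n by auto
        from labels_choice_exists[OF finL big' this small'] obtain X
          where "\<forall>w\<in>W. labels_at ?Tl w \<subseteq> X w \<and> X w \<subseteq> labels_at L w \<and> card (X w) = CARD('d) - 1"
          by (elim exE)
        then have "(\<forall>w\<in>W. X w \<subseteq> labels_at L w \<and> card (X w) = CARD('d) - 1) \<and>
            (\<forall>w\<in>W. labels_at ?Tl w \<subseteq> X w)" by simp
        then show ?thesis by (intro exI[of _ X]) simp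
      qed
      then obtain X where X: "\<forall>w\<in>W. X w \<subseteq> labels_at L w \<and> card (X w) = CARD('d) - 1"
        and TX: "(\<forall>w\<in>W. labels_at ?Tl w \<subseteq> X w) \<or> u \<in> W \<and> card (labels_at ?Tl u) \<ge> CARD('d)"
        by blast
      obtain n0 \<phi>' \<mu> where n0: "(v, n0) \<notin> L" and \<phi>': "\<forall>x\<in>L. \<phi>' x = \<phi> x"
        and es: "edge_section ps v W n0 (insert (v, n0) L) \<phi>' X \<mu>"
        using exists[OF X] by blast
      interpret edge_section ps v W n0 "insert (v, n0) L" \<phi>' X \<mu> by (rule es)
      have eq: "section_ideal qs T \<phi> = section_ideal qs T \<phi>'" for qs
        by (rule section_cong) (use \<phi>' T in auto)
      have lg': "linform u (\<phi>' (u, n)) * g \<in> section_ideal ((v, W) # ps) T \<phi>'"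
        using lg n \<phi>' unfolding eq by simp
      have sub: "T \<subseteq> insert (v, n0) L" "(v, n0) \<notin> T" "(u, n) \<in> insert (v, n0) L"
          "(u, n) \<notin> T" "(u, n) \<noteq> (v, n0)"
        using T n \<open>(v, n0) \<notin> L\<close> by auto
      show ?thesis unfolding eq
        by (rule regular_step[OF sub _ TX g deg lg']) (rule small)
    qed
  qed
qed

subsection \<open>The Borel-fixed family of supports\<close>

text \<open>J is to be radical, so its monomials are recorded by their supports alone:
  \<open>insert (v, j) P\<close> stands for multiplication by x_vj, and \<open>Min UNIV\<close> is
  the index 1.\<close>

fun supports :: "('n \<times> 'n set) list \<Rightarrow> ('n \<times> 'd::{finite,linorder}) set set" where
  "supports [] = {}"
| "supports ((v, W) # ps) = supports ps \<union> {P. (\<forall>w\<in>W. (w, Min UNIV) \<in> P) \<and>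
    (\<exists>t. (v, t) \<in> P \<and> (\<forall>j<t. insert (v, j) P \<in> supports ps))}"

text \<open>One property yields both upward closure (with j' = j) and Borel-fixedness. In the
  recursion the index at the root may move down from \<open>t\<close> to \<open>t'\<close>, which
  leaves fewer smaller indices to be checked.\<close>

lemma supports_exchange:
  assumes "P \<in> supports ps" "\<And>i j. (i, j) \<in> P \<Longrightarrow> \<exists>j'\<le>j. (i, j') \<in> P'"
  shows "P' \<in> supports ps"
  using assms
proof (induction ps arbitrary: P P')
  case (Cons p ps)
  obtain v W where p: "p = (v, W)" by force
  show ?case
  proof (cases "P \<in> supports ps")
    case True
    then show ?thesis using Cons.IH[OF True Cons.prems(2)] p by auto
  next
    case False
    then obtain t where W: "\<forall>w\<in>W. (w, Min UNIV) \<in> P" and t: "(v, t) \<in> P"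
      "\<And>j. j < t \<Longrightarrow> insert (v, j) P \<in> supports ps"
      using Cons.prems(1) p by auto
    have "(w, Min UNIV) \<in> P'" if "w \<in> W" for w
    proof -
      obtain j where j: "j \<le> Min UNIV" "(w, j) \<in> P'" using Cons.prems(2) W \<open>w \<in> W\<close> by blast
      have "Min UNIV \<le> j" by (rule Min_le) auto
      with j(1) have "j = Min UNIV" by (rule antisym)
      then show ?thesis using j(2) by simp
    qed
    moreover obtain t' where t': "t' \<le> t" "(v, t') \<in> P'" using Cons.prems(2) t by blast
    moreover have "insert (v, j) P' \<in> supports ps" if "j < t'" for j
    proof (rule Cons.IH[OF t(2)])
      show "j < t" using that t' by simp
      show "\<exists>j''\<le>j'. (i, j'') \<in> insert (v, j) P'" if "(i, j') \<in> insert (v, j) P" for i j'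
        using that Cons.prems(2) by blast
    qed
    ultimately show ?thesis using p by auto
  qed
qed simp

lemma supports_mono: "P \<in> supports ps \<Longrightarrow> P \<subseteq> P' \<Longrightarrow> P' \<in> supports ps"
  by (rule supports_exchange) auto

text \<open>Vertices on no edge of \<open>ps\<close> have no influence on membership; this serves
  for the vertices \<open>W\<close> of a new edge.\<close>

lemma supports_restrict: "P \<in> supports ps \<Longrightarrow> P \<inter> vertices ps \<times> UNIV \<in> supports ps"
proof (induction ps arbitrary: P)
  case (Cons p ps)
  obtain v W where p: "p = (v, W)" by force
  let ?R = "P \<inter> vertices (p # ps) \<times> UNIV"
  show ?case
  proof (cases "P \<in> supports ps")
    case True
    have "?R \<in> supports ps" by (rule supports_mono[OF Cons.IH[OF True]]) (use p in auto)
    then show ?thesis using p by simp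
  next
    case False
    then obtain t where W: "\<forall>w\<in>W. (w, Min UNIV) \<in> P" and t: "(v, t) \<in> P"
      "\<And>j. j < t \<Longrightarrow> insert (v, j) P \<in> supports ps"
      using Cons.prems(1) p by auto
    have "insert (v, j) ?R \<in> supports ps" if "j < t" for j
      by (rule supports_mono[OF Cons.IH[OF t(2)[OF that]]]) (use p in auto)
    then show ?thesis using W t p by auto
  qed
qed simp

section \<open>Positions of the variables and truncation\<close>

definition var_pos :: "'d::{finite,linorder} \<Rightarrow> nat" where
  "var_pos j = card {..<j}"

lemma var_pos_le_iff: "var_pos i \<le> var_pos j \<longleftrightarrow> i \<le> j"
proof -
  have "var_pos i \<le> var_pos j" if "i \<le> j" for i j :: 'a
    unfolding var_pos_def by (rule card_mono) (use that in auto)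
  moreover have "var_pos i < var_pos j" if "i < j" for i j :: 'a
    unfolding var_pos_def by (rule psubset_card_mono) (use that in auto)
  ultimately show ?thesis by (meson leD not_le)
qed

lemma var_pos_eq_iff: "var_pos i = var_pos j \<longleftrightarrow> i = j"
  using var_pos_le_iff[of i j] var_pos_le_iff[of j i] by (auto intro: antisym)

lemma var_pos_less: "var_pos (j :: 'd::{finite,linorder}) < CARD('d)"
  unfolding var_pos_def by (rule psubset_card_mono) auto

lemma var_pos_Min: "var_pos (Min UNIV :: 'd::{finite,linorder}) = 0"
  by (auto simp: var_pos_def not_less)

lemma var_pos_surj:
  assumes "r < CARD('d::{finite,linorder})"
  obtains q :: "'d::{finite,linorder}" where "var_pos q = r"
proof -
  have "inj (var_pos :: 'd \<Rightarrow> nat)"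
    by (rule injI) (simp add: var_pos_eq_iff)
  then have "card (range (var_pos :: 'd \<Rightarrow> nat)) = CARD('d)" by (simp add: card_image)
  moreover have "range (var_pos :: 'd \<Rightarrow> nat) \<subseteq> {..<CARD('d)}" using var_pos_less by auto
  ultimately have "range (var_pos :: 'd \<Rightarrow> nat) = {..<CARD('d)}"
    by (intro card_subset_eq) auto
  then show thesis using assms that by (metis imageE lessThan_iff)
qed

text \<open>The supports of the monomials in the sum of the monomial ideal of \<open>supports ps\<close> and the ideal
  of the last \<open>k u\<close> variables of each degree \<open>e\<^sub>u\<close>.\<close>

definition truncated_supports ::
    "('n \<times> 'n set) list \<Rightarrow> ('n \<Rightarrow> nat) \<Rightarrow> ('n \<times> 'd::{finite,linorder}) set set" where
  "truncated_supports ps k =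
    {P. P \<in> supports ps \<or> (\<exists>(u, j)\<in>P. CARD('d) \<le> var_pos j + k u)}"

text \<open>The \<open>itself\<close> argument fixes the type \<open>'d\<close>, which occurs in no
  other argument.\<close>

definition monomial_count :: "('n::finite \<times> 'n set) list \<Rightarrow> ('n \<Rightarrow> nat) \<Rightarrow> 'd::{finite,linorder} itself \<Rightarrow>
    ('n \<Rightarrow> int) \<Rightarrow> nat" where
  "monomial_count ps k _ a =
    card {m :: ('n, 'd) mon. mdeg m = a \<and> keys m \<in> truncated_supports ps k}"

section \<open>Recursions for the numbers of monomials\<close>

lemma keys_add_nat: "keys (m + m') = keys m \<union> keys m'"
  for m m' :: "'a \<Rightarrow>\<^sub>0 nat"
  by (auto simp: in_keys_iff lookup_add)

lemma finite_mdeg_subset: "finite {m :: ('n::finite, 'd::finite) mon. mdeg m = a \<and> Q m}"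
  by (rule finite_subset[OF _ finite_mdeg_eq[of a]]) auto

lemma card_mdeg_split:
  assumes "\<And>m. Q m \<Longrightarrow> R m"
  shows "card {m :: ('n::finite, 'd::finite) mon. mdeg m = a \<and> R m} =
    card {m :: ('n, 'd) mon. mdeg m = a \<and> Q m} + card {m :: ('n, 'd) mon. mdeg m = a \<and> R m \<and> \<not> Q m}"
proof -
  have "{m :: ('n, 'd) mon. mdeg m = a \<and> R m} =
      {m. mdeg m = a \<and> Q m} \<union> {m. mdeg m = a \<and> R m \<and> \<not> Q m}"
    using assms by auto
  then show ?thesis
    by (simp add: card_Un_disjoint finite_mdeg_subset disjoint_iff)
qed

lemma mdeg_single_Suc_0: "mdeg (single (i, j) (Suc 0)) = (\<lambda>i'. if i' = i then 1 else 0)"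
  by (simp add: mdeg_single fun_eq_iff)

lemma monomial_minus_plus:
  fixes m :: "('n, 'd) mon"
  assumes "(i, j) \<in> keys m"
  shows "m = (m - single (i, j) 1) + single (i, j) 1"
proof (rule poly_mapping_eqI)
  fix z
  have "lookup m (i, j) \<ge> 1" using assms by (simp add: in_keys_iff Suc_le_eq)
  then show "lookup m z =
      lookup ((m - single (i, j) 1) + single (i, j) 1) z"
    by (auto simp: lookup_add lookup_minus lookup_single when_def)
qed

lemma truncated_supports_mono_k:
  "P \<in> truncated_supports ps k \<Longrightarrow> P \<in> truncated_supports ps (k(u := Suc (k u)))"
proof -
  assume "P \<in> truncated_supports ps k"
  then consider "P \<in> supports ps" | u' j where "(u', j) \<in> P" "CARD('b) \<le> var_pos j + k u'"
    by (auto simp: truncated_supports_def)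
  then show ?thesis
  proof cases
    case 2
    then have "CARD('b) \<le> var_pos j + (k(u := Suc (k u))) u'" by (cases "u' = u") auto
    then show ?thesis using 2(1) unfolding truncated_supports_def by blast
  qed (simp add: truncated_supports_def)
qed

text \<open>\<open>q\<close> is the last variable at \<open>u\<close> that is not yet truncated;
  positions start at 0, hence d - 1 - k u.\<close>

lemma new_truncated_support:
  fixes P :: "('n \<times> 'd::{finite,linorder}) set"
  assumes "P \<in> truncated_supports ps (k(u := Suc (k u)))" "P \<notin> truncated_supports ps k"
    and q: "var_pos q = CARD('d) - 1 - k u"
  shows "(u, q) \<in> P"
proof -
  obtain u' j where j: "(u', j) \<in> P" "CARD('d) \<le> var_pos j + (k(u := Suc (k u))) u'" "var_pos j + k u' < CARD('d)"
    using assms(1,2) unfolding truncated_supports_def by (auto simp: not_le)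
  then have u': "u' = u" by (metis fun_upd_other leD)
  then have "var_pos j = var_pos q" using j q by simp
  then show ?thesis using j(1) u' by (simp add: var_pos_eq_iff)
qed

lemma monomial_count_full:
  fixes k :: "'n::finite \<Rightarrow> nat" and a :: "'n \<Rightarrow> int"
  assumes "k u \<ge> CARD('d::{finite,linorder})"
  shows "monomial_count ps (k(u := Suc (k u))) TYPE('d::{finite,linorder}) a = monomial_count ps k TYPE('d::{finite,linorder}) a"
proof -
  have "truncated_supports ps (k(u := Suc (k u))) =
      (truncated_supports ps k :: ('n \<times> 'd) set set)"
    using assms by (fastforce simp: truncated_supports_def split: if_splits)
  then show ?thesis by (simp add: monomial_count_def)
qed

text \<open>Mirrors \<open>hilbert_series_insert\<close> for a form that can be cancelled: the newly
  truncated monomials are exactly x_uq times the untruncated ones.\<close>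

lemma monomial_count_Nil_step:
  fixes k :: "'n::finite \<Rightarrow> nat" and a :: "'n \<Rightarrow> int"
  assumes k: "k u < CARD('d::{finite,linorder})"
  defines "b \<equiv> \<lambda>i. a i - (if i = u then 1 else 0)"
  shows "monomial_count [] (k(u := Suc (k u))) TYPE('d::{finite,linorder}) a + monomial_count [] k TYPE('d::{finite,linorder}) b =
    monomial_count [] k TYPE('d::{finite,linorder}) a + card {m :: ('n, 'd::{finite,linorder}) mon. mdeg m = b}"
proof -
  let ?k' = "k(u := Suc (k u))"
  let ?K = "truncated_supports [] k :: ('n \<times> 'd) set set"
  let ?K' = "truncated_supports [] ?k' :: ('n \<times> 'd) set set"
  obtain q :: 'd where q: "var_pos q = CARD('d) - 1 - k u" using var_pos_surj[where 'd = 'd and r = "CARD('d) - 1 - k u"] by auto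
  let ?x = "single (u, q) 1 :: ('n, 'd) mon"
  let ?A = "{m :: ('n, 'd) mon. mdeg m = a \<and> keys m \<in> ?K' \<and> keys m \<notin> ?K}"
  let ?B = "{m :: ('n, 'd) mon. mdeg m = b \<and> True \<and> keys m \<notin> ?K}"
  have new: "(u, q) \<in> P" if "P \<in> ?K'" "P \<notin> ?K" for P
    by (rule new_truncated_support[OF that q])
  have "?A = (\<lambda>m. m + ?x) ` ?B"
  proof (intro antisym subsetI)
    fix m assume m: "m \<in> ?A"
    then have uq: "(u, q) \<in> keys m" using new by blast
    let ?m = "m - ?x"
    have eq: "m = ?m + ?x" by (rule monomial_minus_plus[OF uq])
    then have "keys m = keys ?m \<union> {(u, q)}"
      by (metis keys_add_nat keys_single one_neq_zero)
    then have "keys ?m \<notin> ?K" using m by (fastforce simp: truncated_supports_def)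
    moreover have "mdeg m = (\<lambda>i. mdeg ?m i + mdeg ?x i)" by (subst eq) (rule mdeg_add)
    then have "mdeg ?m = b" using m by (simp add: b_def mdeg_single_Suc_0 fun_eq_iff eq_diff_eq)
    ultimately show "m \<in> (\<lambda>m. m + ?x) ` ?B" using eq by blast
  next
    fix m assume "m \<in> (\<lambda>m. m + ?x) ` ?B"
    then obtain m' where m': "mdeg m' = b" "keys m' \<notin> ?K" "m = m' + ?x" by blast
    have "mdeg m = a" using m' by (auto simp: mdeg_add mdeg_single_Suc_0 b_def)
    moreover have "keys m = insert (u, q) (keys m')"
      using m' by (simp add: keys_add_nat)
    ultimately show "m \<in> ?A" using m'(2) q k by (auto simp: truncated_supports_def)
  qed
  then have "card ?A = card ?B" by (simp add: card_image)
  then show ?thesis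
    using card_mdeg_split[of "\<lambda>m. keys m \<in> ?K" "\<lambda>m. keys m \<in> ?K'" a,
        OF truncated_supports_mono_k]
      card_mdeg_split[of "\<lambda>m. keys m \<in> ?K" "\<lambda>_. True" b]
    by (simp add: monomial_count_def)
qed

text \<open>Every support contributed by the edge contains a variable at each of its vertices, and
  all variables at \<open>u\<close> are truncated.\<close>

lemma monomial_count_Cons_full:
  fixes k :: "'n::finite \<Rightarrow> nat" and a :: "'n \<Rightarrow> int"
  assumes "u \<in> insert v W" "k u \<ge> CARD('d::{finite,linorder})"
  shows "monomial_count ((v, W) # ps) k TYPE('d::{finite,linorder}) a = monomial_count ps k TYPE('d::{finite,linorder}) a"
proof -
  have "P \<in> truncated_supports ps k"
    if "\<forall>w\<in>W. (w, Min UNIV) \<in> P" "(v, t) \<in> P" for P :: "('n \<times> 'd) set" and t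
    using assms that by (fastforce simp: truncated_supports_def intro: trans_le_add2)
  then have "truncated_supports ((v, W) # ps) k = (truncated_supports ps k :: ('n \<times> 'd) set set)"
    by (auto simp: truncated_supports_def)
  then show ?thesis by (simp add: monomial_count_def)
qed

lemma mdeg_sum: "mdeg (sum f A) = (\<lambda>i. \<Sum>x\<in>A. mdeg (f x) i)"
  by (induction A rule: infinite_finite_induct) (auto simp: mdeg_add)

text \<open>The recursion of \<open>hilbert_series_edge\<close> for monomials, with the next
  variable x_vq to be truncated in place of \<open>lead\<close>. Both sets of new monomials are
  parametrized by the set \<open>?Z\<close> of those m for which m x_vq is outside the truncated
  ideal: the truncation yields m x_vq, and the edge yields m x_vt times the first variables at
  \<open>W\<close>, where t is least with m x_vt outside J.\<close>

lemma monomial_count_Cons_step: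
  fixes k :: "'n::finite \<Rightarrow> nat" and a :: "'n \<Rightarrow> int"
  assumes forest: "rooted_forest ((v, W) # ps)"
    and k: "\<And>u. u \<in> insert v W \<Longrightarrow> k u < CARD('d::{finite,linorder})"
  defines "b \<equiv> \<lambda>i. a i - (if i \<in> W then 1 else 0)"
  shows "monomial_count ((v, W) # ps) k TYPE('d::{finite,linorder}) a + monomial_count ps k TYPE('d::{finite,linorder}) b =
    monomial_count ps k TYPE('d::{finite,linorder}) a + monomial_count ps (k(v := Suc (k v))) TYPE('d::{finite,linorder}) b"
proof -
  let ?k' = "k(v := Suc (k v))"
  define F where "F = (supports ps :: ('n \<times> 'd) set set)"
  define inr where "inr P \<longleftrightarrow> (\<forall>(u, j)\<in>P. var_pos j + k u < CARD('d))" for P :: "('n \<times> 'd) set"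
  let ?K = "truncated_supports ps k :: ('n \<times> 'd) set set"
  let ?K' = "truncated_supports ps ?k' :: ('n \<times> 'd) set set"
  let ?K1 = "truncated_supports ((v, W) # ps) k :: ('n \<times> 'd) set set"
  have K: "P \<notin> ?K \<longleftrightarrow> P \<notin> F \<and> inr P" for P
    by (auto simp: truncated_supports_def F_def inr_def not_le)
  have vW: "v \<notin> W" and Wps: "W \<inter> vertices ps = {}" using forest by auto
  obtain q :: 'd where q: "var_pos q = CARD('d) - 1 - k v" using var_pos_surj[where 'd = 'd and r = "CARD('d) - 1 - k v"] by auto
  have le_q: "j \<le> q \<longleftrightarrow> var_pos j + k v < CARD('d)" for j :: 'd
    using q k[of v] var_pos_le_iff[of j q] by auto
  let ?x = "\<lambda>j. single (v, j) 1 :: ('n, 'd) mon"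
  define D where "D = (\<Sum>w\<in>W. single (w, Min UNIV) 1 :: ('n, 'd) mon)"
  have mdeg_D: "mdeg D = (\<lambda>i. if i \<in> W then 1 else 0)"
    by (simp add: D_def mdeg_sum mdeg_single_Suc_0 sum.delta)
  have lookup_D: "lookup D z = (if fst z \<in> W \<and> snd z = Min UNIV then 1 else 0)" for z
    by (cases z) (auto simp: D_def lookup_sum lookup_single when_def if_distrib sum.delta cong: if_cong)
  have keys_D: "keys D = W \<times> {Min UNIV}"
    by (auto simp: in_keys_iff lookup_D split: if_splits)
  let ?A = "{m :: ('n, 'd) mon. mdeg m = a \<and> keys m \<in> ?K1 \<and> keys m \<notin> ?K}"
  let ?B = "{m :: ('n, 'd) mon. mdeg m = b \<and> keys m \<in> ?K' \<and> keys m \<notin> ?K}"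
  let ?Z = "{m :: ('n, 'd) mon. mdeg m = (\<lambda>i. b i - (if i = v then 1 else 0)) \<and>
    insert (v, q) (keys m) \<notin> ?K}"
  have new: "(v, q) \<in> P" if "P \<in> ?K'" "P \<notin> ?K" for P
    by (rule new_truncated_support[OF that q])
  have "?B = (\<lambda>m. m + ?x q) ` ?Z"
  proof (intro antisym subsetI)
    fix m assume m: "m \<in> ?B"
    then have vq: "(v, q) \<in> keys m" using new by blast
    let ?m = "m - ?x q"
    have eq: "m = ?m + ?x q" by (rule monomial_minus_plus[OF vq])
    then have "keys m = insert (v, q) (keys ?m)"
      by (metis keys_add_nat keys_single one_neq_zero Un_insert_right sup_bot_right)
    moreover have "mdeg m = (\<lambda>i. mdeg ?m i + mdeg (?x q) i)" by (subst eq) (rule mdeg_add)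
    then have "mdeg ?m = (\<lambda>i. b i - (if i = v then 1 else 0))"
      using m by (simp add: mdeg_single_Suc_0 fun_eq_iff eq_diff_eq)
    ultimately show "m \<in> (\<lambda>m. m + ?x q) ` ?Z" using eq m by auto
  next
    fix m assume "m \<in> (\<lambda>m. m + ?x q) ` ?Z"
    then obtain m' where m': "m' \<in> ?Z" "m = m' + ?x q" by blast
    have "mdeg m = b" using m' by (auto simp: mdeg_add mdeg_single_Suc_0)
    moreover have "keys m = insert (v, q) (keys m')"
      using m' by (simp add: keys_add_nat)
    ultimately show "m \<in> ?B" using m' q by (auto simp: truncated_supports_def)
  qed
  then have card_B: "card ?B = card ?Z" by (simp add: card_image)
  define \<tau> where "\<tau> m = Min {t. insert (v, t) (keys m) \<notin> F}" for m :: "('n, 'd) mon"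
  define g where "g m = m + ?x (\<tau> m) + D" for m
  have keys_g: "keys (g m) = insert (v, \<tau> m) (keys m) \<union> W \<times> {Min UNIV}" for m
    by (simp add: g_def keys_add_nat keys_D)
  have \<tau>_in: "insert (v, \<tau> m) (keys m) \<notin> F" "\<tau> m \<le> q" if "m \<in> ?Z" for m
  proof -
    have q_in: "q \<in> {t. insert (v, t) (keys m) \<notin> F}" using that K by simp
    then show "\<tau> m \<le> q" unfolding \<tau>_def by (intro Min_le) auto
    have "\<tau> m \<in> {t. insert (v, t) (keys m) \<notin> F}"
      unfolding \<tau>_def by (rule Min_in) (use q_in in auto)
    then show "insert (v, \<tau> m) (keys m) \<notin> F" by simp
  qed
  have \<tau>_min: "insert (v, j) (keys m) \<in> F" if "j < \<tau> m" for m j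
  proof (rule ccontr)
    assume "\<not> ?thesis"
    then have "\<tau> m \<le> j" unfolding \<tau>_def by (intro Min_le) auto
    then show False using that by simp
  qed
  have F_mono: "P' \<in> F" if "P \<in> F" "P \<subseteq> P'" for P P'
    using that supports_mono by (auto simp: F_def)
  \<comment> \<open>An index s below \<open>\<tau> m\<close> that occurs in m would put m itself,
    and hence m x_vq, into J. So \<open>\<tau> m\<close> is the least index at \<open>v\<close> in
    \<open>g m\<close>, and \<open>g m\<close> determines m.\<close>
  have \<tau>_le: "\<tau> m \<le> s" if "m \<in> ?Z" "(v, s) \<in> keys m" for m s
  proof (rule ccontr)
    assume "\<not> ?thesis"
    then have "insert (v, s) (keys m) \<in> F" by (intro \<tau>_min) simp
    then have "insert (v, q) (keys m) \<in> F" using that by (auto intro: F_mono simp: insert_absorb)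
    then show False using that K by simp
  qed
  have inj: "inj_on g ?Z"
  proof (rule inj_onI)
    fix m m' assume m: "m \<in> ?Z" "m' \<in> ?Z" "g m = g m'"
    have le: "\<tau> m1 \<le> \<tau> m2" if "m1 \<in> ?Z" "m2 \<in> ?Z" "g m1 = g m2" for m1 m2
    proof -
      have "(v, \<tau> m2) \<in> keys (g m1)" unfolding that(3) keys_g by simp
      then show ?thesis using \<tau>_le[OF that(1)] vW unfolding keys_g by auto
    qed
    have "\<tau> m = \<tau> m'" by (rule antisym[OF le[OF m] le[OF m(2,1) m(3)[symmetric]]])
    then show "m = m'" using m(3) by (simp add: g_def)
  qed
  have "?A = g ` ?Z"
  proof (intro antisym subsetI)
    fix m assume m: "m \<in> ?A"
    then have mK: "keys m \<notin> F" "inr (keys m)" using K by auto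
    then have "keys m \<in> supports ((v, W) # ps)"
      using m by (fastforce simp: truncated_supports_def inr_def)
    then obtain t where W: "\<forall>w\<in>W. (w, Min UNIV) \<in> keys m"
      and t: "(v, t) \<in> keys m"
        "\<And>j. j < t \<Longrightarrow> insert (v, j) (keys m) \<in> F"
      using mK by (auto simp: F_def)
    define m' where "m' = m - ?x t - D"
    have eq: "m = m' + ?x t + D"
      using W t(1) vW unfolding m'_def
      by (intro poly_mapping_eqI)
        (auto simp: lookup_add lookup_minus lookup_single when_def in_keys_iff lookup_D)
    have keys_m: "keys m = insert (v, t) (keys m') \<union> W \<times> {Min UNIV}"
      by (subst eq) (simp add: keys_add_nat keys_D)
    have t_q: "t \<le> q" using t(1) mK(2) by (auto simp: le_q inr_def)
    have "mdeg m = (\<lambda>i. mdeg m' i + (if i = v then 1 else 0) + (if i \<in> W then 1 else 0))"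
      by (subst eq) (simp add: mdeg_add mdeg_single_Suc_0 mdeg_D)
    then have deg: "mdeg m' = (\<lambda>i. b i - (if i = v then 1 else 0))"
      using m by (simp add: b_def fun_eq_iff eq_diff_eq)
    \<comment> \<open>Moving the index \<open>q\<close> down to \<open>t\<close> does not leave J,
      but m is not in J.\<close>
    have "insert (v, q) (keys m') \<notin> F"
    proof
      assume "insert (v, q) (keys m') \<in> F"
      then have "keys m \<in> F" unfolding F_def
        by (rule supports_exchange) (use t_q keys_m in auto)
      then show False using mK by simp
    qed
    moreover have "inr (insert (v, q) (keys m'))"
      using mK(2) keys_m le_q[of q] by (auto simp: inr_def)
    ultimately have m'Z: "m' \<in> ?Z" using deg K by simp
    have "insert (v, t) (keys m') \<notin> F" using mK(1) keys_m F_mono by blast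
    moreover have "insert (v, j) (keys m') \<in> F" if "j < t" for j
    proof -
      have "insert (v, j) (keys m) \<inter> vertices ps \<times> UNIV \<in> F"
        using supports_restrict t(2)[OF that] by (auto simp: F_def)
      then show ?thesis unfolding F_def
        by (rule supports_exchange) (use that keys_m Wps in \<open>auto intro: less_imp_le\<close>)
    qed
    ultimately have "\<tau> m' = t" unfolding \<tau>_def
      by (intro Min_eqI) (auto simp: not_less[symmetric])
    then have "m = g m'" using eq by (simp add: g_def)
    then show "m \<in> g ` ?Z" using m'Z by blast
  next
    fix m assume "m \<in> g ` ?Z"
    then obtain m' where m': "m' \<in> ?Z" "m = g m'" by blast
    have "mdeg m = a"
      using m' by (auto simp: g_def mdeg_add mdeg_single_Suc_0 mdeg_D b_def)
    moreover have "keys m \<in> supports ((v, W) # ps)"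
    proof -
      have "insert (v, j) (keys m) \<in> F" if "j < \<tau> m'" for j
        using \<tau>_min[OF that] by (rule F_mono) (auto simp: m'(2) keys_g)
      then show ?thesis by (auto simp: m'(2) keys_g F_def)
    qed
    moreover have "keys m \<notin> F"
    proof
      assume "keys m \<in> F"
      then have "keys m \<inter> vertices ps \<times> UNIV \<in> F"
        using supports_restrict by (auto simp: F_def)
      then have "insert (v, \<tau> m') (keys m') \<in> F"
        by (rule F_mono) (use Wps in \<open>auto simp: m'(2) keys_g\<close>)
      then show False using \<tau>_in(1)[OF m'(1)] by simp
    qed
    \<comment> \<open>The factor \<open>D\<close> is not truncated: the first variable at w has
      position 0, and \<open>k w\<close> is below d.\<close>
    moreover have "inr (keys m)"
    proof -
      have "inr (insert (v, q) (keys m'))" using m'(1) K by simp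
      then show ?thesis
        using \<tau>_in(2)[OF m'(1)] k by (auto simp: m'(2) keys_g inr_def le_q var_pos_Min)
    qed
    ultimately show "m \<in> ?A" using K by (auto simp: truncated_supports_def)
  qed
  then have "card ?A = card ?Z" by (simp add: card_image[OF inj])
  with card_B have "card ?A = card ?B" by simp
  have "Q \<in> ?K1" if "Q \<in> ?K" for Q using that by (auto simp: truncated_supports_def)
  then show ?thesis
    using \<open>card ?A = card ?B\<close>
      card_mdeg_split[of "\<lambda>m. keys m \<in> ?K" "\<lambda>m. keys m \<in> ?K1" a]
      card_mdeg_split[of "\<lambda>m. keys m \<in> ?K" "\<lambda>m. keys m \<in> ?K'" b,
        OF truncated_supports_mono_k]
    by (simp add: monomial_count_def)
qed

subsection \<open>Hilbert series of the sections\<close>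

lemma card_labels_at_insert:
  assumes "finite T" "(u, n) \<notin> T"
  shows "(\<lambda>w. card (labels_at (insert (u, n) T) w)) =
    (\<lambda>w. card (labels_at T w))(u := Suc (card (labels_at T u)))"
proof -
  have "n \<notin> labels_at T u" using assms by (simp add: labels_at_def)
  then show ?thesis using finite_labels_at[OF assms(1)] by (auto simp: labels_at_insert fun_eq_iff)
qed

text \<open>Both sides obey the same recursion in \<open>T\<close>. A form at a vertex with fewer
  than d forms can be cancelled; any further form already lies in the ideal, just as no variable is
  left to be truncated.\<close>

lemma hilbert_series_forms:
  fixes \<phi> :: "'n::finite \<times> nat \<Rightarrow> 'k::field ^ 'd::{finite,linorder}"
  assumes L: "finite L" "\<And>u. card (labels_at L u) \<ge> CARD('d)" "general_position L \<phi>" and "T \<subseteq> L"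
  shows "hilbert_series (section_ideal [] T \<phi>) a =
    monomial_count [] (\<lambda>u. card (labels_at T u)) TYPE('d) a"
proof -
  have reg: "filter_regular [] L \<phi>" by (rule filter_regular_Nil[OF L(1,3,2)])
  have "finite T" using assms finite_subset by blast
  then show ?thesis using \<open>T \<subseteq> L\<close>
  proof (induction T arbitrary: a rule: finite_induct)
    case empty
    have "section_ideal [] {} \<phi> = {0}"
      by (simp add: section_ideal_def edge_polys_def forms_def ideal_gen_def module.span_empty[OF module_mult])
    then have "section_ideal [] {} \<phi> \<inter> graded_piece a = {0}" by auto
    then have "hilbert_series (section_ideal [] {} \<phi>) a = 0"
      using mpoly.dim_unique[of "{}" "{0}" 0] mpoly.independent_empty by (simp add: hilbert_series_def)
    moreover have "P \<notin> truncated_supports [] (\<lambda>u. 0)" for P :: "('n \<times> 'd) set"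
      by (simp add: truncated_supports_def var_pos_less[unfolded not_le[symmetric]])
    ultimately show ?case by (simp add: monomial_count_def labels_at_def)
  next
    case (insert z T)
    obtain u n where z: "z = (u, n)" by force
    let ?l = "linform u (\<phi> (u, n))" and ?I = "section_ideal [] T \<phi>"
    let ?b = "\<lambda>i. a i - (if i = u then 1 else 0)"
    have k: "(\<lambda>w. card (labels_at (insert z T) w)) =
        (\<lambda>w. card (labels_at T w))(u := Suc (card (labels_at T u)))"
      unfolding z by (rule card_labels_at_insert) (use insert z in auto)
    have TL: "T \<subseteq> L" using insert.prems by simp
    show ?case
    proof (cases "card (labels_at T u) < CARD('d)")
      case True
      have "?l * h \<in> ?I \<longleftrightarrow> h \<in> ?I" if "h \<in> graded_piece ?b" for h
        using regularD[OF reg TL _ _ that] insert z True ideal_mult[OF is_ideal_section]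
        by auto
      then have "{h \<in> graded_piece ?b. ?l * h \<in> ?I} = ?I \<inter> graded_piece ?b" by blast
      then have "hilbert_series (section_ideal [] (insert z T) \<phi>) a + hilbert_series ?I ?b =
          hilbert_series ?I a + card {m :: ('n, 'd) mon. mdeg m = ?b}"
        using hilbert_series_insert[of "edge_polys [] \<union> forms \<phi> T" ?l "\<lambda>i. if i = u then 1 else 0" a,
            OF section_generators_homogeneous linform_piece]
        unfolding z section_insert_eq section_ideal_def[of "[]" T] hilbert_series_def by simp
      then show ?thesis
        using insert.IH[OF TL] monomial_count_Nil_step[where 'd = 'd and k = "\<lambda>w. card (labels_at T w)" and u = u and a = a] True
        unfolding k by simp
    next
      case False
      then have "var u j \<in> ?I" for j
        by (intro var_in_section[OF L(3) TL L(1)]) simp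
      then have "?l \<in> ?I" unfolding linform_def
        by (intro ideal_sum ideal_mult is_ideal_section)
      then have "section_ideal [] (insert z T) \<phi> = ?I"
        unfolding z section_insert_eq section_ideal_def[of "[]" T] by (rule ideal_gen_absorb)
      then show ?thesis using insert.IH[OF TL] False monomial_count_full[where 'd = 'd and k = "\<lambda>w. card (labels_at T w)" and u = u and ps = "[]" and a = a] 
        unfolding k by (simp add: not_less)
    qed
  qed
qed

text \<open>The induction hypothesis is needed for \<open>T\<close> and for \<open>T\<close> with
  the new label, hence with changed labels and forms. If a vertex of the edge carries d forms, the
  edge is redundant in the section and in the monomial ideal alike.\<close>

theorem hilbert_series_section_ideal:
  fixes \<phi> :: "'n::finite \<times> nat \<Rightarrow> 'k::field ^ 'd::{finite,linorder}"
  assumes "rooted_forest ps" "finite L" "\<And>u. card (labels_at L u) \<ge> CARD('d)" "good_position ps L \<phi>"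
    "T \<subseteq> L"
  shows "hilbert_series (section_ideal ps T \<phi>) a =
    monomial_count ps (\<lambda>u. card (labels_at T u)) TYPE('d) a"
  using assms
proof (induction ps arbitrary: L \<phi> T a)
  case Nil
  then show ?case by (intro hilbert_series_forms) auto
next
  case (Cons p ps)
  obtain v W where p: "p = (v, W)" by force
  note finL = Cons.prems(2) and big = Cons.prems(3)
  have forest: "rooted_forest ((v, W) # ps)" and forest': "rooted_forest ps" using Cons.prems(1) p by auto
  have finT: "finite T" using Cons.prems(5) finL finite_subset by blast
  have big': "card (labels_at L u) \<ge> CARD('d) - 1 + 1" for u using big[of u] by simp
  let ?k = "\<lambda>u. card (labels_at T u)"
  obtain X where X: "\<forall>w\<in>W. X w \<subseteq> labels_at L w \<and> card (X w) = CARD('d) - 1"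
    and TX: "(\<forall>w\<in>W. card (labels_at T w) < CARD('d)) \<longrightarrow> (\<forall>w\<in>W. labels_at T w \<subseteq> X w)"
  proof (cases "\<forall>w\<in>W. card (labels_at T w) < CARD('d)")
    case True
    have "\<forall>w\<in>W. card (labels_at T w) \<le> CARD('d) - 1"
    proof
      fix w assume "w \<in> W"
      then have "card (labels_at T w) < CARD('d)" using True by blast
      then show "card (labels_at T w) \<le> CARD('d) - 1" by linarith
    qed
    from labels_choice_exists[OF finL big' Cons.prems(5) this] show thesis
      using that by (elim exE) blast
  next
    case False
    from labels_choice_exists'[OF finL big', of W] show thesis
      using that False by (elim exE) blast
  qed
  obtain n0 \<phi>' \<mu> where fresh: "(v, n0) \<notin> L" and \<phi>': "\<forall>x\<in>L. \<phi>' x = \<phi> x"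
    and es: "edge_section ps v W n0 (insert (v, n0) L) \<phi>' X \<mu>"
    and good': "good_position ps (insert (v, n0) L) \<phi>'"
    and big_c: "\<forall>u. card (labels_at (insert (v, n0) L) u) \<ge> CARD('d)"
  proof -
    have "\<exists>n0 \<phi>' \<mu>. (v, n0) \<notin> L \<and> (\<forall>x\<in>L. \<phi>' x = \<phi> x) \<and>
      edge_section ps v W n0 (insert (v, n0) L) \<phi>' X \<mu> \<and> good_position ps (insert (v, n0) L) \<phi>' \<and>
      (\<forall>u. card (labels_at (insert (v, n0) L) u) \<ge> CARD('d))"
    proof (rule edge_section_exists[OF forest finL big Cons.prems(4)[unfolded p] _ X])
      fix L' and \<phi>'' :: "'n \<times> nat \<Rightarrow> ('k, 'd) vec"
      assume "finite L'" "\<And>u. card (labels_at L' u) \<ge> CARD('d)" "good_position ps L' \<phi>''"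
      then show "filter_regular ps L' \<phi>''" by (rule good_position_regular[OF forest'])
    qed
    then show thesis using that by (elim exE conjE)
  qed
  interpret edge_section ps v W n0 "insert (v, n0) L" \<phi>' X \<mu> by (rule es)
  have eq: "section_ideal qs T \<phi> = section_ideal qs T \<phi>'" for qs
    by (rule section_cong) (use \<phi>' Cons.prems(5) in auto)
  have T: "T \<subseteq> insert (v, n0) L" "(v, n0) \<notin> T" using Cons.prems(5) fresh by auto
  have IH: "hilbert_series (S T') b = monomial_count ps (\<lambda>u. card (labels_at T' u)) TYPE('d) b"
    if "T' \<subseteq> insert (v, n0) L" for T' b
    by (rule Cons.IH[OF forest' _ _ good' that]) (use finL big_c in auto)
  show ?case
  proof (cases "\<exists>u\<in>insert v W. card (labels_at T u) \<ge> CARD('d)")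
    case True
    then obtain u where u: "u \<in> insert v W" "card (labels_at T u) \<ge> CARD('d)" by blast
    have "var u j \<in> S T" for j
      by (rule var_in_section[OF gp T(1) _ u(2)]) (use finL in auto)
    then have "lss_poly (insert v W) \<in> S T"
      using lss_poly_in_ideal[OF is_ideal_section u(1)] by blast
    then have "section_ideal ((v, W) # ps) T \<phi>' = S T" by (rule section_Cons_absorb)
    then show ?thesis unfolding p eq using IH[OF T(1)] monomial_count_Cons_full[where k = ?k, OF u] by simp
  next
    case False
    then have small: "card (labels_at T u) < CARD('d)" if "u \<in> insert v W" for u
      using that by (meson not_le)
    have TX': "labels_at T w \<subseteq> X w" if "w \<in> W" for w using TX small that by blast
    let ?b = "\<lambda>i. a i - (if i \<in> W then 1 else 0)"
    have "hilbert_series (section_ideal ((v, W) # ps) T \<phi>') a + hilbert_series (S T) ?b =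
        hilbert_series (S T) a + hilbert_series (S (insert (v, n0) T)) ?b"
      using hilbert_series_edge[OF T] TX' by blast
    moreover have "insert (v, n0) T \<subseteq> insert (v, n0) L" using T by auto
    moreover have "monomial_count ((v, W) # ps) ?k TYPE('d) a + monomial_count ps ?k TYPE('d) ?b =
        monomial_count ps ?k TYPE('d) a + monomial_count ps (?k(v := Suc (?k v))) TYPE('d) ?b"
      by (rule monomial_count_Cons_step[OF forest small])
    ultimately show ?thesis
      unfolding p eq using IH T(1) card_labels_at_insert[OF finT T(2)] by simp
  qed
qed

subsection \<open>Existence of good positions over infinite fields\<close>

text \<open>Functions that are polynomial along every line serve as polynomial functions: over an
  infinite field a product of two of them is nonzero somewhere if both factors are.\<close>

definition line_poly :: "(('z \<Rightarrow> 'k::field ^ 'd) \<Rightarrow> 'k) \<Rightarrow> bool" where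
  "line_poly F \<longleftrightarrow> (\<forall>a b. \<exists>p. \<forall>t. F (\<lambda>z. a z + t *s (b z - a z)) = poly p t)"

lemma line_poly_const [simp]: "line_poly (\<lambda>x. c)"
  unfolding line_poly_def by (intro allI exI[of _ "[:c:]"]) simp

lemma line_poly_coord [simp]: "line_poly (\<lambda>x. x z $ j)"
  unfolding line_poly_def
proof (intro allI)
  fix a b :: "'a \<Rightarrow> 'b ^ 'c"
  show "\<exists>p. \<forall>t. (a z + t *s (b z - a z)) $ j = poly p t"
    by (intro exI[of _ "[:a z $ j, b z $ j - a z $ j:]"]) simp
qed

lemma line_poly_add: "line_poly F \<Longrightarrow> line_poly G \<Longrightarrow> line_poly (\<lambda>x. F x + G x)"
  unfolding line_poly_def by (metis poly_add)

lemma line_poly_mult: "line_poly F \<Longrightarrow> line_poly G \<Longrightarrow> line_poly (\<lambda>x. F x * G x)"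
  unfolding line_poly_def by (metis poly_mult)

lemma line_poly_sum: "(\<And>i. i \<in> A \<Longrightarrow> line_poly (F i)) \<Longrightarrow> line_poly (\<lambda>x. \<Sum>i\<in>A. F i x)"
  by (induction A rule: infinite_finite_induct) (auto intro: line_poly_add)

lemma line_poly_prod: "(\<And>i. i \<in> A \<Longrightarrow> line_poly (F i)) \<Longrightarrow> line_poly (\<lambda>x. \<Prod>i\<in>A. F i x)"
  by (induction A rule: infinite_finite_induct) (auto intro: line_poly_mult)

lemma line_poly_det:
  fixes M :: "('z \<Rightarrow> 'k::field ^ 'd) \<Rightarrow> 'k ^ 'e ^ 'e::finite"
  assumes "\<And>i j. line_poly (\<lambda>x. M x $ i $ j)"
  shows "line_poly (\<lambda>x. det (M x))"
  unfolding det_def by (intro line_poly_sum line_poly_mult line_poly_const line_poly_prod assms)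

text \<open>The analogue of containing a nonempty Zariski-open set.\<close>

definition generic :: "(('z \<Rightarrow> 'k::field ^ 'd) \<Rightarrow> bool) \<Rightarrow> bool" where
  "generic Q \<longleftrightarrow> (\<exists>F. line_poly F \<and> (\<exists>x. F x \<noteq> 0) \<and> (\<forall>x. F x \<noteq> 0 \<longrightarrow> Q x))"

lemma genericI: "line_poly F \<Longrightarrow> F x \<noteq> 0 \<Longrightarrow> (\<And>x. F x \<noteq> 0 \<Longrightarrow> Q x) \<Longrightarrow> generic Q"
  unfolding generic_def by blast

lemma generic_ex: "generic Q \<Longrightarrow> \<exists>x. Q x"
  unfolding generic_def by blast

lemma generic_mono: "generic Q \<Longrightarrow> (\<And>x. Q x \<Longrightarrow> R x) \<Longrightarrow> generic R"
  unfolding generic_def by blast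

text \<open>On the line through one witness for each condition, both functions become nonzero
  polynomials, and their product has only finitely many roots.\<close>

lemma generic_conj:
  fixes Q R :: "('z \<Rightarrow> 'k::field ^ 'd) \<Rightarrow> bool"
  assumes inf: "infinite (UNIV :: 'k set)" and "generic Q" "generic R"
  shows "generic (\<lambda>x. Q x \<and> R x)"
proof -
  obtain F x where F: "line_poly F" "F x \<noteq> 0" "\<And>x. F x \<noteq> 0 \<Longrightarrow> Q x"
    using assms(2) unfolding generic_def by blast
  obtain G y where G: "line_poly G" "G y \<noteq> 0" "\<And>x. G x \<noteq> 0 \<Longrightarrow> R x"
    using assms(3) unfolding generic_def by blast
  let ?l = "\<lambda>t z. x z + t *s (y z - x z)"
  have l: "?l 0 = x" "?l 1 = y" by (simp_all add: fun_eq_iff)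
  obtain p where p: "\<And>t. F (?l t) = poly p t" using F(1) unfolding line_poly_def by blast
  obtain q where q: "\<And>t. G (?l t) = poly q t" using G(1) unfolding line_poly_def by blast
  have "poly p 0 \<noteq> 0" using p[of 0] l F(2) by simp
  moreover have "poly q 1 \<noteq> 0" using q[of 1] l G(2) by simp
  ultimately have "p * q \<noteq> 0" by auto
  then have "finite {t. poly (p * q) t = 0}" by (rule poly_roots_finite)
  then obtain t where "poly (p * q) t \<noteq> 0" using inf by (metis (mono_tags, lifting) UNIV_eq_I mem_Collect_eq)
  then have "F (?l t) * G (?l t) \<noteq> 0" using p q by simp
  then show ?thesis
    by (rule genericI[OF line_poly_mult[OF F(1) G(1)], of "?l t"]) (use F(3) G(3) in auto)
qed

lemma generic_finite_all:
  fixes Q :: "'i \<Rightarrow> ('z \<Rightarrow> 'k::field ^ 'd) \<Rightarrow> bool"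
  assumes inf: "infinite (UNIV :: 'k set)" and "finite A" "\<And>i. i \<in> A \<Longrightarrow> generic (Q i)"
  shows "generic (\<lambda>x. \<forall>i\<in>A. Q i x)"
  using assms(2,3)
proof (induction A rule: finite_induct)
  case empty
  show ?case by (rule genericI[of "\<lambda>_. 1" "\<lambda>_. 0"]) auto
next
  case (insert i A)
  then have "generic (\<lambda>x. Q i x \<and> (\<forall>i\<in>A. Q i x))" by (intro generic_conj[OF inf]) auto
  then show ?case by (rule generic_mono) auto
qed

section \<open>Determinants and cofactor vectors\<close>

lemma det_nz_iff_span_rows:
  fixes A :: "'k::field ^ 'd ^ 'd::finite"
  shows "det A \<noteq> 0 \<longleftrightarrow> vec.span (rows A) = UNIV"
  by (simp add: invertible_det_nz[symmetric] invertible_left_inverse matrix_left_invertible_span_rows_gen)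

text \<open>The cofactors of row \<open>r0\<close>: up to scaling the vector orthogonal to the rows \<open>g r\<close>, \<open>r \<noteq> r0\<close>.\<close>

definition cofactors :: "'d \<Rightarrow> ('d \<Rightarrow> 'k::field ^ 'd) \<Rightarrow> 'k ^ 'd::finite" where
  "cofactors r0 g = (\<chi> j. det (\<chi> r. if r = r0 then axis j 1 else g r))"

text \<open>Expansion of the determinant along row \<open>r0\<close>.\<close>

lemma sum_mult_cofactors:
  "(\<Sum>j\<in>UNIV. s $ j * cofactors r0 g $ j) = det (\<chi> r. if r = r0 then s else g r)"
proof -
  have "det (\<chi> r. if r = r0 then s else g r) =
      det (\<chi> r. if r = r0 then (\<Sum>j\<in>UNIV. (s $ j) *s axis j 1) else g r)"
    by (simp add: basis_expansion cong: if_cong)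
  also have "\<dots> = (\<Sum>j\<in>UNIV. det (\<chi> r. if r = r0 then (s $ j) *s axis j 1 else g r))"
    by (rule det_linear_row_sum) simp
  also have "\<dots> = (\<Sum>j\<in>UNIV. s $ j * cofactors r0 g $ j)"
    by (simp add: det_row_mul cofactors_def)
  finally show ?thesis ..
qed

lemma cofactors_orthogonal:
  assumes "r \<noteq> r0"
  shows "(\<Sum>j\<in>UNIV. g r $ j * cofactors r0 g $ j) = 0"
  unfolding sum_mult_cofactors
  by (rule det_identical_rows[of r0 r]) (use assms in \<open>auto simp: row_def vec_eq_iff\<close>)

lemma cofactors_cong: "(\<And>r. r \<noteq> r0 \<Longrightarrow> g r = g' r) \<Longrightarrow> cofactors r0 g = cofactors r0 g'"
proof -
  assume *: "\<And>r. r \<noteq> r0 \<Longrightarrow> g r = g' r"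
  have "(\<chi> r. if r = r0 then axis j 1 else g r) = (\<chi> r. if r = r0 then axis j 1 else g' r)" for j
    by (simp add: vec_eq_iff *)
  then show ?thesis by (simp add: cofactors_def)
qed

text \<open>If \<mu>_j1 is nonzero, the vectors \<mu>_j1 e_j - \<mu>_j e_j1 with j different from j1
  form a basis of the orthogonal complement of \<mu>. The transposition \<open>\<pi>\<close> of
  \<open>r0\<close> and \<open>j1\<close> distributes them over the rows other than
  \<open>r0\<close>. The scalars \<open>\<kappa>\<close> are there because
  \<open>prescribable\<close> controls the forms only up to scalars.\<close>

lemma cofactors_realize:
  fixes \<mu> :: "'k::field ^ 'd::finite"
  assumes "\<mu> \<noteq> 0"
  shows "\<exists>g. (\<forall>r. r \<noteq> r0 \<longrightarrow> g r \<noteq> 0) \<and>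
    (\<forall>\<kappa>. (\<forall>r. \<kappa> r \<noteq> 0) \<longrightarrow> (\<exists>c. c \<noteq> 0 \<and> cofactors r0 (\<lambda>r. \<kappa> r *s g r) = c *s \<mu>))"
proof -
  obtain j1 where j1: "\<mu> $ j1 \<noteq> 0" using assms by (auto simp: vec_eq_iff)
  define \<pi> where "\<pi> r = (if r = r0 then j1 else if r = j1 then r0 else r)" for r
  have \<pi>: "\<pi> (\<pi> r) = r" "\<pi> r = j1 \<longleftrightarrow> r = r0" for r by (auto simp: \<pi>_def)
  define g where "g r = (\<mu> $ j1) *s axis (\<pi> r) 1 - (\<mu> $ \<pi> r) *s axis j1 (1 :: 'k)" for r
  have "g r \<noteq> 0" if "r \<noteq> r0" for r
  proof -
    have "g r $ \<pi> r = \<mu> $ j1" using that \<pi>(2)[of r] by (simp add: g_def axis_def)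
    then show ?thesis using j1 by auto
  qed
  moreover have "\<exists>c. c \<noteq> 0 \<and> cofactors r0 (\<lambda>r. \<kappa> r *s g r) = c *s \<mu>" if \<kappa>: "\<And>r. \<kappa> r \<noteq> 0" for \<kappa>
  proof -
    let ?c = "cofactors r0 (\<lambda>r. \<kappa> r *s g r)"
    let ?M = "\<chi> r. if r = r0 then axis j1 1 else \<kappa> r *s g r"
    have rows: "?M $ r \<in> vec.span (rows ?M)" for r
      by (intro vec.span_base) (auto simp: rows_def row_def vec_lambda_eta)
    have j1_in: "axis j1 1 \<in> vec.span (rows ?M)" using rows[of r0] by simp
    have "axis j 1 \<in> vec.span (rows ?M)" for j
    proof (cases "j = j1")
      case False
      then have r: "\<pi> j \<noteq> r0" using \<pi> by metis
      then have "\<kappa> (\<pi> j) *s g (\<pi> j) \<in> vec.span (rows ?M)" using rows[of "\<pi> j"] by simp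
      then have "inverse (\<kappa> (\<pi> j)) *s (\<kappa> (\<pi> j) *s g (\<pi> j)) \<in> vec.span (rows ?M)"
        by (rule vec.span_scale)
      moreover have "inverse (\<kappa> (\<pi> j)) *s (\<kappa> (\<pi> j) *s g (\<pi> j)) = g (\<pi> j)"
        using \<kappa> by (simp add: vector_smult_assoc)
      ultimately have "g (\<pi> j) \<in> vec.span (rows ?M)" by (simp only:)
      then have "g (\<pi> j) + (\<mu> $ j) *s axis j1 1 \<in> vec.span (rows ?M)"
        using j1_in by (intro vec.span_add vec.span_scale)
      then have "(\<mu> $ j1) *s axis j 1 \<in> vec.span (rows ?M)" by (simp add: g_def \<pi>)
      then have "inverse (\<mu> $ j1) *s ((\<mu> $ j1) *s axis j 1) \<in> vec.span (rows ?M)"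
        by (rule vec.span_scale)
      moreover have "inverse (\<mu> $ j1) *s ((\<mu> $ j1) *s axis j (1 :: 'k)) = axis j 1"
        using j1 by (simp add: vector_smult_assoc)
      ultimately show ?thesis by (simp only:)
    qed (use j1_in in simp)
    then have "(\<Sum>j\<in>UNIV. (y $ j) *s axis j 1) \<in> vec.span (rows ?M)" for y
      by (intro vec.span_sum vec.span_scale)
    then have "vec.span (rows ?M) = UNIV" by (auto simp: basis_expansion)
    then have "det ?M \<noteq> 0" by (simp add: det_nz_iff_span_rows)
    then have c1: "?c $ j1 \<noteq> 0"
      using sum_mult_cofactors[of "axis j1 1" r0 "\<lambda>r. \<kappa> r *s g r"]
      by (simp add: axis_def if_distrib if_distribR sum.delta cong: if_cong)
    \<comment> \<open>Orthogonality to the row \<open>\<pi> j\<close> compares the coordinates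
      \<open>j\<close> and \<open>j1\<close>.\<close>
    have c_eq: "?c $ j = ?c $ j1 / \<mu> $ j1 * \<mu> $ j" for j
    proof (cases "j = j1")
      case False
      then have r: "\<pi> j \<noteq> r0" using \<pi> by metis
      have "0 = (\<Sum>i\<in>UNIV. (\<kappa> (\<pi> j) *s g (\<pi> j)) $ i * ?c $ i)"
        using cofactors_orthogonal[OF r, of "\<lambda>r. \<kappa> r *s g r"] by simp
      also have "\<dots> = \<kappa> (\<pi> j) * (\<Sum>i\<in>UNIV. \<mu> $ j1 * (if i = j then ?c $ i else 0) -
          \<mu> $ j * (if i = j1 then ?c $ i else 0))"
        unfolding sum_distrib_left
        by (intro sum.cong refl) (auto simp: g_def \<pi> axis_def algebra_simps)
      also have "\<dots> = \<kappa> (\<pi> j) * (\<mu> $ j1 * ?c $ j - \<mu> $ j * ?c $ j1)"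
        by (simp add: sum_subtractf sum.delta flip: sum_distrib_left)
      finally show ?thesis using \<kappa>[of "\<pi> j"] j1 by (simp add: field_simps)
    qed (use j1 in simp)
    have "?c = (?c $ j1 / \<mu> $ j1) *s \<mu>"
      by (intro vec_eq_iff[THEN iffD2] allI) (subst vector_smult_component, rule c_eq)
    moreover have "?c $ j1 / \<mu> $ j1 \<noteq> 0" using c1 j1 by simp
    ultimately show ?thesis by blast
  qed
  ultimately show ?thesis by blast
qed

text \<open>Scalars have to be allowed since prescribed cofactors are only attained up to scaling: for
  \<open>d = 1\<close> the cofactor is always 1.\<close>

definition prescribable ::
    "'n set \<Rightarrow> ('n \<times> nat) set \<Rightarrow> (('z \<Rightarrow> 'k::field ^ 'd) \<Rightarrow> 'n \<times> nat \<Rightarrow> 'k ^ 'd::finite) \<Rightarrow> bool" where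
  "prescribable U L \<Phi> \<longleftrightarrow> (\<forall>X y. X \<subseteq> L \<inter> U \<times> UNIV \<and> (\<forall>u. card (labels_at X u) \<le> CARD('d)) \<and>
    (\<forall>z\<in>X. y z \<noteq> 0) \<longrightarrow> (\<exists>x. \<forall>z\<in>X. \<exists>c. c \<noteq> 0 \<and> \<Phi> x z = c *s y z))"

lemma prescribableD:
  assumes "prescribable U L \<Phi>" "X \<subseteq> L \<inter> U \<times> UNIV"
    and "\<And>u. card (labels_at X u) \<le> CARD('d)" "\<And>z. z \<in> X \<Longrightarrow> y z \<noteq> (0 :: 'k::field ^ 'd::finite)"
  shows "\<exists>x. \<forall>z\<in>X. \<exists>c. c \<noteq> 0 \<and> \<Phi> x z = c *s y z"
  by (rule assms(1)[unfolded prescribable_def, THEN spec, THEN spec, THEN mp]) (use assms(2-) in simp)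

section \<open>Prescribing forms up to scalars\<close>

lemma span_scaled_axes:
  fixes y :: "'d \<Rightarrow> 'k::field ^ 'd::finite"
  assumes "\<And>j. \<exists>c. c \<noteq> 0 \<and> y j = c *s axis j 1"
  shows "vec.span (range y) = UNIV"
proof -
  have "axis j 1 \<in> vec.span (range y)" for j
  proof -
    obtain c where c: "c \<noteq> 0" "y j = c *s axis j 1" using assms by blast
    then have "inverse c *s y j = axis j 1" by (simp add: vector_smult_assoc)
    then show ?thesis using vec.span_scale[OF vec.span_base, of "y j" "range y" "inverse c"] by simp
  qed
  then have "(\<Sum>j\<in>UNIV. (x $ j) *s axis j 1) \<in> vec.span (range y)" for x
    by (intro vec.span_sum vec.span_scale)
  then show ?thesis by (auto simp: basis_expansion)
qed

text \<open>The d labels are prescribed to be the standard basis vectors, which still span after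
  rescaling.\<close>

lemma prescribable_span:
  fixes \<Phi> :: "('z \<Rightarrow> 'k::field ^ 'd) \<Rightarrow> 'n \<times> nat \<Rightarrow> 'k ^ 'd::finite"
  assumes pre: "prescribable U L \<Phi>" and "u \<in> U" and X: "X \<subseteq> labels_at L u" "card X = CARD('d)"
  shows "\<exists>x. vec.span ((\<lambda>n. \<Phi> x (u, n)) ` X) = UNIV"
proof -
  have "finite X" using X(2) by (metis card.infinite zero_less_card_finite less_irrefl)
  then obtain e where e: "bij_betw e (UNIV :: 'd set) X"
    using X(2) finite_same_card_bij[of "UNIV :: 'd set" X] by auto
  let ?X = "Pair u ` X"
  have "labels_at ?X w = (if w = u then X else {})" for w by (auto simp: labels_at_def)
  then have "card (labels_at ?X w) \<le> CARD('d)" for w using X(2) by simp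
  moreover have "?X \<subseteq> L \<inter> U \<times> UNIV" using X(1) \<open>u \<in> U\<close> by (auto simp: labels_at_def)
  ultimately have "\<exists>x. \<forall>z\<in>?X. \<exists>c. c \<noteq> 0 \<and> \<Phi> x z = c *s axis (inv_into UNIV e (snd z)) 1"
    by (intro prescribableD[OF pre]) (simp_all add: axis_eq_0_iff)
  then obtain x where x: "\<And>n. n \<in> X \<Longrightarrow> \<exists>c. c \<noteq> 0 \<and> \<Phi> x (u, n) = c *s axis (inv_into UNIV e n) 1"
    by auto
  have "vec.span (range (\<lambda>j. \<Phi> x (u, e j))) = UNIV"
  proof (rule span_scaled_axes)
    fix j
    have "inv_into UNIV e (e j) = j" using e by (simp add: bij_betw_inv_into_left)
    then show "\<exists>c. c \<noteq> 0 \<and> \<Phi> x (u, e j) = c *s axis j 1"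
      using x[of "e j"] e bij_betwE by fastforce
  qed
  moreover have "range (\<lambda>j. \<Phi> x (u, e j)) = (\<lambda>n. \<Phi> x (u, n)) ` X"
    using bij_betw_imp_surj_on[OF e] by (auto simp: image_image[symmetric])
  ultimately show ?thesis by auto
qed

text \<open>For each of the finitely many sets of d labels, spanning is the nonvanishing of a
  determinant; the witnesses may differ from set to set.\<close>

lemma generic_general_position:
  fixes \<Phi> :: "('z \<Rightarrow> 'k::field ^ 'd) \<Rightarrow> 'n::finite \<times> nat \<Rightarrow> 'k ^ 'd::finite"
  assumes inf: "infinite (UNIV :: 'k set)" and finL: "finite L"
    and lp: "\<And>z j. line_poly (\<lambda>x. \<Phi> x z $ j)"
    and span: "\<And>u X. X \<subseteq> labels_at L u \<Longrightarrow> card X = CARD('d) \<Longrightarrow>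
      \<exists>x. vec.span ((\<lambda>n. \<Phi> x (u, n)) ` X) = UNIV"
  shows "generic (\<lambda>x. general_position L (\<Phi> x))"
proof -
  let ?A = "SIGMA u:UNIV. {X. X \<subseteq> labels_at L u \<and> card X = CARD('d)}"
  have "finite {X. X \<subseteq> labels_at L u \<and> card X = CARD('d)}" for u
    by (rule finite_subset[of _ "Pow (labels_at L u)"]) (auto intro: finite_labels_at[OF finL])
  then have "finite ?A" by (intro finite_SigmaI) auto
  moreover have "generic (\<lambda>x. vec.span ((\<lambda>n. \<Phi> x (fst a, n)) ` snd a) = UNIV)" if "a \<in> ?A" for a
  proof -
    obtain u X where a: "a = (u, X)" by force
    have X: "X \<subseteq> labels_at L u" "card X = CARD('d)" using that a by auto
    have "finite X" using X(1) finite_labels_at[OF finL] finite_subset by blast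
    then obtain e where e: "bij_betw e (UNIV :: 'd set) X"
      using X(2) finite_same_card_bij[of "UNIV :: 'd set" X] by auto
    let ?M = "\<lambda>x. \<chi> r. \<Phi> x (u, e r)"
    have "rows (?M x) = (\<lambda>n. \<Phi> x (u, n)) ` X" for x
      using bij_betw_imp_surj_on[OF e] by (auto simp: rows_def row_def vec_lambda_eta)
    then have iff: "det (?M x) \<noteq> 0 \<longleftrightarrow> vec.span ((\<lambda>n. \<Phi> x (u, n)) ` X) = UNIV" for x
      by (simp add: det_nz_iff_span_rows)
    obtain x where "det (?M x) \<noteq> 0" using span[OF X] iff by blast
    then show ?thesis
      by (rule genericI[rotated]) (use iff lp in \<open>auto simp: a intro!: line_poly_det\<close>)
  qed
  ultimately have "generic (\<lambda>x. \<forall>a\<in>?A. vec.span ((\<lambda>n. \<Phi> x (fst a, n)) ` snd a) = UNIV)"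
    by (rule generic_finite_all[OF inf])
  then show ?thesis by (rule generic_mono) (auto simp: general_position_def)
qed

text \<open>The labels \<open>e w r\<close>, \<open>r \<noteq> r0\<close>, are those of the set \<open>X w\<close> in \<open>good_position\<close>.\<close>

locale attach_edge =
  fixes U :: "'n::finite set" and L :: "('n \<times> nat) set" and v :: 'n and W :: "'n set" and n0 :: nat
    and \<Phi> :: "('z \<Rightarrow> 'k::field ^ 'd) \<Rightarrow> 'n \<times> nat \<Rightarrow> 'k ^ 'd::finite"
    and e :: "'n \<Rightarrow> 'd \<Rightarrow> nat" and r0 :: 'd
  assumes finL: "finite L" and pre: "prescribable U L \<Phi>" and lp: "\<And>z j. line_poly (\<lambda>x. \<Phi> x z $ j)"
    and W: "W \<subseteq> U" "v \<in> U - W" "W \<noteq> {}" and n0: "(v, n0) \<notin> L"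
    and e: "\<And>w. w \<in> W \<Longrightarrow> inj_on (e w) (UNIV - {r0})"
      "\<And>w r. w \<in> W \<Longrightarrow> r \<noteq> r0 \<Longrightarrow> (w, e w r) \<in> L"
begin

definition "\<mu> x w = cofactors r0 (\<lambda>r. \<Phi> x (w, e w r))"
definition "\<Phi>' x = (\<Phi> x)((v, n0) := \<chi> j. \<Prod>w\<in>W. \<mu> x w $ j)"

lemma line_poly_\<mu>: "line_poly (\<lambda>x. \<mu> x w $ j)"
  unfolding \<mu>_def cofactors_def
proof (simp, rule line_poly_det)
  fix i j'
  show "line_poly (\<lambda>x. (\<chi> r. if r = r0 then axis j 1 else \<Phi> x (w, e w r)) $ i $ j')"
    by (cases "i = r0") (simp_all add: lp)
qed

lemma line_poly_\<Phi>': "line_poly (\<lambda>x. \<Phi>' x z $ j)"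
  by (cases "z = (v, n0)") (auto simp: \<Phi>'_def lp intro!: line_poly_prod line_poly_\<mu>)

text \<open>Vectors with cofactors \<open>tgt w\<close> are prescribed at the labels
  \<open>e w r\<close>, and \<open>y\<close> at the labels in \<open>X\<close>. These labels sit at
  disjoint sets of vertices, so a single use of \<open>prescribable\<close> serves for both.\<close>

lemma realize:
  assumes X: "X \<subseteq> L \<inter> (U - W) \<times> UNIV" "\<And>u. card (labels_at X u) \<le> CARD('d)" "\<And>z. z \<in> X \<Longrightarrow> y z \<noteq> 0"
    and tgt: "\<And>w. w \<in> W \<Longrightarrow> tgt w \<noteq> 0"
  shows "\<exists>x. (\<forall>z\<in>X. \<exists>c. c \<noteq> 0 \<and> \<Phi> x z = c *s y z) \<and> (\<forall>w\<in>W. \<exists>c. c \<noteq> 0 \<and> \<mu> x w = c *s tgt w)"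
proof -
  have "\<exists>g. (\<forall>r. r \<noteq> r0 \<longrightarrow> g r \<noteq> 0) \<and>
      (\<forall>\<kappa>. (\<forall>r. \<kappa> r \<noteq> 0) \<longrightarrow> (\<exists>c. c \<noteq> 0 \<and> cofactors r0 (\<lambda>r. \<kappa> r *s g r) = c *s tgt w))" if "w \<in> W" for w
    by (rule cofactors_realize[OF tgt[OF that]])
  then obtain g where g: "\<And>w r. w \<in> W \<Longrightarrow> r \<noteq> r0 \<Longrightarrow> g w r \<noteq> 0"
    "\<And>w \<kappa>. w \<in> W \<Longrightarrow> (\<And>r. \<kappa> r \<noteq> 0) \<Longrightarrow> \<exists>c. c \<noteq> 0 \<and> cofactors r0 (\<lambda>r. \<kappa> r *s g w r) = c *s tgt w"
    by metis
  let ?XW = "(\<lambda>(w, r). (w, e w r)) ` (W \<times> (UNIV - {r0}))"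
  let ?X = "X \<union> ?XW"
  define y' where "y' z = (if fst z \<in> W then g (fst z) (inv_into (UNIV - {r0}) (e (fst z)) (snd z)) else y z)" for z
  have y'_W: "y' (w, e w r) = g w r" if "w \<in> W" "r \<noteq> r0" for w r
    using inv_into_f_f[OF e(1)[OF that(1)], of r] that by (simp add: y'_def)
  have y'_X: "y' z = y z" if "z \<in> X" for z
    using that X(1) by (auto simp: y'_def)
  have "card (labels_at ?X u) \<le> CARD('d)" for u
  proof (cases "u \<in> W")
    case True
    then have "labels_at ?X u = e u ` (UNIV - {r0})" using X(1) by (auto simp: labels_at_def)
    also have "card \<dots> \<le> card (UNIV - {r0})" by (rule card_image_le) simp
    also have "\<dots> \<le> CARD('d)" by (rule card_mono) auto
    finally show ?thesis .
  next
    case False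
    then have "labels_at ?X u = labels_at X u" by (auto simp: labels_at_def)
    then show ?thesis using X(2) by simp
  qed
  moreover have "?X \<subseteq> L \<inter> U \<times> UNIV" using X(1) e(2) W(1) by auto
  moreover have "y' z \<noteq> 0" if z: "z \<in> ?X" for z
  proof (cases "z \<in> X")
    case False
    then obtain w r where "w \<in> W" "r \<noteq> r0" "z = (w, e w r)" using z by auto
    then show ?thesis using y'_W g(1) by simp
  qed (simp add: y'_X X(3))
  ultimately have "\<exists>x. \<forall>z\<in>?X. \<exists>c. c \<noteq> 0 \<and> \<Phi> x z = c *s y' z"
    by (intro prescribableD[OF pre])
  then obtain x where x: "\<And>z. z \<in> ?X \<Longrightarrow> \<exists>c. c \<noteq> 0 \<and> \<Phi> x z = c *s y' z"
    by blast
  have "\<exists>c. c \<noteq> 0 \<and> \<mu> x w = c *s tgt w" if w: "w \<in> W" for w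
  proof -
    have "\<exists>c. c \<noteq> 0 \<and> (r \<noteq> r0 \<longrightarrow> \<Phi> x (w, e w r) = c *s g w r)" for r
    proof (cases "r = r0")
      case False
      then have "(w, e w r) \<in> ?X" using w by auto
      then show ?thesis using x[of "(w, e w r)"] y'_W[OF w False] by auto
    qed (auto intro: exI[of _ 1])
    then obtain \<kappa> where \<kappa>: "\<And>r. \<kappa> r \<noteq> 0" "\<And>r. r \<noteq> r0 \<Longrightarrow> \<Phi> x (w, e w r) = \<kappa> r *s g w r"
      by metis
    then have "\<mu> x w = cofactors r0 (\<lambda>r. \<kappa> r *s g w r)"
      unfolding \<mu>_def by (intro cofactors_cong) auto
    then show ?thesis using g(2)[OF w \<kappa>(1)] by simp
  qed
  moreover have "\<exists>c. c \<noteq> 0 \<and> \<Phi> x z = c *s y z" if "z \<in> X" for z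
    using x[of z] y'_X[OF that] that by auto
  ultimately show ?thesis by blast
qed

text \<open>The new form is the coordinatewise product of the \<open>\<mu> x w\<close>. It is
  prescribed through a single \<open>w0\<close> in \<open>W\<close>, with the all-ones vector as
  target at the other vertices. The labels at \<open>W\<close> are used up by this, so
  \<open>W\<close> leaves the set \<open>U\<close>.\<close>

lemma prescribable_step: "prescribable (U - W) (insert (v, n0) L) \<Phi>'"
  unfolding prescribable_def
proof (intro allI impI, elim conjE)
  fix X :: "('n \<times> nat) set" and y :: "'n \<times> nat \<Rightarrow> ('k, 'd) vec"
  assume X: "X \<subseteq> insert (v, n0) L \<inter> (U - W) \<times> UNIV" "\<forall>u. card (labels_at X u) \<le> CARD('d)" "\<forall>z\<in>X. y z \<noteq> 0"
  obtain w0 where w0: "w0 \<in> W" using W(3) by blast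
  have one: "(\<chi> j. (1 :: 'k)) \<noteq> (0 :: ('k, 'd) vec)" by (simp add: vec_eq_iff)
  define tgt where "tgt w = (if w = w0 \<and> (v, n0) \<in> X then y (v, n0) else \<chi> j. 1)" for w
  have tgt: "tgt w \<noteq> 0" for w using X(3) one by (auto simp: tgt_def)
  let ?X = "X - {(v, n0)}"
  have finX: "finite X" using X(1) finL finite_subset by blast
  have "card (labels_at ?X u) \<le> CARD('d)" for u
    using X(2)[rule_format, of u] card_mono[OF finite_labels_at[OF finX] labels_at_mono[of ?X X]]
    by (meson Diff_subset le_trans)
  moreover have "?X \<subseteq> L \<inter> (U - W) \<times> UNIV" using X(1) by auto
  ultimately obtain x where x: "\<forall>z\<in>?X. \<exists>c. c \<noteq> 0 \<and> \<Phi> x z = c *s y z"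
      "\<forall>w\<in>W. \<exists>c. c \<noteq> 0 \<and> \<mu> x w = c *s tgt w"
    using realize[of ?X y tgt] X(3) tgt by blast
  obtain c where c: "\<And>w. w \<in> W \<Longrightarrow> c w \<noteq> 0" "\<And>w. w \<in> W \<Longrightarrow> \<mu> x w = c w *s tgt w"
    using x(2) by metis
  have "\<exists>c. c \<noteq> 0 \<and> \<Phi>' x z = c *s y z" if z: "z \<in> X" for z
  proof (cases "z = (v, n0)")
    case True
    have "(\<Prod>w\<in>W. \<mu> x w $ j) = (\<Prod>w\<in>W. c w) * y z $ j" for j
    proof -
      have "(\<Prod>w\<in>W. tgt w $ j) = (\<Prod>w\<in>W. if w = w0 then y z $ j else 1)"
        using z True by (intro prod.cong) (auto simp: tgt_def)
      also have "\<dots> = y z $ j" using w0 by simp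
      finally show ?thesis using c(2) by (simp add: prod.distrib)
    qed
    then have "\<Phi>' x z = (\<Prod>w\<in>W. c w) *s y z" using True by (simp add: \<Phi>'_def vec_eq_iff)
    moreover have "(\<Prod>w\<in>W. c w) \<noteq> 0" using c(1) by simp
    ultimately show ?thesis by blast
  next
    case False
    then show ?thesis using x(1) z by (auto simp: \<Phi>'_def)
  qed
  then show "\<exists>x. \<forall>z\<in>X. \<exists>c. c \<noteq> 0 \<and> \<Phi>' x z = c *s y z" by blast
qed

lemma generic_\<mu>_nonzero: "w \<in> W \<Longrightarrow> generic (\<lambda>x. \<mu> x w \<noteq> 0)"
proof -
  assume w: "w \<in> W"
  have one: "(\<chi> j. (1 :: 'k)) \<noteq> (0 :: ('k, 'd) vec)" by (simp add: vec_eq_iff)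
  have "\<exists>x. (\<forall>z\<in>{}. \<exists>c. c \<noteq> 0 \<and> \<Phi> x z = c *s 0) \<and> (\<forall>w\<in>W. \<exists>c. c \<noteq> 0 \<and> \<mu> x w = c *s (\<chi> j. 1))"
    by (rule realize[of "{}" "\<lambda>_. 0" "\<lambda>_. \<chi> j. 1"]) (use one in \<open>auto simp: labels_at_def\<close>)
  then obtain x c where "c \<noteq> 0" "\<mu> x w = c *s (\<chi> j. 1)" using w by blast
  then have "\<mu> x w $ r0 \<noteq> 0" by simp
  then show ?thesis
    by (rule genericI[OF line_poly_\<mu>]) auto
qed

end

text \<open>The spanning hypothesis is kept apart from \<open>prescribable\<close> because vertices
  leave \<open>U\<close> with every edge, while their forms must stay in general position. The
  finitely many choices of \<open>X\<close> lead to different forms c, and all resulting conditions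
  are met at one common parameter.\<close>

theorem generic_good_position:
  fixes \<Phi> :: "('z \<Rightarrow> 'k::field ^ 'd) \<Rightarrow> 'n::finite \<times> nat \<Rightarrow> 'k ^ 'd::finite"
  assumes inf: "infinite (UNIV :: 'k set)"
    and "rooted_forest ps" "finite L" "\<And>z j. line_poly (\<lambda>x. \<Phi> x z $ j)"
    and "prescribable U L \<Phi>" "vertices ps \<subseteq> U"
    and "\<And>u X. X \<subseteq> labels_at L u \<Longrightarrow> card X = CARD('d) \<Longrightarrow>
      \<exists>x. vec.span ((\<lambda>n. \<Phi> x (u, n)) ` X) = UNIV"
  shows "generic (\<lambda>x. good_position ps L (\<Phi> x))"
  using assms(2-)
proof (induction ps arbitrary: U L \<Phi>)
  case Nil
  then show ?case unfolding good_position.simps by (intro generic_general_position[OF inf]) auto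
next
  case (Cons p ps)
  obtain v W where p: "p = (v, W)" by force
  note finL = Cons.prems(2) and lp = Cons.prems(3) and span = Cons.prems(6)
  have forest: "v \<notin> W" "W \<noteq> {}" "W \<inter> vertices ps = {}" "rooted_forest ps"
    using Cons.prems(1) p by auto
  have U: "W \<subseteq> U" "v \<in> U - W" "vertices ps \<subseteq> U - W" using Cons.prems(5) forest p by auto
  obtain n0 where n0: "(v, n0) \<notin> L"
  proof -
    have "\<exists>n. n \<notin> labels_at L v" using finite_labels_at[OF finL] by (metis ex_new_if_finite infinite_UNIV_nat)
    then show thesis using that by (auto simp: labels_at_def)
  qed
  \<comment> \<open>Any index can be the free row; the d - 1 elements of \<open>X w\<close> are
    indexed by the others.\<close>
  obtain r0 :: 'd where True by simp
  let ?good = "\<lambda>X x. \<exists>n \<mu>. (v, n) \<notin> L \<and>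
    (\<forall>w\<in>W. \<mu> w \<noteq> 0 \<and> (\<forall>m\<in>X w. (\<Sum>j\<in>UNIV. \<Phi> x (w, m) $ j * \<mu> w $ j) = 0)) \<and>
    good_position ps (insert (v, n) L) ((\<Phi> x)((v, n) := \<chi> j. \<Prod>w\<in>W. \<mu> w $ j))"
  let ?XS = "{X \<in> PiE UNIV (\<lambda>w. Pow (labels_at L w)). \<forall>w\<in>W. card (X w) = CARD('d) - 1}"
  have "finite (PiE UNIV (\<lambda>w. Pow (labels_at L w)))"
    by (intro finite_PiE) (auto intro: finite_labels_at finL)
  then have fin: "finite ?XS" by simp
  have "generic (?good X)" if X: "X \<in> ?XS" for X
  proof -
    have "\<exists>e. bij_betw e (UNIV - {r0}) (X w)" if "w \<in> W" for w
    proof -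
      have "X w \<subseteq> labels_at L w" using X by auto
      then have "finite (X w)" using finite_labels_at[OF finL] finite_subset by blast
      moreover have "card (UNIV - {r0}) = card (X w)" using X that by (simp add: card_Diff_singleton)
      ultimately show ?thesis using finite_same_card_bij[of "UNIV - {r0}" "X w"] by auto
    qed
    then obtain e where be: "\<And>w. w \<in> W \<Longrightarrow> bij_betw (e w) (UNIV - {r0}) (X w)" by metis
    interpret attach_edge U L v W n0 \<Phi> e r0
    proof
      show "inj_on (e w) (UNIV - {r0})" if "w \<in> W" for w
        using be[OF that] by (rule bij_betw_imp_inj_on)
      show "(w, e w r) \<in> L" if "w \<in> W" "r \<noteq> r0" for w r
      proof -
        have "e w r \<in> X w" using bij_betwE[OF be[OF that(1)]] that(2) by auto
        then have "e w r \<in> labels_at L w" using X by auto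
        then show ?thesis by (simp add: labels_at_def)
      qed
    qed (use finL Cons.prems(4) lp U forest n0 in auto)
    have "generic (\<lambda>x. good_position ps (insert (v, n0) L) (\<Phi>' x))"
    proof (rule Cons.IH[OF forest(4) _ line_poly_\<Phi>' prescribable_step U(3)])
      fix u Y assume Y: "Y \<subseteq> labels_at (insert (v, n0) L) u" "card Y = CARD('d)"
      show "\<exists>x. vec.span ((\<lambda>n. \<Phi>' x (u, n)) ` Y) = UNIV"
      proof (cases "u = v")
        case True
        then show ?thesis using prescribable_span[OF prescribable_step _ Y] U(2) by blast
      next
        case False
        then have "Y \<subseteq> labels_at L u" using Y(1) by (simp add: labels_at_insert)
        from span[OF this Y(2)] show ?thesis using False by (simp add: \<Phi>'_def)
      qed
    qed (simp add: finL)
    moreover have "generic (\<lambda>x. \<forall>w\<in>W. \<mu> x w \<noteq> 0)"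
      by (rule generic_finite_all[OF inf]) (auto intro: generic_\<mu>_nonzero)
    ultimately have "generic (\<lambda>x. good_position ps (insert (v, n0) L) (\<Phi>' x) \<and> (\<forall>w\<in>W. \<mu> x w \<noteq> 0))"
      by (rule generic_conj[OF inf])
    then show ?thesis
    proof (rule generic_mono)
      fix x assume x: "good_position ps (insert (v, n0) L) (\<Phi>' x) \<and> (\<forall>w\<in>W. \<mu> x w \<noteq> 0)"
      have "(\<Sum>j\<in>UNIV. \<Phi> x (w, m) $ j * \<mu> x w $ j) = 0" if wm: "w \<in> W" "m \<in> X w" for w m
      proof -
        obtain r where r: "r \<noteq> r0" "m = e w r"
          using bij_betw_imp_surj_on[OF be[OF wm(1)]] wm(2) by auto
        show ?thesis unfolding r(2) \<mu>_def
          using cofactors_orthogonal[OF r(1), of "\<lambda>r. \<Phi> x (w, e w r)"] .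
      qed
      then show "?good X x"
        using x n0 unfolding \<Phi>'_def by (intro exI[of _ n0] exI[of _ "\<mu> x"]) auto
    qed
  qed
  then have "generic (\<lambda>x. \<forall>X\<in>?XS. ?good X x)" by (rule generic_finite_all[OF inf fin])
  then show ?case unfolding p good_position.simps
  proof (rule generic_mono, intro allI impI)
    fix x X assume *: "\<forall>X\<in>?XS. ?good X x"
      and X: "\<forall>w\<in>W. X w \<subseteq> labels_at L w \<and> card (X w) = CARD('d) - 1"
    \<comment> \<open>\<open>X\<close> is arbitrary outside \<open>W\<close>; normalizing it there
      puts it into the finite set \<open>?XS\<close>.\<close>
    let ?X = "\<lambda>w. if w \<in> W then X w else {}"
    have "?X \<in> ?XS" using X by (auto simp: PiE_UNIV_domain Pi_iff)
    from bspec[OF * this] show "?good X x" by simp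
  qed
qed

text \<open>The parameters are the forms themselves, d at each vertex, so that initially every form
  can be chosen at will.\<close>

lemma exists_good_position:
  fixes ps :: "('n::finite \<times> 'n set) list"
  assumes "infinite (UNIV :: 'k::field set)" "rooted_forest ps"
  shows "\<exists>\<phi> :: 'n \<times> nat \<Rightarrow> 'k ^ 'd::finite. good_position ps (UNIV \<times> {..<CARD('d)}) \<phi>"
proof -
  let ?L = "UNIV \<times> {..<CARD('d)} :: ('n \<times> nat) set"
  let ?\<Phi> = "\<lambda>x :: 'n \<times> nat \<Rightarrow> 'k ^ 'd. x"
  have pre: "prescribable UNIV ?L ?\<Phi>"
    unfolding prescribable_def
  proof (intro allI impI)
    fix X :: "('n \<times> nat) set" and y :: "'n \<times> nat \<Rightarrow> 'k ^ 'd"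
    show "\<exists>x. \<forall>z\<in>X. \<exists>c. c \<noteq> 0 \<and> x z = c *s y z"
      by (intro exI[of _ y] ballI exI[of _ 1]) simp
  qed
  have "generic (\<lambda>x. good_position ps ?L (?\<Phi> x))"
  proof (rule generic_good_position[OF assms _ _ pre])
    show "\<exists>x. vec.span ((\<lambda>n. ?\<Phi> x (u, n)) ` X) = UNIV"
      if "X \<subseteq> labels_at ?L u" "card X = CARD('d)" for u X
      by (rule prescribable_span[OF pre UNIV_I that])
  qed auto
  then show ?thesis by (rule generic_ex)
qed

subsection \<open>Monomial ideals given by supports\<close>

text \<open>For an upward closed \<open>F\<close> this is a squarefree monomial ideal, described so
  that its graded pieces visibly have bases of monomials.\<close>

definition support_ideal :: "('n \<times> 'd) set set \<Rightarrow> ('n, 'd, 'k::comm_ring_1) mpoly set" where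
  "support_ideal F = {p. \<forall>m\<in>keys p. keys m \<in> F}"

lemma is_ideal_support_ideal:
  fixes F :: "('n \<times> 'd) set set"
  assumes up: "\<And>P P'. P \<in> F \<Longrightarrow> P \<subseteq> P' \<Longrightarrow> P' \<in> F"
  shows "is_ideal (support_ideal F :: ('n, 'd, 'k::comm_ring_1) mpoly set)"
  unfolding is_ideal_def
proof (rule module.subspaceI[OF module_mult])
  fix p q :: "('n, 'd, 'k) mpoly"
  assume p: "p \<in> support_ideal F"
  show "q * p \<in> support_ideal F"
    unfolding support_ideal_def
  proof (intro CollectI ballI)
    fix m assume "m \<in> keys (q * p)"
    then obtain m1 m2 where "m = m1 + m2" "m2 \<in> keys p"
      using keys_mult[of q p] by blast
    then show "keys m \<in> F"
      using p up[of "keys m2" "keys m"]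
      by (auto simp: support_ideal_def keys_add_nat)
  qed
  show "p + q \<in> support_ideal F" if "q \<in> support_ideal F"
    using p that Poly_Mapping.keys_add[of p q] by (auto simp: support_ideal_def)
qed (simp add: support_ideal_def)

lemma is_graded_support_ideal:
  fixes F :: "('n \<times> 'd::finite) set set"
  assumes "\<And>P P'. P \<in> F \<Longrightarrow> P \<subseteq> P' \<Longrightarrow> P' \<in> F"
  shows "is_graded_ideal (support_ideal F :: ('n, 'd, 'k::comm_ring_1) mpoly set)"
  using is_ideal_support_ideal[OF assms] keys_hom_component
  unfolding is_graded_ideal_def by (fastforce simp: support_ideal_def)

text \<open>For \<open>Q \<notin> F\<close> the ideal is contained in the prime ideal of the variables outside \<open>Q\<close>, the kernel
  of the substitution of these variables by zero.\<close>

lemma is_radical_support_ideal: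
  fixes F :: "('n::finite \<times> 'd::finite) set set"
  assumes up: "\<And>P P'. P \<in> F \<Longrightarrow> P \<subseteq> P' \<Longrightarrow> P' \<in> F"
  shows "is_radical (support_ideal F :: ('n, 'd, 'k::field) mpoly set)"
  unfolding is_radical_def
proof (intro allI impI)
  fix p :: "('n, 'd, 'k) mpoly" and k
  assume pk: "p ^ k \<in> support_ideal F"
  show "p \<in> support_ideal F"
    unfolding support_ideal_def
  proof (intro CollectI ballI, rule ccontr)
    fix m assume m: "m \<in> keys p" "keys m \<notin> F"
    let ?Q = "keys m"
    define \<psi> where "\<psi> i j = (if (i, j) \<in> ?Q then var i j else 0 :: ('n, 'd, 'k) mpoly)" for i j
    have mono: "monomial_subst \<psi> m' = (if keys m' \<subseteq> ?Q then single m' 1 else 0)" for m'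
    proof (cases "keys m' \<subseteq> ?Q")
      case True
      have "\<psi> i j ^ lookup m' (i, j) = var i j ^ lookup m' (i, j)" for i j
      proof (cases "(i, j) \<in> keys m'")
        case True
        then have "(i, j) \<in> ?Q" using \<open>keys m' \<subseteq> ?Q\<close> by blast
        then show ?thesis by (simp add: \<psi>_def)
      qed (simp add: in_keys_iff)
      then have "monomial_subst \<psi> m' = monomial_subst var m'" by (simp add: monomial_subst_def)
      also have "\<dots> = poly_subst var (single m' 1)" by (simp add: poly_subst_single)
      also have "\<dots> = single m' 1"
      proof -
        have "poly_subst var q = q" for q :: "('n, 'd, 'k) mpoly"
          by (induction q rule: mpoly_induct)
            (simp_all add: poly_subst_const poly_subst_var poly_subst_add poly_subst_mult)
        then show ?thesis .
      qed
      finally show ?thesis using True by simp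
    next
      case False
      then obtain i j where "(i, j) \<in> keys m'" "(i, j) \<notin> ?Q" by auto
      then have "\<psi> i j ^ lookup m' (i, j) = 0"
        by (simp add: \<psi>_def in_keys_iff zero_power)
      then have "monomial_subst \<psi> m' = 0" unfolding monomial_subst_def
        by (intro prod_zero) auto
      then show ?thesis using False by simp
    qed
    have subst: "poly_subst \<psi> q = (\<Sum>m'\<in>keys q.
        if keys m' \<subseteq> ?Q then single m' (lookup q m') else 0)" for q
      unfolding poly_subst_eq_monomial_subst mono
      by (intro sum.cong refl) (auto simp: const_def mult_single)
    have "lookup (poly_subst \<psi> p) m =
        (\<Sum>m'\<in>keys p. if m' = m then lookup p m else 0)"
      unfolding subst lookup_sum by (intro sum.cong refl) (auto simp: lookup_single when_def)
    also have "\<dots> \<noteq> 0" using m(1) by (simp add: sum.delta in_keys_iff)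
    finally have "poly_subst \<psi> p \<noteq> 0" by auto
    then have "poly_subst \<psi> (p ^ k) \<noteq> 0"
    proof (induction k)
      case 0
      have "poly_subst \<psi> 1 = 1" using poly_subst_const[of \<psi> 1] by simp
      then show ?case by simp
    next
      case (Suc k)
      then show ?case using mpoly_no_zero_divisors by (auto simp: poly_subst_mult)
    qed
    moreover have "poly_subst \<psi> (p ^ k) = 0"
    proof -
      have "\<not> keys m' \<subseteq> ?Q" if "m' \<in> keys (p ^ k)" for m'
        using that pk m(2) up by (auto simp: support_ideal_def)
      then show ?thesis unfolding subst by (intro sum.neutral) auto
    qed
    ultimately show False by simp
  qed
qed

text \<open>The image of x_ij is a combination of the x_ik with k \<le> j, and it divides the image
  of every monomial that contains x_ij. So each monomial in the image of m contains, for every x_ij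
  in m, some x_ij' with j' \<le> j, and the exchange property applies.\<close>

lemma borel_fixed_support_ideal:
  fixes F :: "('n::finite \<times> 'd::{finite,linorder}) set set"
  assumes exchange: "\<And>P P'. P \<in> F \<Longrightarrow> (\<And>i j. (i, j) \<in> P \<Longrightarrow> \<exists>j'\<le>j. (i, j') \<in> P') \<Longrightarrow> P' \<in> F"
  shows "borel_fixed (support_ideal F :: ('n, 'd, 'k::field) mpoly set)"
  unfolding borel_fixed_def
proof (intro allI impI subsetI, elim imageE)
  fix g and p q :: "('n, 'd, 'k) mpoly"
  assume g: "\<forall>i. g i \<in> borel_group" and p: "p \<in> support_ideal F" and q: "q = gl_act g p"
  let ?\<psi> = "\<lambda>i j. \<Sum>k\<in>UNIV. const (g i $ k $ j) * var i k :: ('n, 'd, 'k) mpoly"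
  have ideal_F: "is_ideal (support_ideal F :: ('n, 'd, 'k) mpoly set)"
    by (rule is_ideal_support_ideal) (rule exchange, auto)
  have "monomial_subst ?\<psi> m \<in> support_ideal F" if m: "m \<in> keys p" for m
    unfolding support_ideal_def
  proof (intro CollectI ballI, rule exchange)
    show "keys m \<in> F" using p m by (simp add: support_ideal_def)
    fix m' i j
    assume m': "m' \<in> keys (monomial_subst ?\<psi> m)" and ij: "(i, j) \<in> keys m"
    \<comment> \<open>The supports of the monomials in the ideal generated by the x_ik with k \<le>
      j.\<close>
    let ?G = "{P. \<exists>j'\<le>j. (i, j') \<in> P}"
    have ideal_G: "is_ideal (support_ideal ?G :: ('n, 'd, 'k) mpoly set)"
      by (rule is_ideal_support_ideal) auto
    have "?\<psi> i j \<in> support_ideal ?G"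
    proof (rule ideal_sum[OF ideal_G])
      fix k
      show "const (g i $ k $ j) * var i k \<in> support_ideal ?G"
      proof (cases "k \<le> j")
        case True
        then have "var i k \<in> support_ideal ?G" by (auto simp: support_ideal_def var_def)
        then show ?thesis by (rule ideal_mult[OF ideal_G])
      next
        case False
        then have "g i $ k $ j = 0" using g by (auto simp: borel_group_def)
        then show ?thesis by (simp add: ideal_0[OF ideal_G])
      qed
    qed
    moreover have "monomial_subst ?\<psi> m = ?\<psi> i j *
        (?\<psi> i j ^ (lookup m (i, j) - 1) *
          (\<Prod>(i', j')\<in>UNIV - {(i, j)}. ?\<psi> i' j' ^ lookup m (i', j')))"
    proof -
      have "?\<psi> i j ^ lookup m (i, j) =
          ?\<psi> i j * ?\<psi> i j ^ (lookup m (i, j) - 1)"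
        using ij by (intro power_eq_if[THEN trans]) (simp add: in_keys_iff)
      then show ?thesis
        unfolding monomial_subst_def by (subst prod.remove[of UNIV "(i, j)"]) (simp_all add: mult.assoc)
    qed
    ultimately have "monomial_subst ?\<psi> m \<in> support_ideal ?G"
      using ideal_mult_right[OF ideal_G] by simp
    then show "\<exists>j'\<le>j. (i, j') \<in> keys m'" using m' by (simp add: support_ideal_def)
  qed
  then show "q \<in> support_ideal F"
    unfolding q gl_act_def poly_subst_eq_monomial_subst
    by (intro ideal_sum[OF ideal_F] ideal_mult[OF ideal_F])
qed

lemma hilbert_series_support_ideal:
  "hilbert_series (support_ideal F :: ('n::finite, 'd::finite, 'k::field) mpoly set) a =
    card {m :: ('n, 'd) mon. mdeg m = a \<and> keys m \<in> F}"
proof -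
  have "support_ideal F \<inter> graded_piece a =
      {p :: ('n, 'd, 'k) mpoly. keys p \<subseteq> {m. mdeg m = a \<and> keys m \<in> F}}"
    by (auto simp: support_ideal_def graded_piece_def)
  then show ?thesis
    by (simp add: hilbert_series_def dim_keys_subset(1)[OF finite_mdeg_subset])
qed

lemma hilbert_series_support_ideal_supports:
  "hilbert_series (support_ideal (supports ps) :: ('n::finite, 'd::{finite,linorder}, 'k::field) mpoly set) a =
    monomial_count ps (\<lambda>u. 0) TYPE('d) a"
proof -
  have "truncated_supports ps (\<lambda>u. 0) = (supports ps :: ('n \<times> 'd) set set)"
    by (simp add: truncated_supports_def var_pos_less[unfolded not_le[symmetric]])
  then show ?thesis by (simp add: hilbert_series_support_ideal monomial_count_def)
qed

subsection \<open>Extension of the base field\<close>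

definition map_coeffs :: "('k::comm_ring_1 \<Rightarrow> 'l::comm_ring_1) \<Rightarrow> ('n, 'd, 'k) mpoly \<Rightarrow> ('n, 'd, 'l) mpoly" where
  "map_coeffs \<iota> p = (\<Sum>m\<in>keys p. single m (\<iota> (lookup p m)))"

lemma lookup_map_coeffs:
  assumes "\<iota> 0 = 0"
  shows "lookup (map_coeffs \<iota> p) m = \<iota> (lookup p m)"
  using assms by (auto simp: map_coeffs_def lookup_sum lookup_single when_def sum.delta in_keys_iff)

text \<open>Spans the part of the ideal in degree \<open>a\<close>, by elements that are given by
  the same formula over every field.\<close>

definition lss_multiples :: "'n set set \<Rightarrow> ('n \<Rightarrow> int) \<Rightarrow> ('n::finite, 'd::finite, 'k::field) mpoly set" where
  "lss_multiples E a = (\<lambda>(e, m). single m 1 * lss_poly e) `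
    (SIGMA e:E. {m. mdeg m = (\<lambda>i. a i - (if i \<in> e then 1 else 0))})"

lemma finite_lss_multiples: "finite (lss_multiples E a)"
  unfolding lss_multiples_def by (intro finite_imageI finite_SigmaI finite_mdeg_eq) auto

lemma lss_ideal_piece_span:
  fixes E :: "'n::finite set set"
  shows "(lss_ideal E :: ('n, 'd::finite, 'k::field) mpoly set) \<inter> graded_piece a =
    mpoly.span (lss_multiples E a)"
proof (intro antisym subsetI)
  fix p :: "('n, 'd, 'k) mpoly"
  assume p: "p \<in> lss_ideal E \<inter> graded_piece a"
  have "hom_component a q \<in> mpoly.span (lss_multiples E a)" if "q \<in> lss_ideal E" for q :: "('n, 'd, 'k) mpoly"
    using that unfolding lss_ideal_def
  proof (induction rule: ideal_gen_induct)
    case zero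
    show ?case by (simp add: mpoly.span_zero)
  next
    case (step c f q)
    then obtain e where e: "e \<in> E" "f = lss_poly e" by auto
    let ?b = "\<lambda>i. a i - (if i \<in> e then 1 else 0)"
    let ?c = "hom_component ?b c"
    have "hom_component a (c * f) = ?c * f"
      using hom_component_mult[OF lss_poly_piece, of a e c] e by (simp add: mult.commute)
    also have "\<dots> = (\<Sum>m\<in>keys ?c.
        pscale (lookup ?c m) (single m 1 * f))"
      by (subst mpoly_expansion[of ?c])
        (simp add: sum_distrib_right pscale_def single_eq_const_mult[of _ "lookup _ _"] mult.assoc)
    also have "\<dots> \<in> mpoly.span (lss_multiples E a)"
    proof (intro mpoly.span_sum mpoly.span_scale mpoly.span_base)
      fix m assume "m \<in> keys ?c"
      then have "mdeg m = ?b" using hom_component_in_piece[of ?b c] by (auto simp: graded_piece_def)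
      then show "single m 1 * f \<in> lss_multiples E a"
        using e unfolding lss_multiples_def by (intro image_eqI[of _ _ "(e, m)"]) auto
    qed
    finally show ?case using step by (simp add: hom_component_add mpoly.span_add)
  qed
  then show "p \<in> mpoly.span (lss_multiples E a)"
    using p hom_component_id[of p a] by (metis IntD1 IntD2)
next
  have "lss_multiples E a \<subseteq> (lss_ideal E :: ('n, 'd, 'k) mpoly set) \<inter> graded_piece a"
  proof
    fix p :: "('n, 'd, 'k) mpoly"
    assume "p \<in> lss_multiples E a"
    then obtain e m where em: "e \<in> E" "mdeg m = (\<lambda>i. a i - (if i \<in> e then 1 else 0))"
      "p = single m 1 * lss_poly e"
      by (auto simp: lss_multiples_def)
    have "single m (1 :: 'k) \<in> graded_piece (mdeg m)" by (simp add: graded_piece_def)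
    then have "p \<in> graded_piece a"
      unfolding em(3) by (rule graded_piece_mult[OF _ lss_poly_piece]) (simp add: em(2))
    moreover have "p \<in> lss_ideal E" unfolding em(3) lss_ideal_def
      using em(1) by (intro ideal_mult is_ideal_ideal_gen ideal_gen_base) auto
    ultimately show "p \<in> lss_ideal E \<inter> graded_piece a" by simp
  qed
  moreover have "mpoly.subspace ((lss_ideal E :: ('n, 'd, 'k) mpoly set) \<inter> graded_piece a)"
    unfolding lss_ideal_def
    using subspace_ideal[OF is_ideal_ideal_gen] subspace_graded_piece by (rule mpoly.subspace_inter)
  ultimately show "p \<in> lss_ideal E \<inter> graded_piece a" if "p \<in> mpoly.span (lss_multiples E a)"
    for p :: "('n, 'd, 'k) mpoly"
    using that mpoly.span_minimal by blast
qed

locale field_extension =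
  fixes \<iota> :: "'k::field \<Rightarrow> 'l::field"
  assumes \<iota>_add: "\<iota> (x + y) = \<iota> x + \<iota> y" and \<iota>_mult: "\<iota> (x * y) = \<iota> x * \<iota> y" and \<iota>_1: "\<iota> 1 = 1"
begin

lemma \<iota>_0: "\<iota> 0 = 0"
proof -
  have "\<iota> 0 + 0 = \<iota> 0 + \<iota> 0" using \<iota>_add[of 0 0] by simp
  then show ?thesis by (simp only: add_left_cancel)
qed

abbreviation "em \<equiv> map_coeffs \<iota> :: ('n, 'd, 'k) mpoly \<Rightarrow> ('n, 'd, 'l) mpoly"

lemma em_add: "em (p + q) = em p + em q"
  by (rule poly_mapping_eqI) (simp add: lookup_map_coeffs \<iota>_0 lookup_add \<iota>_add)

lemma em_0: "em 0 = 0"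
  by (rule poly_mapping_eqI) (simp add: lookup_map_coeffs \<iota>_0)

lemma em_pscale: "em (pscale c p) = pscale (\<iota> c) (em p)"
  by (rule poly_mapping_eqI) (simp add: lookup_map_coeffs \<iota>_0 pscale_def lookup_const_mult \<iota>_mult)

lemma em_sum: "em (sum f A) = (\<Sum>x\<in>A. em (f x))"
  by (induction A rule: infinite_finite_induct) (simp_all add: em_0 em_add)

lemma em_single: "em (single m 1) = single m 1"
  by (rule poly_mapping_eqI) (simp add: lookup_map_coeffs \<iota>_0 lookup_single when_def \<iota>_1)

lemma em_multiple:
  "em (single m 1 * lss_poly e) = single m 1 * lss_poly e"
  by (simp add: lss_poly_def sum_distrib_left em_sum var_def prod_single_power mult_single em_single)

lemma em_image_multiples: "em ` lss_multiples E a = lss_multiples E a"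
  unfolding lss_multiples_def image_image
  by (intro image_cong refl) (auto simp: em_multiple)

text \<open>A linear functional \<open>\<theta>\<close> on \<open>'l\<close> over \<open>'k\<close>, applied to the coefficients, turns a linear relation
  over \<open>'l\<close> into a linear relation over \<open>'k\<close>.\<close>

lemma functional_exists:
  assumes "x \<noteq> 0"
  obtains \<theta> :: "'l \<Rightarrow> 'k" where "\<And>x y. \<theta> (x + y) = \<theta> x + \<theta> y" "\<And>c x. \<theta> (x * \<iota> c) = c * \<theta> x" "\<theta> x = 1"
proof -
  interpret pair: vector_space_pair "\<lambda>c x. \<iota> c * x" "(*) :: 'k \<Rightarrow> 'k \<Rightarrow> 'k"
    by unfold_locales (simp_all add: algebra_simps \<iota>_add \<iota>_mult \<iota>_1)
  have "pair.vs1.independent {x}" using assms by simp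
  then obtain \<theta> where \<theta>: "Vector_Spaces.linear (\<lambda>c x. \<iota> c * x) (*) \<theta>" "\<theta> x = 1"
    using pair.linear_independent_extend[of "{x}" "\<lambda>_. 1"] by auto
  interpret \<theta>: Vector_Spaces.linear "\<lambda>c x. \<iota> c * x" "(*)" \<theta> by (rule \<theta>)
  show thesis
    by (rule that[of \<theta>]) (use \<theta>.add \<theta>.scale \<theta>(2) in \<open>simp_all add: mult.commute\<close>)
qed

lemma em_independent:
  fixes B :: "('n, 'd, 'k) mpoly set"
  assumes fin: "finite B" and ind: "mpoly.independent B"
  shows "inj_on em B" "mpoly.independent (em ` B)"
proof -
  show inj: "inj_on em B"
  proof (rule inj_onI)
    fix p q assume eq: "em p = em q"
    show "p = q"
    proof (rule ccontr)
      assume "p \<noteq> q"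
      then obtain m where m: "lookup (p - q) m \<noteq> 0"
        by (metis poly_mapping_eqI lookup_zero right_minus_eq)
      have "em (p - q) + em q = em p" by (simp flip: em_add)
      then have "em (p - q) = 0" using eq by simp
      then have "\<iota> (lookup (p - q) m) = 0"
        by (metis lookup_map_coeffs \<iota>_0 lookup_zero)
      then have "\<iota> (lookup (p - q) m * inverse (lookup (p - q) m)) = 0"
        by (simp add: \<iota>_mult)
      then show False using m \<iota>_1 by simp
    qed
  qed
  show "mpoly.independent (em ` B)"
  proof (rule mpoly.independent_if_scalars_zero)
    show "finite (em ` B)" using fin by simp
    fix f x assume 0: "(\<Sum>x\<in>em ` B. pscale (f x) x) = 0" and "x \<in> em ` B"
    then obtain b where b: "b \<in> B" "x = em b" by auto
    show "f x = 0"
    proof (rule ccontr)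
      assume "f x \<noteq> 0"
      then obtain \<theta> :: "'l \<Rightarrow> 'k" where \<theta>: "\<And>x y. \<theta> (x + y) = \<theta> x + \<theta> y"
        "\<And>c x. \<theta> (x * \<iota> c) = c * \<theta> x" "\<theta> (f x) = 1"
        using functional_exists by blast
      have \<theta>0: "\<theta> 0 = 0" using \<theta>(2)[of 0 0] by (simp add: \<iota>_0)
      have \<theta>sum: "\<theta> (sum h A) = (\<Sum>x\<in>A. \<theta> (h x))" for h and A :: "('n, 'd, 'k) mpoly set"
        by (induction A rule: infinite_finite_induct) (simp_all add: \<theta>0 \<theta>(1))
      have "(\<Sum>b\<in>B. pscale (\<theta> (f (em b))) b) = 0"
      proof (rule poly_mapping_eqI)
        fix m
        have "(\<Sum>b\<in>B. f (em b) * \<iota> (lookup b m)) =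
            lookup (\<Sum>x\<in>em ` B. pscale (f x) x) m"
          by (simp add: sum.reindex[OF inj] lookup_sum pscale_def lookup_const_mult lookup_map_coeffs \<iota>_0)
        then have "\<theta> (\<Sum>b\<in>B. f (em b) * \<iota> (lookup b m)) = 0" using 0 \<theta>0 by simp
        then show "lookup (\<Sum>b\<in>B. pscale (\<theta> (f (em b))) b) m = lookup 0 m"
          by (simp add: \<theta>sum \<theta>(2) lookup_sum pscale_def lookup_const_mult
              mult.commute[of "\<theta> _"])
      qed
      then have "\<theta> (f (em b)) = 0"
        using b(1)
        by (rule mpoly.independentD[OF ind fin subset_refl, where u = "\<lambda>b. \<theta> (f (em b))"])
      then show False using \<theta>(3) b(2) by simp
    qed
  qed
qed

text \<open>The same multiples span the graded pieces over both fields, and a maximal independent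
  subset over the small field remains independent and spanning over the large one.\<close>

lemma hilbert_series_lss_ideal_eq:
  fixes E :: "'n::finite set set"
  shows "hilbert_series (lss_ideal E :: ('n, 'd::finite, 'l) mpoly set) =
    hilbert_series (lss_ideal E :: ('n, 'd, 'k) mpoly set)"
proof
  fix a
  let ?M = "lss_multiples E a :: ('n, 'd, 'k) mpoly set"
  let ?M' = "lss_multiples E a :: ('n, 'd, 'l) mpoly set"
  obtain B where B: "B \<subseteq> ?M" "mpoly.independent B" "?M \<subseteq> mpoly.span B"
    using mpoly.maximal_independent_subset[of ?M] by blast
  have fin: "finite B" using B(1) finite_lss_multiples finite_subset by blast
  have em_span: "em p \<in> mpoly.span (em ` B)" if "p \<in> mpoly.span B" for p
    using that
  proof (induction rule: mpoly.span_induct_alt)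
    case base
    show ?case by (simp add: em_0 mpoly.span_zero)
  next
    case (step c x y)
    then have "em x \<in> mpoly.span (em ` B)" by (intro mpoly.span_base) simp
    then show ?case using step.IH unfolding em_add em_pscale by (intro mpoly.span_add mpoly.span_scale)
  qed
  have "em ` ?M \<subseteq> mpoly.span (em ` B)"
  proof
    fix p assume "p \<in> em ` ?M"
    then obtain q where "p = em q" "q \<in> ?M" by (rule imageE)
    then show "p \<in> mpoly.span (em ` B)" using em_span[of q] subsetD[OF B(3)] by simp
  qed
  moreover have "em ` B \<subseteq> em ` ?M" using B(1) by (rule image_mono)
  ultimately have "mpoly.dim ?M' = card (em ` B)"
    unfolding em_image_multiples
    using mpoly.dim_unique[OF _ _ em_independent(2)[OF fin B(2)] refl] by simp
  also have "\<dots> = card B" by (rule card_image[OF em_independent(1)[OF fin B(2)]])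
  also have "\<dots> = mpoly.dim ?M" using mpoly.dim_unique[OF B(1,3,2) refl] by simp
  finally show "hilbert_series (lss_ideal E :: ('n, 'd, 'l) mpoly set) a =
      hilbert_series (lss_ideal E :: ('n, 'd, 'k) mpoly set) a"
    by (simp add: hilbert_series_def lss_ideal_piece_span mpoly.dim_span)
qed

end

text \<open>The constants inside the field of rational functions, which is infinite even over a
  finite field.\<close>

lemma field_extension_fract: "field_extension (\<lambda>c :: 'k::field. Fraction_Field.Fract [:c:] 1)"
  by unfold_locales (simp_all add: One_fract_def one_pCons mult.commute)

lemma infinite_fract: "infinite (UNIV :: 'k::field poly fract set)"
proof -
  have "inj (\<lambda>n. Fraction_Field.Fract (Polynomial.monom (1 :: 'k) n) 1)"
    by (rule injI) (simp add: Fraction_Field.eq_fract monom_eq_iff')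
  then show ?thesis by (meson finite_imageD finite_subset infinite_UNIV_nat subset_UNIV)
qed

subsection \<open>Good forests\<close>

text \<open>The root of an edge is the vertex that it shares with the earlier ones, or any vertex if
  there is none; r > 1 makes \<open>W\<close> nonempty. Edges are added in front, so the last edge
  heads the list.\<close>

lemma good_forest_rooted:
  fixes E :: "'n set set"
  assumes "good_forest r E"
  obtains ps where "rooted_forest ps" "(\<lambda>(v, W). insert v W) ` set ps = E"
proof -
  obtain es where es: "set es = E"
    and one: "\<And>i. 1 \<le> i \<Longrightarrow> i \<le> length es - 1 \<Longrightarrow> card (\<Union>(set (take i es)) \<inter> es ! i) \<le> 1"
    and unif: "r > 1" "\<And>e. e \<in> E \<Longrightarrow> finite e \<and> card e = r"
    using assms unfolding good_forest_def uniform_hypergraph_def by auto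
  have "\<exists>ps. rooted_forest ps \<and> (\<lambda>(v, W). insert v W) ` set ps = set (take i es)" if "i \<le> length es" for i
    using that
  proof (induction i)
    case 0
    show ?case by (intro exI[of _ "[]"]) simp
  next
    case (Suc i)
    then obtain ps where ps: "rooted_forest ps" "(\<lambda>(v, W). insert v W) ` set ps = set (take i es)"
      by auto
    let ?e = "es ! i"
    have e: "finite ?e" "card ?e = r" using unif(2)[of ?e] es Suc.prems by auto
    have V: "vertices ps = \<Union>(set (take i es))"
      unfolding vertices_def ps(2)[symmetric] by (auto simp: case_prod_unfold)
    have "card (vertices ps \<inter> ?e) \<le> 1"
    proof (cases "i = 0")
      case False
      then show ?thesis using one[of i] Suc.prems V by simp
    qed (simp add: V)
    moreover have "finite (vertices ps \<inter> ?e)" using e(1) by simp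
    ultimately have "\<exists>v\<in>?e. vertices ps \<inter> ?e \<subseteq> {v}"
    proof (cases "vertices ps \<inter> ?e = {}")
      case True
      moreover obtain v where "v \<in> ?e" using e(2) unif(1) by fastforce
      ultimately show ?thesis by auto
    next
      case False
      assume fin: "finite (vertices ps \<inter> ?e)" and le: "card (vertices ps \<inter> ?e) \<le> 1"
      have "card (vertices ps \<inter> ?e) \<noteq> 0" using False fin by (simp only: card_eq_0_iff) simp
      then have "card (vertices ps \<inter> ?e) = 1" using le by linarith
      then obtain v where "vertices ps \<inter> ?e = {v}" by (rule card_1_singletonE)
      then show ?thesis by blast
    qed
    then obtain v where v: "v \<in> ?e" "vertices ps \<inter> ?e \<subseteq> {v}" by blast
    have "card (?e - {v}) = r - 1" using e v(1) by (simp add: card_Diff_singleton)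
    then have "?e - {v} \<noteq> {}" using unif(1) by (metis card.empty zero_less_diff less_irrefl)
    then have "rooted_forest ((v, ?e - {v}) # ps)" using ps(1) v(2) by auto
    moreover have "(\<lambda>(v, W). insert v W) ` set ((v, ?e - {v}) # ps) = set (take (Suc i) es)"
      using ps(2) v(1) Suc.prems by (simp add: take_Suc_conv_app_nth insert_absorb)
    ultimately show ?case by blast
  qed
  from this[of "length es"] show thesis using that es by auto
qed

lemma edge_polys_eq: "edge_polys ps = lss_poly ` ((\<lambda>(v, W). insert v W) ` set ps)"
  unfolding edge_polys_def image_image by (intro image_cong) auto

text \<open>The section by no forms is the ideal itself, and on the monomial side nothing is
  truncated.\<close>

lemma hilbert_series_lss_ideal_infinite:
  fixes ps :: "('n::finite \<times> 'n set) list"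
  assumes "infinite (UNIV :: 'k::field set)" "rooted_forest ps"
    and E: "(\<lambda>(v, W). insert v W) ` set ps = E"
  shows "hilbert_series (lss_ideal E :: ('n, 'd::{finite,linorder}, 'k) mpoly set) a =
    monomial_count ps (\<lambda>u. 0) TYPE('d) a"
proof -
  let ?L = "UNIV \<times> {..<CARD('d)} :: ('n \<times> nat) set"
  obtain \<phi> :: "'n \<times> nat \<Rightarrow> ('k, 'd) vec" where \<phi>: "good_position ps ?L \<phi>"
    using exists_good_position[OF assms(1,2)] by blast
  have "labels_at ?L u = {..<CARD('d)}" for u by (auto simp: labels_at_def)
  then have "hilbert_series (section_ideal ps {} \<phi>) a = monomial_count ps (\<lambda>u. card (labels_at {} u)) TYPE('d) a"
    by (intro hilbert_series_section_ideal[OF assms(2) _ _ \<phi>]) auto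
  moreover have "section_ideal ps {} \<phi> = lss_ideal E"
    by (simp add: section_ideal_def lss_ideal_def forms_def edge_polys_eq E)
  ultimately show ?thesis by (simp add: labels_at_def)
qed

theorem theorem3p4:
  fixes r :: nat
    and E :: "'n::finite set set"
  assumes "good_forest r E"
  shows "cartwright_sturmfels (lss_ideal E :: ('n, 'd::{finite,linorder}, 'k::field) mpoly set)"
proof -
  obtain ps where ps: "rooted_forest ps" "(\<lambda>(v, W). insert v W) ` set ps = E"
    using good_forest_rooted[OF assms] .
  \<comment> \<open>J lives over the given field; only the Hilbert series of the LSS ideal is
    computed over the rational function field.\<close>
  interpret field_extension "\<lambda>c :: 'k. Fraction_Field.Fract [:c:] 1" by (rule field_extension_fract)
  let ?J = "support_ideal (supports ps) :: ('n, 'd, 'k) mpoly set"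
  have "hilbert_series ?J = hilbert_series (lss_ideal E :: ('n, 'd, 'k) mpoly set)"
  proof
    fix a
    show "hilbert_series ?J a = hilbert_series (lss_ideal E :: ('n, 'd, 'k) mpoly set) a"
      unfolding hilbert_series_support_ideal_supports hilbert_series_lss_ideal_eq[symmetric]
      by (rule hilbert_series_lss_ideal_infinite[OF infinite_fract ps, symmetric])
  qed
  moreover have "is_graded_ideal ?J" by (rule is_graded_support_ideal[OF supports_mono])
  moreover have "is_radical ?J" by (rule is_radical_support_ideal[OF supports_mono])
  moreover have "borel_fixed ?J" by (rule borel_fixed_support_ideal[OF supports_exchange])
  moreover have "is_graded_ideal (lss_ideal E :: ('n, 'd, 'k) mpoly set)"
    unfolding lss_ideal_def by (rule is_graded_ideal_gen) (use lss_poly_piece in blast)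
  ultimately show ?thesis unfolding cartwright_sturmfels_def by blast
qed

end
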